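(* Assume $e_n(t)$ has compact support for each $n\in\mathbb{N}$. Let $\mathscr{S}$ be a subset of the family of all noncausal finite variation processes on $[0,L]$, $S$ a dense subset of $[0,L]$, and $h$ a map on $\mathscr{S}$. For $a\in\mathscr S$ let $d_{\rm u}Y_t=a(t)\,d_{\rm u}B_t+b(t)\,dt$. Then the following are equivalent: (i) $h(a)$ is identified for $a\in\mathscr{S}$ from $((e_n,d_{\rm u}Y))_{n\in\mathbb{N}}$. (ii) $h(a)$ is identified for $a\in\mathscr{S}$ from $(Y_t)_{t\in S}$.
   Context: $(B_t)_{t\in[0,\infty)}$ is a one-dimensional Brownian motion on a probability space $(\Omega,\mathcal F,P)$; $0<L\le\infty$, and $[0,L]$ means $[0,\infty)$ if $L=\infty$. $\lambda$ is Lebesgue measure. A random function on $[0,L]$ is a map $[0,L]\times\Omega\to\mathbb C$ measurable for the product of the Lebesgue $\sigma$-field and $\mathcal F$ (no adaptedness). A noncausal finite variation process is a real-valued random function almost all of whose paths are of bounded variation on $[0,L]$. $L^0(\Omega)$ is the space of a.s.-classes of a.s. finite complex random variables; $L^0(\Omega;E)$ likewise with values in a Banach space $E$. $\langle f,g\rangle=\int_0^L\overline f g\,d\lambda$; $B_t[e]=\int_0^te\,dB$ for $e\in L^2([0,L];\mathbb C)$. $(e_n)_{n\in\mathbb N}$ is a fixed complete orthonormal system (CONS) of $L^2([0,L];\mathbb C)$ and $b\in L^0(\Omega;L^2([0,L];\mathbb C))$ is fixed. Ogawa integral: for $f\in L^0(\Omega;L^2([0,L];\mathbb C))$ and a CONS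 $\varphi=(\varphi_m)$, $f$ is $\varphi$-integrable if $\sum_m\langle\varphi_m,f\rangle B_L[\varphi_m]$ converges in probability; $f$ is u-integrable for $L^2([0,L];\mathbb R)$ if it is $\varphi$-integrable for every CONS $\varphi$ of $L^2([0,L];\mathbb R)$ with sum independent of $\varphi$, the sum being written $\int_0^Lf\,d_{\rm u}B$; $\int_0^tf\,d_{\rm u}B$ is the integral of $f1_{[0,t]}$. All u-integrals here are for $L^2([0,L];\mathbb R)$. The stochastic Fourier coefficients are $(e_n,d_{\rm u}Y)=\int_0^L\overline{e_n}a\,d_{\rm u}B+\int_0^L\overline{e_n}b\,d\lambda$, and $Y_t=\int_0^ta\,d_{\rm u}B+\int_0^tb\,d\lambda$. Identification (in the wide sense): for an index set $\Lambda$ and a map $X:\mathscr S\to L^0(\Omega)^\Lambda$, $h(a)$ is identified for $a\in\mathscr S$ from $X(a)$ if there is a map $\mathcal T$ on ${\rm Im}(X)$ with $\mathcal T\circ X=h$ on $\mathscr S$. *)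

theory Defs
  imports "HOL-Probability.Probability"
begin

text \<open>
  The time set \<open>[0, L]\<close>, which is \<open>[0, \<infinity>)\<close> if \<open>L = \<infinity>\<close>.
\<close>

definition horizon :: "ereal \<Rightarrow> real set"
  where "horizon L = {t. 0 \<le> t \<and> ereal t \<le> L}"

section \<open>The Hilbert spaces \<open>L\<^sup>2([0, L])\<close>\<close>

text \<open>
  Elements of \<open>L\<^sup>2([0, L]; \<complex>)\<close> are represented by functions, and equality in \<open>L\<^sup>2\<close> is equality
  almost everywhere.  \<open>L\<^sup>2([0, L]; \<real>)\<close> is regarded as a set of complex functions with real values,
  so that one inner product serves for both spaces.
\<close>

definition L2 :: "ereal \<Rightarrow> (real \<Rightarrow> complex) set"
  where "L2 L = {f \<in> borel_measurable (lebesgue_on (horizon L)).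
                   integrable (lebesgue_on (horizon L)) (\<lambda>t. (norm (f t))\<^sup>2)}"

definition L2_real :: "ereal \<Rightarrow> (real \<Rightarrow> complex) set"
  where "L2_real L = {f \<in> L2 L. \<forall>t. f t \<in> \<real>}"

definition L2_inner :: "ereal \<Rightarrow> (real \<Rightarrow> complex) \<Rightarrow> (real \<Rightarrow> complex) \<Rightarrow> complex"
  where "L2_inner L f g = (LINT t|lebesgue_on (horizon L). cnj (f t) * g t)"

text \<open>Used with \<open>H = L2 L\<close> and with \<open>H = L2_real L\<close>.\<close>

definition is_CONS :: "ereal \<Rightarrow> (real \<Rightarrow> complex) set \<Rightarrow> (nat \<Rightarrow> real \<Rightarrow> complex) \<Rightarrow> bool"
  where "is_CONS L H \<phi> \<longleftrightarrow>
    (\<forall>m. \<phi> m \<in> H) \<and>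
    (\<forall>m n. L2_inner L (\<phi> m) (\<phi> n) = (if m = n then 1 else 0)) \<and>
    (\<forall>f\<in>H. (\<forall>m. L2_inner L (\<phi> m) f = 0) \<longrightarrow> (AE t in lebesgue_on (horizon L). f t = 0))"

text \<open>The support of an element of \<open>L\<^sup>2\<close> is understood up to null sets.\<close>

definition compactly_supported :: "ereal \<Rightarrow> (real \<Rightarrow> complex) \<Rightarrow> bool"
  where "compactly_supported L f \<longleftrightarrow>
    (\<exists>K. compact K \<and> K \<subseteq> horizon L \<and> (AE t in lebesgue_on (horizon L). t \<notin> K \<longrightarrow> f t = 0))"

section \<open>Random variables and random functions\<close>

text \<open>
  The element of \<open>L\<^sup>0(\<Omega>)\<close> given by a complex random variable: its class modulo almost sure equality.
\<close>

definition L0_class :: "'w measure \<Rightarrow> ('w \<Rightarrow> complex) \<Rightarrow> ('w \<Rightarrow> complex) set"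
  where "L0_class M Z = {Z' \<in> borel_measurable M. AE w in M. Z' w = Z w}"

definition tendsto_in_prob :: "'w measure \<Rightarrow> (nat \<Rightarrow> 'w \<Rightarrow> complex) \<Rightarrow> ('w \<Rightarrow> complex) \<Rightarrow> bool"
  where "tendsto_in_prob M X Z \<longleftrightarrow>
    (\<forall>\<epsilon>>0. (\<lambda>n. measure M {w \<in> space M. norm (X n w - Z w) > \<epsilon>}) \<longlonglongrightarrow> 0)"

text \<open>
  Since \<open>L\<^sup>2([0, L]; \<complex>)\<close> is separable, the elements of \<open>L\<^sup>0(\<Omega>; L\<^sup>2([0, L]; \<complex>))\<close> are precisely those
  represented by a random function (measurable for the product of the Lebesgue \<open>\<sigma>\<close>-field and that
  of \<open>\<Omega>\<close>) with almost all paths in \<open>L\<^sup>2\<close>.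
\<close>

definition L0_L2 :: "'w measure \<Rightarrow> ereal \<Rightarrow> (real \<times> 'w \<Rightarrow> complex) set"
  where "L0_L2 M L = {f \<in> borel_measurable (lebesgue_on (horizon L) \<Otimes>\<^sub>M M).
                        AE w in M. (\<lambda>t. f (t, w)) \<in> L2 L}"

text \<open>
  The total variation is taken over all of \<open>I\<close>, so for \<open>I = [0, \<infinity>)\<close> this is more than bounded
  variation on every compact interval.
\<close>

definition bounded_variation_on :: "real set \<Rightarrow> (real \<Rightarrow> real) \<Rightarrow> bool"
  where "bounded_variation_on I f \<longleftrightarrow>
    (\<exists>C. \<forall>n (x :: nat \<Rightarrow> real). mono_on {..n} x \<longrightarrow> x ` {..n} \<subseteq> I \<longrightarrow>
       (\<Sum>i<n. \<bar>f (x (Suc i)) - f (x i)\<bar>) \<le> C)"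

text \<open>
  Noncausal finite variation processes; being maps on \<open>[0, L] \<times> \<Omega>\<close>, they carry no information
  outside this set, hence \<open>extensional\<close>.
\<close>

definition fv_processes :: "'w measure \<Rightarrow> ereal \<Rightarrow> (real \<times> 'w \<Rightarrow> real) set"
  where "fv_processes M L =
    {a \<in> extensional (horizon L \<times> space M).
       a \<in> borel_measurable (lebesgue_on (horizon L) \<Otimes>\<^sub>M M) \<and>
       (AE w in M. bounded_variation_on (horizon L) (\<lambda>t. a (t, w)))}"

section \<open>Brownian motion and the Wiener integral\<close>

definition brownian_motion :: "'w measure \<Rightarrow> (real \<Rightarrow> 'w \<Rightarrow> real) \<Rightarrow> bool"
  where "brownian_motion M B \<longleftrightarrow>
    (\<forall>t\<ge>0. B t \<in> borel_measurable M) \<and>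
    (AE w in M. B 0 w = 0) \<and>
    (\<forall>n (t :: nat \<Rightarrow> real). 0 \<le> t 0 \<longrightarrow> mono t \<longrightarrow>
       prob_space.indep_vars M (\<lambda>_. borel) (\<lambda>i w. B (t (Suc i)) w - B (t i) w) {..<n}) \<and>
    (\<forall>s t. 0 \<le> s \<longrightarrow> s < t \<longrightarrow>
       distributed M lborel (\<lambda>w. B t w - B s w) (normal_density 0 (sqrt (t - s)))) \<and>
    (AE w in M. continuous_on {0..} (\<lambda>t. B t w))"

text \<open>A list of triples \<open>(c, s, u)\<close> stands for the step function \<open>\<Sum> c 1\<^bsub>(s, u]\<^esub>\<close>.\<close>

type_synonym step = "(complex \<times> real \<times> real) list"

definition step_in :: "ereal \<Rightarrow> step \<Rightarrow> bool"
  where "step_in L p \<longleftrightarrow> (\<forall>(c, s, u)\<in>set p. s \<in> horizon L \<and> u \<in> horizon L \<and> s \<le> u)"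

definition step_fun :: "step \<Rightarrow> real \<Rightarrow> complex"
  where "step_fun p t = (\<Sum>(c, s, u)\<leftarrow>p. c * indicator {s<..u} t)"

definition step_integral :: "(real \<Rightarrow> 'w \<Rightarrow> real) \<Rightarrow> step \<Rightarrow> 'w \<Rightarrow> complex"
  where "step_integral B p w = (\<Sum>(c, s, u)\<leftarrow>p. c * complex_of_real (B u w - B s w))"

text \<open>
  The extension of the elementary integral by the Wiener isometry: \<open>Z\<close> is the \<open>L\<^sup>2(\<Omega>)\<close> limit of the
  integrals of step functions which converge to \<open>g\<close> in \<open>L\<^sup>2([0, L])\<close>.  For \<open>g \<in> L2 L\<close> such a \<open>Z\<close>
  exists and is almost surely unique; \<open>wiener_integral\<close> is a version of \<open>B\<^sub>L[g]\<close>.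
\<close>

definition has_wiener_integral ::
    "'w measure \<Rightarrow> (real \<Rightarrow> 'w \<Rightarrow> real) \<Rightarrow> ereal \<Rightarrow> (real \<Rightarrow> complex) \<Rightarrow> ('w \<Rightarrow> complex) \<Rightarrow> bool"
  where "has_wiener_integral M B L g Z \<longleftrightarrow>
    Z \<in> borel_measurable M \<and>
    (\<exists>p :: nat \<Rightarrow> step. (\<forall>k. step_in L (p k)) \<and>
       (\<lambda>k. \<integral>\<^sup>+ t. ennreal ((norm (g t - step_fun (p k) t))\<^sup>2) \<partial>lebesgue_on (horizon L))
         \<longlonglongrightarrow> 0 \<and>
       (\<lambda>k. \<integral>\<^sup>+ w. ennreal ((norm (Z w - step_integral B (p k) w))\<^sup>2) \<partial>M) \<longlonglongrightarrow> 0)"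

definition wiener_integral ::
    "'w measure \<Rightarrow> (real \<Rightarrow> 'w \<Rightarrow> real) \<Rightarrow> ereal \<Rightarrow> (real \<Rightarrow> complex) \<Rightarrow> 'w \<Rightarrow> complex"
  where "wiener_integral M B L g = (SOME Z. has_wiener_integral M B L g Z)"

section \<open>The Ogawa integral\<close>

definition has_ogawa_integral ::
    "'w measure \<Rightarrow> (real \<Rightarrow> 'w \<Rightarrow> real) \<Rightarrow> ereal \<Rightarrow> (nat \<Rightarrow> real \<Rightarrow> complex) \<Rightarrow>
      (real \<times> 'w \<Rightarrow> complex) \<Rightarrow> ('w \<Rightarrow> complex) \<Rightarrow> bool"
  where "has_ogawa_integral M B L \<phi> f Z \<longleftrightarrow>
    f \<in> L0_L2 M L \<and> Z \<in> borel_measurable M \<and>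
    tendsto_in_prob M
      (\<lambda>n w. \<Sum>m<n. L2_inner L (\<phi> m) (\<lambda>t. f (t, w)) * wiener_integral M B L (\<phi> m) w) Z"

text \<open>
  \<open>f\<close> is u-integrable for \<open>L\<^sup>2([0, L]; \<real>)\<close> if it has an integral in the following sense, that is, if
  the series converge for all CONS \<open>\<phi>\<close> of \<open>L\<^sup>2([0, L]; \<real>)\<close>, with one sum \<open>Z\<close> for all of them.
  The sum is almost surely unique, and \<open>u_integral\<close> is a version of it.
\<close>

definition has_u_integral ::
    "'w measure \<Rightarrow> (real \<Rightarrow> 'w \<Rightarrow> real) \<Rightarrow> ereal \<Rightarrow> (real \<times> 'w \<Rightarrow> complex) \<Rightarrow> ('w \<Rightarrow> complex) \<Rightarrow> bool"
  where "has_u_integral M B L f Z \<longleftrightarrow>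
    (\<forall>\<phi>. is_CONS L (L2_real L) \<phi> \<longrightarrow> has_ogawa_integral M B L \<phi> f Z)"

definition u_integral ::
    "'w measure \<Rightarrow> (real \<Rightarrow> 'w \<Rightarrow> real) \<Rightarrow> ereal \<Rightarrow> (real \<times> 'w \<Rightarrow> complex) \<Rightarrow> 'w \<Rightarrow> complex"
  where "u_integral M B L f = (SOME Z. has_u_integral M B L f Z)"

text \<open>
  For \<open>dY = a d\<^sub>uB + b dt\<close>, the stochastic Fourier coefficient \<open>(e, d\<^sub>uY)\<close> and the value \<open>Y\<^sub>t\<close>, as
  elements of \<open>L\<^sup>0(\<Omega>)\<close>.
\<close>

definition SFC ::
    "'w measure \<Rightarrow> (real \<Rightarrow> 'w \<Rightarrow> real) \<Rightarrow> ereal \<Rightarrow> (real \<times> 'w \<Rightarrow> complex) \<Rightarrow>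
      (real \<times> 'w \<Rightarrow> real) \<Rightarrow> (real \<Rightarrow> complex) \<Rightarrow> ('w \<Rightarrow> complex) set"
  where "SFC M B L b a e =
    L0_class M (\<lambda>w. u_integral M B L (\<lambda>(s, w). cnj (e s) * complex_of_real (a (s, w))) w +
                    (LINT s|lebesgue_on (horizon L). cnj (e s) * b (s, w)))"

definition Y_process ::
    "'w measure \<Rightarrow> (real \<Rightarrow> 'w \<Rightarrow> real) \<Rightarrow> ereal \<Rightarrow> (real \<times> 'w \<Rightarrow> complex) \<Rightarrow>
      (real \<times> 'w \<Rightarrow> real) \<Rightarrow> real \<Rightarrow> ('w \<Rightarrow> complex) set"
  where "Y_process M B L b a t =
    L0_class M (\<lambda>w. u_integral M B L (\<lambda>(s, w). complex_of_real (a (s, w)) * indicator {0..t} s) w +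
                    (LINT s:{0..t}|lebesgue. b (s, w)))"

section \<open>Identification in the wide sense\<close>

text \<open>Only the values of \<open>T\<close> on the image \<open>X ` A\<close> matter.\<close>

definition identified :: "'a set \<Rightarrow> ('a \<Rightarrow> 'i \<Rightarrow> ('w \<Rightarrow> complex) set) \<Rightarrow> ('a \<Rightarrow> 'c) \<Rightarrow> bool"
  where "identified A X h \<longleftrightarrow> (\<exists>T. \<forall>a\<in>A. T (X a) = h a)"

end

theory Submission
  imports Defs
begin

text \<open>
  Let \<open>c\<close> be the difference of two processes \<open>a\<close>, \<open>a'\<close> of the family.  The summands with \<open>b\<close> cancel and
  the u-integral is linear, so the two processes have the same coefficients \<open>(e\<^sub>n, d\<^sub>uY)\<close> if and only if the
  u-integrals of all \<open>cnj e\<^sub>n c\<close> vanish almost surely, and the same \<open>Y\<^sub>t\<close>, \<open>t \<in> S\<close>, if and only if those of all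
  \<open>1\<^bsub>[0,t]\<^esub> c\<close> vanish.  Identifiability of \<open>h\<close> from some data says that \<open>h\<close> is constant wherever the data
  are (\<open>identified_iff\<close>), so it suffices that these two conditions on \<open>c\<close> are equivalent.  They are, because each
  is equivalent to the vanishing of the u-integral of \<open>f c\<close> for every \<open>f\<close> in \<open>L\<^sup>2\<close>: the \<open>f\<close> with this property
  form a closed subspace (\<open>closed_subspace_null_integrands\<close>), while the \<open>cnj e\<^sub>n\<close> are complete and the
  \<open>1\<^bsub>[0,t]\<^esub>\<close> with \<open>t\<close> in a dense set span a dense subspace (\<open>null_integrands_determined\<close>).

  What has to be proved is that the u-integral of \<open>f c\<close> exists and depends continuously on \<open>f\<close>.  For fixed
  \<open>\<omega>\<close>, a partial sum \<open>\<Sum> \<langle>\<phi>\<^sub>m, f c\<rangle> B\<^sub>L[\<phi>\<^sub>m]\<close> is an ordinary integral \<open>\<integral> \<psi> c d\<lambda>\<close> with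
  \<open>\<psi> = f \<Sum> cnj \<phi>\<^sub>m B\<^sub>L[\<phi>\<^sub>m]\<close>.  Since \<open>c\<close> has bounded variation, it is at most a constant, depending on
  \<open>\<omega>\<close>, times the supremum of \<open>\<bar>\<integral>\<^sub>A \<psi> d\<lambda>\<bar>\<close> over the initial segments \<open>A\<close> of the time interval
  (\<open>bounded_variation_integral_bound\<close>).  This bound is pathwise, and the supremum involves only
  Wiener integrals of deterministic functions: \<open>\<integral>\<^sub>A \<psi> d\<lambda>\<close> is the Wiener integral of the orthogonal projection
  of \<open>f 1\<^sub>A\<close>.  Parametrizing the initial segments by the share \<open>u\<close> of the squared norm of \<open>f\<close> that they carry
  gives a continuous process on \<open>[0, 1]\<close> whose increments have fourth moments of order \<open>(u - v)\<^sup>2\<close>, uniformly in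
  the projections.  Chaining (\<open>chaining_limit\<close>) then turns convergence for each single \<open>u\<close>, which is the
  \<open>L\<^sup>2\<close>-convergence of orthogonal expansions, into convergence of the expected supremum.  The lemma
  \<open>ogawa_sum_diff_tendsto_0\<close> collects this.  Applied to two systems it gives existence of the integral
  and independence of the system; applied to \<open>f\<^sub>k \<rightarrow> 0\<close> it gives continuity.
\<close>

section \<open>Square-integrable functions and orthonormal systems\<close>

definition sq_int :: "'a measure \<Rightarrow> ('a \<Rightarrow> complex) set"
  where "sq_int N = {f \<in> borel_measurable N. integrable N (\<lambda>x. (norm (f x))\<^sup>2)}"

definition sq_norm :: "'a measure \<Rightarrow> ('a \<Rightarrow> complex) \<Rightarrow> real"
  where "sq_norm N f = (LINT x|N. (norm (f x))\<^sup>2)"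

definition inner_prod :: "'a measure \<Rightarrow> ('a \<Rightarrow> complex) \<Rightarrow> ('a \<Rightarrow> complex) \<Rightarrow> complex"
  where "inner_prod N f g = (LINT x|N. cnj (f x) * g x)"

lemma borel_measurable_cnj [measurable (raw)]:
  "f \<in> borel_measurable N \<Longrightarrow> (\<lambda>x. cnj (f x)) \<in> borel_measurable N"
  by (rule measurable_compose[OF _ borel_measurable_continuous_onI[OF continuous_on_cnj[OF continuous_on_id]]])

lemma norm_add_sq_le: "(norm (a + b :: complex))\<^sup>2 \<le> 2 * (norm a)\<^sup>2 + 2 * (norm b)\<^sup>2"
proof -
  have "(norm (a + b))\<^sup>2 \<le> (norm a + norm b)\<^sup>2"
    by (intro power_mono norm_triangle_ineq) auto
  also have "\<dots> \<le> 2 * (norm a)\<^sup>2 + 2 * (norm b)\<^sup>2"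
    using sum_squares_bound[of "norm a" "norm b"] by (simp add: power2_sum)
  finally show ?thesis .
qed

lemma sq_intD: assumes "f \<in> sq_int N"
  shows "f \<in> borel_measurable N" "integrable N (\<lambda>x. (norm (f x))\<^sup>2)"
  using assms by (auto simp: sq_int_def)

lemma sq_int_scale: assumes "f \<in> sq_int N" shows "(\<lambda>x. c * f x) \<in> sq_int N"
  using assms by (auto simp: sq_int_def norm_mult power_mult_distrib)

lemma sq_norm_scale: "sq_norm N (\<lambda>x. c * f x) = (norm c)\<^sup>2 * sq_norm N f"
  by (simp add: sq_norm_def norm_mult power_mult_distrib)

lemma sq_int_add: assumes "f \<in> sq_int N" "g \<in> sq_int N" shows "(\<lambda>x. f x + g x) \<in> sq_int N"
proof -
  note [measurable] = sq_intD(1)[OF assms(1)] sq_intD(1)[OF assms(2)]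
  have i: "integrable N (\<lambda>x. 2 * (norm (f x))\<^sup>2 + 2 * (norm (g x))\<^sup>2)"
    using assms by (intro Bochner_Integration.integrable_add integrable_mult_right) (auto dest: sq_intD)
  have "integrable N (\<lambda>x. (norm (f x + g x))\<^sup>2)"
    by (rule Bochner_Integration.integrable_bound[OF i]) (use norm_add_sq_le in \<open>auto simp: abs_of_nonneg\<close>)
  then show ?thesis by (auto simp: sq_int_def)
qed

lemma sq_norm_add_le: assumes "f \<in> sq_int N" "g \<in> sq_int N"
  shows "sq_norm N (\<lambda>x. f x + g x) \<le> 2 * sq_norm N f + 2 * sq_norm N g"
proof -
  have "sq_norm N (\<lambda>x. f x + g x) \<le> (LINT x|N. 2 * (norm (f x))\<^sup>2 + 2 * (norm (g x))\<^sup>2)"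
    unfolding sq_norm_def using assms sq_int_add[OF assms]
    by (intro integral_mono norm_add_sq_le Bochner_Integration.integrable_add integrable_mult_right) (auto dest: sq_intD)
  also have "\<dots> = 2 * sq_norm N f + 2 * sq_norm N g"
    unfolding sq_norm_def using assms
    by (subst Bochner_Integration.integral_add) (auto dest: sq_intD)
  finally show ?thesis .
qed

lemma sq_int_uminus: "f \<in> sq_int N \<Longrightarrow> (\<lambda>x. - f x) \<in> sq_int N"
  using sq_int_scale[of f N "-1"] by simp

lemma sq_int_diff: assumes "f \<in> sq_int N" "g \<in> sq_int N" shows "(\<lambda>x. f x - g x) \<in> sq_int N"
  using sq_int_add[OF assms(1) sq_int_uminus[OF assms(2)]] by simp

lemma sq_norm_uminus: "sq_norm N (\<lambda>x. - f x) = sq_norm N f"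
  by (simp add: sq_norm_def)

lemma sq_norm_commute: "sq_norm N (\<lambda>x. f x - g x) = sq_norm N (\<lambda>x. g x - f x)"
  by (simp add: sq_norm_def norm_minus_commute)

lemma sq_norm_diff_le: assumes "f \<in> sq_int N" "g \<in> sq_int N"
  shows "sq_norm N (\<lambda>x. f x - g x) \<le> 2 * sq_norm N f + 2 * sq_norm N g"
  using sq_norm_add_le[OF assms(1) sq_int_uminus[OF assms(2)]] by (simp add: sq_norm_uminus)

lemma sq_int_zero [simp]: "(\<lambda>x. 0) \<in> sq_int N"
  by (auto simp: sq_int_def)

lemma sq_int_sum: assumes "\<And>i. i \<in> I \<Longrightarrow> f i \<in> sq_int N" shows "(\<lambda>x. \<Sum>i\<in>I. f i x) \<in> sq_int N"
  using assms by (induction I rule: infinite_finite_induct) (auto intro!: sq_int_add)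

lemma sq_int_cnj: "f \<in> sq_int N \<Longrightarrow> (\<lambda>x. cnj (f x)) \<in> sq_int N"
  by (auto simp: sq_int_def)

lemma sq_norm_nonneg [simp]: "0 \<le> sq_norm N f"
  by (simp add: sq_norm_def)

lemma nn_integral_sq_norm: assumes "f \<in> sq_int N"
  shows "(\<integral>\<^sup>+x. ennreal ((norm (f x))\<^sup>2) \<partial>N) = ennreal (sq_norm N f)"
  unfolding sq_norm_def by (rule nn_integral_eq_integral) (use assms in \<open>auto dest: sq_intD\<close>)

lemma sq_int_bounded:
  assumes "f \<in> borel_measurable N" "(\<integral>\<^sup>+x. ennreal ((norm (f x))\<^sup>2) \<partial>N) < \<infinity>"
  shows "f \<in> sq_int N"
  using assms unfolding sq_int_def by (auto intro!: integrableI_bounded)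

lemma sq_int_mult_bounded:
  assumes "f \<in> sq_int N" "g \<in> borel_measurable N" "\<And>x. x \<in> space N \<Longrightarrow> norm (g x) \<le> C"
  shows "(\<lambda>x. f x * g x) \<in> sq_int N"
proof -
  note [measurable] = sq_intD(1)[OF assms(1)] assms(2)
  have i: "integrable N (\<lambda>x. C\<^sup>2 * (norm (f x))\<^sup>2)"
    using assms by (intro integrable_mult_right) (auto dest: sq_intD)
  have "norm ((norm (f x * g x))\<^sup>2) \<le> norm (C\<^sup>2 * (norm (f x))\<^sup>2)" if "x \<in> space N" for x
  proof -
    have "(norm (g x))\<^sup>2 \<le> C\<^sup>2" using assms(3)[OF that] by (intro power_mono) auto
    from mult_left_mono[OF this zero_le_power2[of "norm (f x)"]] show ?thesis
      by (simp add: norm_mult power_mult_distrib mult.commute)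
  qed
  then have "integrable N (\<lambda>x. (norm (f x * g x))\<^sup>2)"
    by (intro Bochner_Integration.integrable_bound[OF i]) auto
  then show ?thesis by (auto simp: sq_int_def)
qed

lemma sq_int_indicator:
  assumes "f \<in> sq_int N" "A \<in> sets N" shows "(\<lambda>x. f x * indicator A x) \<in> sq_int N"
  by (rule sq_int_mult_bounded[where C=1]) (use assms in \<open>auto simp: indicator_def\<close>)

lemma sq_norm_indicator_le:
  assumes "f \<in> sq_int N" "A \<in> sets N" shows "sq_norm N (\<lambda>x. f x * indicator A x) \<le> sq_norm N f"
  unfolding sq_norm_def using sq_intD(2)[OF sq_int_indicator[OF assms]] sq_intD(2)[OF assms(1)]
  by (intro integral_mono) (auto simp: indicator_def)

lemma sq_norm_zero_AE: assumes "f \<in> sq_int N" shows "sq_norm N f = 0 \<longleftrightarrow> (AE x in N. f x = 0)"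
  unfolding sq_norm_def by (subst integral_nonneg_eq_0_iff_AE) (use assms in \<open>auto dest: sq_intD\<close>)

lemma sq_norm_cong_AE: assumes "f \<in> borel_measurable N" "g \<in> borel_measurable N" "AE x in N. f x = g x"
  shows "sq_norm N f = sq_norm N g"
  unfolding sq_norm_def by (rule integral_cong_AE) (use assms in auto)

lemma sq_norm_le_two_diff: assumes "f \<in> sq_int N" "g \<in> sq_int N"
  shows "sq_norm N f \<le> 2 * sq_norm N (\<lambda>x. g x - f x) + 2 * sq_norm N g"
proof -
  have "sq_norm N (\<lambda>x. (f x - g x) + g x) \<le> 2 * sq_norm N (\<lambda>x. f x - g x) + 2 * sq_norm N g"
    by (rule sq_norm_add_le) (use assms in \<open>auto intro: sq_int_diff\<close>)
  then show ?thesis by (simp add: sq_norm_commute[of N f])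
qed

lemma inner_prod_integrable: assumes "f \<in> sq_int N" "g \<in> sq_int N"
  shows "integrable N (\<lambda>x. cnj (f x) * g x)"
proof -
  note [measurable] = sq_intD(1)[OF assms(1)] sq_intD(1)[OF assms(2)]
  have i: "integrable N (\<lambda>x. (norm (f x))\<^sup>2 + (norm (g x))\<^sup>2)"
    using assms by (intro Bochner_Integration.integrable_add) (auto dest: sq_intD)
  have "norm (cnj a * b) \<le> norm ((norm a)\<^sup>2 + (norm b)\<^sup>2)" for a b :: complex
  proof -
    have "norm a * norm b \<le> (norm a)\<^sup>2 + (norm b)\<^sup>2"
      using sum_squares_bound[of "norm a" "norm b"] mult_nonneg_nonneg[OF norm_ge_zero[of a] norm_ge_zero[of b]]
      by linarith
    then show ?thesis by (simp add: norm_mult)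
  qed
  then show ?thesis
    by (intro Bochner_Integration.integrable_bound[OF i]) auto
qed

lemma inner_prod_add: "f \<in> sq_int N \<Longrightarrow> g \<in> sq_int N \<Longrightarrow> h \<in> sq_int N \<Longrightarrow> inner_prod N f (\<lambda>x. g x + h x) = inner_prod N f g + inner_prod N f h"
  using inner_prod_integrable[of f N g] inner_prod_integrable[of f N h] by (simp add: inner_prod_def algebra_simps)

lemma inner_prod_diff: "f \<in> sq_int N \<Longrightarrow> g \<in> sq_int N \<Longrightarrow> h \<in> sq_int N \<Longrightarrow> inner_prod N f (\<lambda>x. g x - h x) = inner_prod N f g - inner_prod N f h"
  using inner_prod_integrable[of f N g] inner_prod_integrable[of f N h] by (simp add: inner_prod_def algebra_simps)

lemma inner_prod_scale: "inner_prod N f (\<lambda>x. c * g x) = c * inner_prod N f g"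
  by (simp add: inner_prod_def mult.left_commute flip: integral_mult_right_zero)

lemma inner_prod_sum: assumes "f \<in> sq_int N" "\<And>i. i \<in> I \<Longrightarrow> g i \<in> sq_int N"
  shows "inner_prod N f (\<lambda>x. \<Sum>i\<in>I. g i x) = (\<Sum>i\<in>I. inner_prod N f (g i))"
  unfolding inner_prod_def sum_distrib_left by (rule Bochner_Integration.integral_sum) (use assms inner_prod_integrable in auto)

lemma inner_prod_commute: "cnj (inner_prod N f g) = inner_prod N g f"
proof -
  have "(LINT x|N. cnj (cnj (f x) * g x)) = cnj (LINT x|N. cnj (f x) * g x)"
    by (rule Bochner_Integration.integral_cnj)
  then show ?thesis by (simp add: inner_prod_def mult.commute del: integral_cnj)
qed

lemma inner_prod_self: "inner_prod N f f = of_real (sq_norm N f)"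
proof -
  have "inner_prod N f f = (LINT x|N. complex_of_real ((norm (f x))\<^sup>2))"
    unfolding inner_prod_def by (intro Bochner_Integration.integral_cong refl) (metis complex_norm_square mult.commute)
  also have "\<dots> = of_real (sq_norm N f)"
    unfolding sq_norm_def by (rule integral_complex_of_real)
  finally show ?thesis .
qed

lemma inner_prod_CS: assumes "f \<in> sq_int N" "g \<in> sq_int N"
  shows "(norm (inner_prod N f g))\<^sup>2 \<le> sq_norm N f * sq_norm N g"
proof -
  note [measurable] = sq_intD(1)[OF assms(1)] sq_intD(1)[OF assms(2)]
  have "ennreal ((norm (inner_prod N f g))\<^sup>2) = (ennreal (norm (inner_prod N f g)))\<^sup>2"
    by (simp add: ennreal_power)
  also have "\<dots> \<le> (\<integral>\<^sup>+x. ennreal (norm (cnj (f x) * g x)) \<partial>N)\<^sup>2"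
    unfolding inner_prod_def by (intro power_mono integral_norm_bound_ennreal inner_prod_integrable assms) auto
  also have "\<dots> = (\<integral>\<^sup>+x. ennreal (norm (f x)) * ennreal (norm (g x)) \<partial>N)\<^sup>2"
    by (simp add: norm_mult ennreal_mult)
  also have "\<dots> \<le> (\<integral>\<^sup>+x. ennreal (norm (f x)) ^ 2 \<partial>N) * (\<integral>\<^sup>+x. ennreal (norm (g x)) ^ 2 \<partial>N)"
    by (rule Cauchy_Schwarz_nn_integral) auto
  also have "\<dots> = ennreal (sq_norm N f * sq_norm N g)"
    by (simp add: ennreal_power nn_integral_sq_norm assms ennreal_mult)
  finally show ?thesis by simp
qed

text \<open>
  Pointwise form of the subsequence argument: \<open>x \<le> 2\<^sup>-\<^sup>k + 2\<^sup>k x\<^sup>2\<close>, since one of the two summands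
  exceeds \<open>x\<close> according to whether \<open>x \<le> 2\<^sup>-\<^sup>k\<close>.
\<close>

lemma summable_of_weighted_squares:
  fixes d :: "nat \<Rightarrow> complex"
  assumes "summable (\<lambda>k. 2 ^ k * (norm (d k))\<^sup>2)"
  shows "summable (\<lambda>k. norm (d k))"
proof (rule summable_comparison_test')
  show "summable (\<lambda>k. (1/2) ^ k + 2 ^ k * (norm (d k))\<^sup>2)"
    by (intro summable_add assms summable_geometric) auto
  have "x \<le> (1/2) ^ k + 2 ^ k * x\<^sup>2" if "0 \<le> x" for x :: real and k :: nat
  proof (cases "x \<le> (1/2) ^ k")
    case True
    then show ?thesis by (simp add: add_increasing2)
  next
    case False
    have "x = 2 ^ k * ((1/2) ^ k * x)" by (simp add: power_one_over)
    also have "\<dots> \<le> 2 ^ k * (x * x)" using False that by (intro mult_left_mono mult_right_mono) auto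
    finally have "x \<le> 2 ^ k * x\<^sup>2" by (simp add: power2_eq_square)
    then show ?thesis by (simp add: add_increasing)
  qed
  then show "norm (norm (d k)) \<le> (1/2) ^ k + 2 ^ k * (norm (d k))\<^sup>2" if "k \<ge> 0" for k by simp
qed

text \<open>
  The Riesz-Fischer theorem.  A subsequence with increments of squared norm at most \<open>8\<^sup>-\<^sup>k\<close> converges almost
  everywhere, because the increments stay summable after weighting with \<open>2\<^sup>k\<close>, and Fatou's lemma shows that
  the pointwise limit is also the limit in the mean.
\<close>

lemma sq_int_complete:
  assumes f: "\<And>n. f n \<in> sq_int N"
    and cauchy: "\<And>\<epsilon>. \<epsilon> > 0 \<Longrightarrow> \<exists>n0. \<forall>m\<ge>n0. \<forall>n\<ge>n0. sq_norm N (\<lambda>x. f m x - f n x) \<le> \<epsilon>"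
  shows "\<exists>g\<in>sq_int N. (\<lambda>n. sq_norm N (\<lambda>x. g x - f n x)) \<longlonglongrightarrow> 0"
proof -
  note [measurable] = sq_intD(1)[OF f]
  have "\<forall>k. \<exists>n0. \<forall>m\<ge>n0. \<forall>n\<ge>n0. sq_norm N (\<lambda>x. f m x - f n x) \<le> (1/8) ^ k"
    using cauchy by simp
  then obtain r where r: "\<And>k m n. m \<ge> r k \<Longrightarrow> n \<ge> r k \<Longrightarrow> sq_norm N (\<lambda>x. f m x - f n x) \<le> (1/8) ^ k"
    by metis
  \<comment> \<open>Sums of the \<open>r i\<close> instead of the \<open>r k\<close> themselves make the subsequence monotone.\<close>
  define R where "R k = (\<Sum>i\<le>k. r i)" for k
  have Rr: "r k \<le> R k" for k unfolding R_def by (rule member_le_sum) auto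
  have Rmono: "R j \<le> R k" if "j \<le> k" for j k
    unfolding R_def by (rule sum_mono2) (use that in auto)
  have rR: "r j \<le> R k" if "j \<le> k" for j k using Rr[of j] Rmono[OF that] by simp
  let ?d = "\<lambda>k x. f (R (Suc k)) x - f (R k) x"
  have int_d: "(\<integral>\<^sup>+x. ennreal (2 ^ k * (norm (?d k x))\<^sup>2) \<partial>N) \<le> ennreal ((1/4) ^ k)" for k
  proof -
    have "(\<integral>\<^sup>+x. ennreal (2 ^ k * (norm (?d k x))\<^sup>2) \<partial>N) = ennreal (2 ^ k * sq_norm N (?d k))"
      by (simp add: ennreal_mult nn_integral_cmult nn_integral_sq_norm sq_int_diff f)
    also have "\<dots> \<le> ennreal (2 ^ k * (1/8) ^ k)"
      by (intro ennreal_leI mult_left_mono r) (use rR[of k "Suc k"] rR[of k k] in auto)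
    also have "2 ^ k * (1/8::real) ^ k = (1/4) ^ k" by (simp flip: power_mult_distrib)
    finally show ?thesis .
  qed
  have "(\<integral>\<^sup>+x. (\<Sum>k. ennreal (2 ^ k * (norm (?d k x))\<^sup>2)) \<partial>N) = (\<Sum>k. \<integral>\<^sup>+x. ennreal (2 ^ k * (norm (?d k x))\<^sup>2) \<partial>N)"
    by (rule nn_integral_suminf) auto
  also have "\<dots> \<le> (\<Sum>k. ennreal ((1/4) ^ k))"
    by (intro suminf_le int_d) auto
  also have "\<dots> = ennreal (\<Sum>k. (1/4) ^ k)"
    by (rule suminf_ennreal2) (auto intro: summable_geometric)
  finally have "(\<integral>\<^sup>+x. (\<Sum>k. ennreal (2 ^ k * (norm (?d k x))\<^sup>2)) \<partial>N) \<noteq> \<infinity>"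
    by (auto simp: top_unique)
  then have "AE x in N. (\<Sum>k. ennreal (2 ^ k * (norm (?d k x))\<^sup>2)) \<noteq> \<infinity>"
    by (intro nn_integral_noteq_infinite) auto
  then have conv: "AE x in N. convergent (\<lambda>k. f (R k) x)"
  proof eventually_elim
    case (elim x)
    then have "summable (\<lambda>k. 2 ^ k * (norm (?d k x))\<^sup>2)"
      by (intro summable_suminf_not_top) auto
    then have "summable (\<lambda>k. norm (?d k x))" by (rule summable_of_weighted_squares)
    then have "summable (\<lambda>k. ?d k x)" by (rule summable_norm_cancel)
    then have "convergent (\<lambda>n. \<Sum>k<n. ?d k x)" by (simp add: summable_iff_convergent)
    also have "(\<lambda>n. \<Sum>k<n. ?d k x) = (\<lambda>n. f (R n) x - f (R 0) x)"
      using sum_lessThan_telescope[of "\<lambda>k. f (R k) x"] by auto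
    finally show ?case by (simp add: convergent_diff_const_right_iff)
  qed
  define g where "g x = lim (\<lambda>k. f (R k) x)" for x
  have [measurable]: "g \<in> borel_measurable N" unfolding g_def by measurable
  have lim: "AE x in N. (\<lambda>k. f (R k) x) \<longlonglongrightarrow> g x"
    using conv by eventually_elim (simp add: g_def convergent_LIMSEQ_iff)
  have bound: "(\<integral>\<^sup>+x. ennreal ((norm (g x - f n x))\<^sup>2) \<partial>N) \<le> ennreal ((1/8) ^ j)" if n: "n \<ge> R j" for j n
  proof -
    have "(\<integral>\<^sup>+x. ennreal ((norm (g x - f n x))\<^sup>2) \<partial>N)
        = (\<integral>\<^sup>+x. liminf (\<lambda>k. ennreal ((norm (f (R k) x - f n x))\<^sup>2)) \<partial>N)"
    proof (rule nn_integral_cong_AE, use lim in eventually_elim)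
      fix x assume "(\<lambda>k. f (R k) x) \<longlonglongrightarrow> g x"
      then have "(\<lambda>k. ennreal ((norm (f (R k) x - f n x))\<^sup>2)) \<longlonglongrightarrow> ennreal ((norm (g x - f n x))\<^sup>2)"
        by (intro tendsto_ennrealI tendsto_intros)
      then show "ennreal ((norm (g x - f n x))\<^sup>2) = liminf (\<lambda>k. ennreal ((norm (f (R k) x - f n x))\<^sup>2))"
        by (intro lim_imp_Liminf[symmetric]) auto
    qed
    also have "\<dots> \<le> liminf (\<lambda>k. \<integral>\<^sup>+x. ennreal ((norm (f (R k) x - f n x))\<^sup>2) \<partial>N)"
      by (rule nn_integral_liminf) auto
    also have "\<dots> \<le> ennreal ((1/8) ^ j)"
    proof (rule Liminf_le[OF _ eventually_sequentiallyI])
      fix k assume "k \<ge> j"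
      then show "(\<integral>\<^sup>+x. ennreal ((norm (f (R k) x - f n x))\<^sup>2) \<partial>N) \<le> ennreal ((1/8) ^ j)"
        using n Rr[of j] rR[of j k] by (simp add: nn_integral_sq_norm sq_int_diff f r)
    qed simp
    finally show ?thesis .
  qed
  have "(\<lambda>x. g x - f (R 0) x) \<in> sq_int N"
    by (rule sq_int_bounded) (use bound[of 0 "R 0"] in \<open>auto simp: order.strict_trans1\<close>)
  from sq_int_add[OF this f[of "R 0"]] have g: "g \<in> sq_int N" by simp
  have "(\<lambda>n. sq_norm N (\<lambda>x. g x - f n x)) \<longlonglongrightarrow> 0"
  proof (rule LIMSEQ_I)
    fix e :: real assume "0 < e"
    then obtain j where j: "(1/8::real) ^ j < e" using real_arch_pow_inv[of e "1/8"] by auto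
    have "norm (sq_norm N (\<lambda>x. g x - f n x) - 0) < e" if "n \<ge> R j" for n
      using bound[OF that] j by (simp add: nn_integral_sq_norm sq_int_diff f g)
    then show "\<exists>no. \<forall>n\<ge>no. norm (sq_norm N (\<lambda>x. g x - f n x) - 0) < e" by blast
  qed
  with g show ?thesis by blast
qed

definition orthonormal :: "'a measure \<Rightarrow> (nat \<Rightarrow> 'a \<Rightarrow> complex) \<Rightarrow> bool"
  where "orthonormal N \<phi> \<longleftrightarrow> (\<forall>m. \<phi> m \<in> sq_int N) \<and> (\<forall>m n. inner_prod N (\<phi> m) (\<phi> n) = (if m = n then 1 else 0))"

definition ons_proj :: "'a measure \<Rightarrow> (nat \<Rightarrow> 'a \<Rightarrow> complex) \<Rightarrow> nat \<Rightarrow> ('a \<Rightarrow> complex) \<Rightarrow> 'a \<Rightarrow> complex"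
  where "ons_proj N \<phi> n g x = (\<Sum>m<n. inner_prod N (\<phi> m) g * \<phi> m x)"

lemma orthonormal_sq_int: "orthonormal N \<phi> \<Longrightarrow> \<phi> m \<in> sq_int N"
  by (simp add: orthonormal_def)

lemma ons_proj_sq_int: "orthonormal N \<phi> \<Longrightarrow> ons_proj N \<phi> n g \<in> sq_int N"
  unfolding ons_proj_def[abs_def] by (intro sq_int_sum sq_int_scale orthonormal_sq_int)

lemma orthonormal_pythagoras: assumes "orthonormal N \<phi>" "finite I"
  shows "sq_norm N (\<lambda>x. \<Sum>i\<in>I. a i * \<phi> i x) = (\<Sum>i\<in>I. (norm (a i))\<^sup>2)"
proof -
  let ?s = "\<lambda>x. \<Sum>i\<in>I. a i * \<phi> i x"
  have s: "?s \<in> sq_int N" by (intro sq_int_sum sq_int_scale orthonormal_sq_int assms)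
  have c: "inner_prod N (\<phi> j) ?s = a j" if "j \<in> I" for j
  proof -
    have "inner_prod N (\<phi> j) ?s = (\<Sum>i\<in>I. a i * inner_prod N (\<phi> j) (\<phi> i))"
      by (subst inner_prod_sum) (use assms in \<open>auto intro: sq_int_scale orthonormal_sq_int simp: inner_prod_scale\<close>)
    also have "\<dots> = (\<Sum>i\<in>I. if i = j then a i else 0)"
      using assms by (intro sum.cong) (auto simp: orthonormal_def)
    finally show ?thesis using that assms by simp
  qed
  have "of_real (sq_norm N ?s) = inner_prod N ?s ?s" by (simp add: inner_prod_self)
  also have "\<dots> = (\<Sum>i\<in>I. a i * inner_prod N ?s (\<phi> i))"
    by (subst inner_prod_sum[OF s]) (use assms in \<open>auto intro: sq_int_scale orthonormal_sq_int simp: inner_prod_scale\<close>)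
  also have "\<dots> = (\<Sum>i\<in>I. a i * cnj (a i))"
    by (intro sum.cong refl) (simp add: c flip: inner_prod_commute[of N "\<phi> _"])
  also have "\<dots> = of_real (\<Sum>i\<in>I. (norm (a i))\<^sup>2)"
    by (simp only: of_real_sum complex_norm_square)
  finally show ?thesis by (simp only: of_real_eq_iff)
qed

lemma sq_norm_proj: assumes "orthonormal N \<phi>" shows "sq_norm N (ons_proj N \<phi> n g) = (\<Sum>m<n. (norm (inner_prod N (\<phi> m) g))\<^sup>2)"
  unfolding ons_proj_def[abs_def] by (rule orthonormal_pythagoras[OF assms]) auto

text \<open>
  The difference of the two sides is the squared norm of \<open>g\<close> minus its projection.
\<close>

lemma bessel: assumes "orthonormal N \<phi>" "g \<in> sq_int N"
  shows "(\<Sum>m<n. (norm (inner_prod N (\<phi> m) g))\<^sup>2) \<le> sq_norm N g"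
proof -
  let ?s = "ons_proj N \<phi> n g"
  have s: "?s \<in> sq_int N" by (rule ons_proj_sq_int[OF assms(1)])
  have gs: "inner_prod N g ?s = of_real (sq_norm N ?s)"
  proof -
    have "inner_prod N g ?s = (\<Sum>m<n. inner_prod N (\<phi> m) g * inner_prod N g (\<phi> m))"
      unfolding ons_proj_def[abs_def]
      by (subst inner_prod_sum) (use assms in \<open>auto intro: sq_int_scale orthonormal_sq_int simp: inner_prod_scale\<close>)
    also have "\<dots> = (\<Sum>m<n. of_real ((norm (inner_prod N (\<phi> m) g))\<^sup>2))"
      by (intro sum.cong refl) (metis complex_norm_square inner_prod_commute)
    finally show ?thesis by (simp add: sq_norm_proj[OF assms(1)])
  qed
  then have sg: "inner_prod N ?s g = of_real (sq_norm N ?s)" by (metis inner_prod_commute complex_cnj_complex_of_real)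
  have "of_real (sq_norm N (\<lambda>x. g x - ?s x)) = inner_prod N (\<lambda>x. g x - ?s x) (\<lambda>x. g x - ?s x)" by (simp add: inner_prod_self)
  also have "\<dots> = inner_prod N (\<lambda>x. g x - ?s x) g - inner_prod N (\<lambda>x. g x - ?s x) ?s"
    by (intro inner_prod_diff sq_int_diff assms s)
  also have "\<dots> = cnj (inner_prod N g (\<lambda>x. g x - ?s x)) - cnj (inner_prod N ?s (\<lambda>x. g x - ?s x))"
    by (simp only: inner_prod_commute)
  also have "\<dots> = of_real (sq_norm N g - sq_norm N ?s)"
    by (simp add: inner_prod_diff assms s gs sg inner_prod_self)
  finally have "sq_norm N (\<lambda>x. g x - ?s x) = sq_norm N g - sq_norm N ?s" by (simp only: of_real_eq_iff)
  then show ?thesis using sq_norm_nonneg[of N "\<lambda>x. g x - ?s x"] sq_norm_proj[OF assms(1)] by simp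
qed

lemma inner_prod_tendsto: assumes "h \<in> sq_int N" "g \<in> sq_int N" "\<And>n. f n \<in> sq_int N" "(\<lambda>n. sq_norm N (\<lambda>x. g x - f n x)) \<longlonglongrightarrow> 0"
  shows "(\<lambda>n. inner_prod N h (f n)) \<longlonglongrightarrow> inner_prod N h g"
proof -
  have "(\<lambda>n. (norm (inner_prod N h g - inner_prod N h (f n)))\<^sup>2) \<longlonglongrightarrow> 0"
  proof (rule tendsto_sandwich[OF _ _ tendsto_const])
    show "\<forall>\<^sub>F n in sequentially. (norm (inner_prod N h g - inner_prod N h (f n)))\<^sup>2 \<le> sq_norm N h * sq_norm N (\<lambda>x. g x - f n x)"
      using inner_prod_CS[OF assms(1) sq_int_diff[OF assms(2,3)]] by (simp add: inner_prod_diff assms)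
    show "(\<lambda>n. sq_norm N h * sq_norm N (\<lambda>x. g x - f n x)) \<longlonglongrightarrow> 0"
      using tendsto_mult_left[OF assms(4), of "sq_norm N h"] by simp
  qed auto
  then have "(\<lambda>n. sqrt ((norm (inner_prod N h g - inner_prod N h (f n)))\<^sup>2)) \<longlonglongrightarrow> sqrt 0" by (rule tendsto_real_sqrt)
  then have "(\<lambda>n. norm (inner_prod N h (f n) - inner_prod N h g)) \<longlonglongrightarrow> 0" by (simp add: norm_minus_commute)
  then show ?thesis by (subst LIM_zero_iff[symmetric]) (rule tendsto_norm_zero_cancel)
qed

text \<open>
  By Bessel's inequality the expansion of \<open>g\<close> is a Cauchy sequence; its limit has the same coefficients as \<open>g\<close>,
  hence equals \<open>g\<close> because only zero is orthogonal to the system.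
\<close>

lemma complete_ons_expansion:
  assumes o: "orthonormal N \<phi>" and g: "g \<in> sq_int N"
    and compl: "\<And>f. f \<in> sq_int N \<Longrightarrow> (\<And>m. inner_prod N (\<phi> m) f = 0) \<Longrightarrow> AE x in N. f x = 0"
  shows "(\<lambda>n. sq_norm N (\<lambda>x. g x - ons_proj N \<phi> n g x)) \<longlonglongrightarrow> 0"
proof -
  let ?a = "\<lambda>m. (norm (inner_prod N (\<phi> m) g))\<^sup>2"
  have sm: "summable ?a"
    by (rule summableI_nonneg_bounded[where x = "sq_norm N g"]) (use bessel[OF o g] in auto)
  have p: "ons_proj N \<phi> n g \<in> sq_int N" for n by (rule ons_proj_sq_int[OF o])
  have dif: "sq_norm N (\<lambda>x. ons_proj N \<phi> n g x - ons_proj N \<phi> m g x) = sum ?a {m..<n}" if "m \<le> n" for m n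
  proof -
    have "ons_proj N \<phi> n g x - ons_proj N \<phi> m g x = (\<Sum>i\<in>{m..<n}. inner_prod N (\<phi> i) g * \<phi> i x)" for x
      unfolding ons_proj_def lessThan_atLeast0 using sum.atLeastLessThan_concat[of 0 m n "\<lambda>i. inner_prod N (\<phi> i) g * \<phi> i x"] that
      by (simp add: algebra_simps)
    then show ?thesis by (simp add: orthonormal_pythagoras[OF o])
  qed
  have cauchy: "\<exists>n0. \<forall>m\<ge>n0. \<forall>n\<ge>n0. sq_norm N (\<lambda>x. ons_proj N \<phi> m g x - ons_proj N \<phi> n g x) \<le> e" if "e > 0" for e
  proof -
    from sm that obtain n0 where n0: "\<And>m n. m \<ge> n0 \<Longrightarrow> norm (sum ?a {m..<n}) < e"
      unfolding summable_Cauchy by blast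
    have "sq_norm N (\<lambda>x. ons_proj N \<phi> m g x - ons_proj N \<phi> n g x) \<le> e" if "m \<ge> n0" "n \<ge> n0" for m n
    proof (cases "m \<le> n")
      case True
      then show ?thesis using dif[OF True] n0[OF \<open>m \<ge> n0\<close>, of n] by (simp add: sq_norm_commute[of N "ons_proj N \<phi> m g"])
    next
      case False
      then show ?thesis using dif[of n m] n0[OF \<open>n \<ge> n0\<close>, of m] by simp
    qed
    then show ?thesis by blast
  qed
  obtain g' where g': "g' \<in> sq_int N" and lim: "(\<lambda>n. sq_norm N (\<lambda>x. g' x - ons_proj N \<phi> n g x)) \<longlonglongrightarrow> 0"
    using sq_int_complete[OF p cauchy] by blast
  have "inner_prod N (\<phi> m) (\<lambda>x. g x - g' x) = 0" for m
  proof -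
    have "inner_prod N (\<phi> m) (ons_proj N \<phi> n g) = inner_prod N (\<phi> m) g" if "n \<ge> Suc m" for n
    proof -
      have "inner_prod N (\<phi> m) (ons_proj N \<phi> n g) = (\<Sum>i<n. inner_prod N (\<phi> i) g * inner_prod N (\<phi> m) (\<phi> i))"
        unfolding ons_proj_def[abs_def] by (subst inner_prod_sum) (use o in \<open>auto intro: sq_int_scale orthonormal_sq_int simp: inner_prod_scale\<close>)
      also have "\<dots> = (\<Sum>i<n. if i = m then inner_prod N (\<phi> i) g else 0)"
        using o by (intro sum.cong) (auto simp: orthonormal_def)
      finally show ?thesis using that by simp
    qed
    then have "(\<lambda>n. inner_prod N (\<phi> m) (ons_proj N \<phi> n g)) \<longlonglongrightarrow> inner_prod N (\<phi> m) g"
      by (intro tendsto_eventually eventually_sequentiallyI)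
    with inner_prod_tendsto[OF orthonormal_sq_int[OF o] g' p lim] have "inner_prod N (\<phi> m) g = inner_prod N (\<phi> m) g'"
      by (rule LIMSEQ_unique[rotated])
    then show ?thesis by (simp add: inner_prod_diff orthonormal_sq_int[OF o] g g')
  qed
  then have "AE x in N. g x - g' x = 0" by (intro compl sq_int_diff g g')
  then have "sq_norm N (\<lambda>x. g' x - ons_proj N \<phi> n g x) = sq_norm N (\<lambda>x. g x - ons_proj N \<phi> n g x)" for n
    by (intro sq_norm_cong_AE sq_intD(1)[OF sq_int_diff] g g' p) auto
  with lim show ?thesis by simp
qed

section \<open>Dense subspaces of \<open>L\<^sup>2([0, L])\<close>\<close>

text \<open>
  Lebesgue measure on the time interval.  The predicates of the previous section for this measure are the
  notions used in the definition of the Ogawa integral (\<open>L2_eq\<close>, \<open>L2_inner_eq\<close>).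
\<close>

abbreviation Leb :: "ereal \<Rightarrow> real measure" where "Leb L \<equiv> lebesgue_on (horizon L)"

lemma horizon_borel [measurable]: "horizon L \<in> sets borel"
  unfolding horizon_def by measurable

lemma horizon_lebesgue [measurable]: "horizon L \<in> sets lebesgue"
  using horizon_borel by (simp add: sets_completionI_sets)

lemma space_Leb [simp]: "space (Leb L) = horizon L"
  by (simp add: space_restrict_space)

lemma L2_eq: "L2 L = sq_int (Leb L)"
  by (simp add: L2_def sq_int_def)

lemma L2_inner_eq: "L2_inner L = inner_prod (Leb L)"
  by (simp add: fun_eq_iff L2_inner_def inner_prod_def)

lemma borel_Int_horizon: "A \<in> sets borel \<Longrightarrow> A \<inter> horizon L \<in> sets (Leb L)"
  by (subst sets_restrict_space_iff) (auto intro: sets_completionI_sets)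

lemma sets_Leb_iff: "A \<in> sets (Leb L) \<longleftrightarrow> A \<subseteq> horizon L \<and> A \<in> sets lebesgue"
  by (subst sets_restrict_space_iff) auto

lemma AE_Leb_iff: "(AE x in Leb L. P x) \<longleftrightarrow> (AE x in lebesgue. x \<in> horizon L \<longrightarrow> P x)"
  by (subst AE_restrict_space_iff) auto

lemma borel_measurable_Leb: "f \<in> borel_measurable borel \<Longrightarrow> f \<in> borel_measurable (Leb L)"
  for f :: "real \<Rightarrow> 'b::topological_space"
  by (intro measurable_restrict_space1 measurable_completion) simp

lemma horizon_downward: "t \<in> horizon L \<Longrightarrow> 0 \<le> s \<Longrightarrow> s \<le> t \<Longrightarrow> s \<in> horizon L"
  by (auto simp: horizon_def intro: order_trans[of "ereal s" "ereal t"])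

lemma indicator_atMost_tendsto:
  fixes x t :: real
  assumes s: "s \<longlonglongrightarrow> t" and x: "x \<noteq> t"
  shows "(\<lambda>n. indicator {..s n} x :: 'b::{zero_neq_one,topological_space}) \<longlonglongrightarrow> indicator {..t} x"
proof -
  have "\<forall>\<^sub>F n in sequentially. (indicator {..s n} x :: 'b) = indicator {..t} x"
  proof (cases "x < t")
    case True
    from order_tendstoD(1)[OF s this] show ?thesis
      by eventually_elim (use True in \<open>auto simp: indicator_def\<close>)
  next
    case False
    with x have "t < x" by auto
    from order_tendstoD(2)[OF s this] show ?thesis
      by eventually_elim (use \<open>t < x\<close> in \<open>auto simp: indicator_def\<close>)
  qed
  then show ?thesis by (rule tendsto_eventually)
qed

lemma sq_int_dominated_limit:
  fixes f :: "nat \<Rightarrow> 'a \<Rightarrow> complex"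
  assumes w: "w \<in> sq_int N" and f: "\<And>n. f n \<in> borel_measurable N" and g: "g \<in> borel_measurable N"
    and lim: "AE x in N. (\<lambda>n. f n x) \<longlonglongrightarrow> g x"
    and dom: "\<And>n. AE x in N. norm (f n x) \<le> norm (w x)"
  shows "g \<in> sq_int N" "\<And>n. f n \<in> sq_int N" "(\<lambda>n. sq_norm N (\<lambda>x. g x - f n x)) \<longlonglongrightarrow> 0"
proof -
  note [measurable] = f g sq_intD(1)[OF w]
  note iw = sq_intD(2)[OF w]
  have domg: "AE x in N. norm (g x) \<le> norm (w x)"
  proof -
    have "AE x in N. \<forall>n. norm (f n x) \<le> norm (w x)" using dom by (simp add: AE_all_countable)
    then show ?thesis using lim
      by eventually_elim (auto intro: LIMSEQ_le_const2[OF tendsto_norm])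
  qed
  have *: "h \<in> sq_int N" if [measurable]: "h \<in> borel_measurable N" and "AE x in N. norm (h x) \<le> norm (w x)" for h
  proof -
    have "AE x in N. norm ((norm (h x))\<^sup>2) \<le> norm ((norm (w x))\<^sup>2)"
      using that(2) by eventually_elim (simp add: power_mono)
    then have "integrable N (\<lambda>x. (norm (h x))\<^sup>2)"
      by (intro Bochner_Integration.integrable_bound[OF iw]) auto
    then show ?thesis by (simp add: sq_int_def)
  qed
  show g': "g \<in> sq_int N" by (rule *[OF g domg])
  show f': "f n \<in> sq_int N" for n by (rule *[OF f dom])
  have "(\<lambda>n. LINT x|N. (norm (g x - f n x))\<^sup>2) \<longlonglongrightarrow> (LINT x|N. 0)"
  proof (rule integral_dominated_convergence)
    show "integrable N (\<lambda>x. 4 * (norm (w x))\<^sup>2)" using iw by simp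
    show "AE x in N. (\<lambda>n. (norm (g x - f n x))\<^sup>2) \<longlonglongrightarrow> 0"
      using lim
    proof eventually_elim
      case (elim x)
      then have "(\<lambda>n. (norm (g x - f n x))\<^sup>2) \<longlonglongrightarrow> (norm (g x - g x))\<^sup>2" by (intro tendsto_intros)
      then show ?case by simp
    qed
    show "AE x in N. norm ((norm (g x - f n x))\<^sup>2) \<le> 4 * (norm (w x))\<^sup>2" for n
      using domg dom[of n]
    proof eventually_elim
      case (elim x)
      have "norm (g x - f n x) \<le> 2 * norm (w x)" using norm_triangle_ineq4[of "g x" "f n x"] elim by linarith
      from power_mono[OF this norm_ge_zero, of 2] show ?case by (simp add: power_mult_distrib)
    qed
  qed auto
  then show "(\<lambda>n. sq_norm N (\<lambda>x. g x - f n x)) \<longlonglongrightarrow> 0" by (simp add: sq_norm_def)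
qed

text \<open>
  Functions are not identified modulo null sets, so closedness is stated for limits in the seminorm; it
  includes invariance under changes on null sets (\<open>closed_subspace_AE\<close>).
\<close>

definition closed_subspace :: "'a measure \<Rightarrow> ('a \<Rightarrow> complex) set \<Rightarrow> bool"
  where "closed_subspace N G \<longleftrightarrow>
    (\<lambda>x. 0) \<in> G \<and>
    (\<forall>f\<in>G. \<forall>g\<in>G. (\<lambda>x. f x + g x) \<in> G) \<and>
    (\<forall>f\<in>G. \<forall>c. (\<lambda>x. c * f x) \<in> G) \<and>
    (\<forall>f s. f \<in> sq_int N \<longrightarrow> (\<forall>n. s n \<in> G \<inter> sq_int N) \<longrightarrow> (\<lambda>n. sq_norm N (\<lambda>x. f x - s n x)) \<longlonglongrightarrow> 0 \<longrightarrow> f \<in> G)"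

lemma closed_subspaceD:
  assumes "closed_subspace N G"
  shows "(\<lambda>x. 0) \<in> G" "f \<in> G \<Longrightarrow> g \<in> G \<Longrightarrow> (\<lambda>x. f x + g x) \<in> G" "f \<in> G \<Longrightarrow> (\<lambda>x. c * f x) \<in> G"
    "f \<in> sq_int N \<Longrightarrow> (\<And>n. s n \<in> G) \<Longrightarrow> (\<And>n. s n \<in> sq_int N) \<Longrightarrow> (\<lambda>n. sq_norm N (\<lambda>x. f x - s n x)) \<longlonglongrightarrow> 0 \<Longrightarrow> f \<in> G"
  using assms unfolding closed_subspace_def by blast+

lemma closed_subspace_diff:
  assumes "closed_subspace N G" "f \<in> G" "g \<in> G" shows "(\<lambda>x. f x - g x) \<in> G"
  using closed_subspaceD(2)[OF assms(1,2) closed_subspaceD(3)[OF assms(1,3), of "-1"]] by simp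

lemma closed_subspace_sum:
  assumes "closed_subspace N G" "\<And>i. i \<in> I \<Longrightarrow> f i \<in> G" shows "(\<lambda>x. \<Sum>i\<in>I. f i x) \<in> G"
  using assms(2)
  by (induction I rule: infinite_finite_induct) (auto intro!: closed_subspaceD(1,2)[OF assms(1)])

lemma closed_subspace_AE:
  assumes "closed_subspace N G" "g \<in> G" "g \<in> sq_int N" "f \<in> sq_int N" "AE x in N. f x = g x"
  shows "f \<in> G"
proof (rule closed_subspaceD(4)[OF assms(1,4), of "\<lambda>_. g"])
  have "sq_norm N (\<lambda>x. f x - g x) = 0"
    using assms by (subst sq_norm_zero_AE) (auto intro: sq_int_diff)
  then show "(\<lambda>n. sq_norm N (\<lambda>x. f x - g x)) \<longlonglongrightarrow> 0" by simp
qed (use assms in auto)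

lemma closed_subspace_cons:
  assumes G: "closed_subspace N G" and o: "orthonormal N \<phi>" and "\<And>n. \<phi> n \<in> G" and f: "f \<in> sq_int N"
    and "\<And>f. f \<in> sq_int N \<Longrightarrow> (\<And>m. inner_prod N (\<phi> m) f = 0) \<Longrightarrow> AE x in N. f x = 0"
  shows "f \<in> G"
proof (rule closed_subspaceD(4)[OF G f])
  show "(\<lambda>n. sq_norm N (\<lambda>x. f x - ons_proj N \<phi> n f x)) \<longlonglongrightarrow> 0"
    using complete_ons_expansion[OF o f assms(5)] .
  show "ons_proj N \<phi> n f \<in> sq_int N" for n by (rule ons_proj_sq_int[OF o])
  show "ons_proj N \<phi> n f \<in> G" for n
    unfolding ons_proj_def[abs_def] by (intro closed_subspace_sum[OF G] closed_subspaceD(3)[OF G] assms)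
qed

lemma sq_int_indicator_finite:
  assumes "A \<in> sets N" "emeasure N A < \<infinity>" shows "(\<lambda>x. indicator A x) \<in> sq_int N"
proof -
  have "integrable N (\<lambda>x. indicator A x :: real)" using assms by simp
  also have "(\<lambda>x. indicator A x :: real) = (\<lambda>x. (norm (indicator A x :: complex))\<^sup>2)"
    by (auto simp: indicator_def)
  finally show ?thesis using assms(1) by (auto simp: sq_int_def)
qed

lemma emeasure_Leb_interval: "emeasure (Leb L) ({a..b} \<inter> horizon L) < \<infinity>"
proof -
  have "emeasure (Leb L) ({a..b} \<inter> horizon L) = emeasure lebesgue ({a..b} \<inter> horizon L)"
    by (rule emeasure_restrict_space) auto
  also have "\<dots> \<le> emeasure lebesgue {a..b}" by (rule emeasure_mono) auto
  also have "\<dots> < \<infinity>" by (cases "a \<le> b") auto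
  finally show ?thesis .
qed

lemma sq_int_Leb_indicator:
  assumes "A \<in> sets (Leb L)" "A \<subseteq> {a..b}" shows "(\<lambda>x. indicator A x) \<in> sq_int (Leb L)"
proof (rule sq_int_indicator_finite[OF assms(1)])
  have "A \<subseteq> {a..b} \<inter> horizon L" using assms sets.sets_into_space[OF assms(1)] by auto
  then have "emeasure (Leb L) A \<le> emeasure (Leb L) ({a..b} \<inter> horizon L)"
    by (rule emeasure_mono) (auto intro: borel_Int_horizon)
  then show "emeasure (Leb L) A < \<infinity>" using emeasure_Leb_interval order.strict_trans1 by blast
qed

lemma atLeastAtMost_in_Leb: "t \<in> horizon L \<Longrightarrow> {0..t} \<in> sets (Leb L)"
  using borel_Int_horizon[of "{0..t}" L] horizon_downward[of t L] by (simp add: Int_absorb2 subset_iff)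

lemma greaterThanAtMost_in_Leb: "s \<in> horizon L \<Longrightarrow> t \<in> horizon L \<Longrightarrow> {s<..t} \<in> sets (Leb L)"
  using borel_Int_horizon[of "{s<..t}" L] horizon_downward[of t L]
  by (simp add: Int_absorb2 subset_iff horizon_def)

lemma AE_Leb_singleton: "AE x in Leb L. x \<noteq> a"
proof -
  have "AE x in lebesgue. x \<noteq> a"
    by (intro AE_I[of _ _ "{a}"]) auto
  then show ?thesis unfolding AE_Leb_iff by eventually_elim simp
qed

text \<open>
  The sets \<open>A\<close> whose restrictions to \<open>(0, t]\<close> have their indicator in \<open>G\<close> form a Dynkin system that contains
  all half-lines, hence all Borel sets, and up to null sets all Lebesgue sets.  Every square-integrable
  function is a dominated limit of linear combinations of such indicators.
\<close>

lemma closed_subspace_intervals_dense: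
  assumes G: "closed_subspace (Leb L) G"
    and S: "S \<subseteq> horizon L" "horizon L \<subseteq> closure S"
    and gen: "\<And>t. t \<in> S \<Longrightarrow> (\<lambda>x. indicator {0..t} x) \<in> G"
    and L: "0 < L"
    and f: "f \<in> sq_int (Leb L)"
  shows "f \<in> G"
proof -
  have ind: "(\<lambda>x. indicator {0..t} x) \<in> sq_int (Leb L)" if "t \<in> horizon L" for t
    by (rule sq_int_Leb_indicator[OF atLeastAtMost_in_Leb[OF that]]) auto
  have gen': "(\<lambda>x. indicator {0..t} x) \<in> G" if t: "t \<in> horizon L" for t
  proof -
    from t S(2) have "t \<in> closure S" by auto
    then obtain s where s: "\<And>n. s n \<in> S" "s \<longlonglongrightarrow> t"
      by (auto simp: closure_sequential)
    have "Bseq s" using s(2) by (intro convergent_imp_Bseq) (auto simp: convergent_def)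
    then obtain K where K: "\<And>n. norm (s n) \<le> K" by (metis Bseq_def)
    show ?thesis
    proof (rule closed_subspaceD(4)[OF G ind[OF t]])
      show "(\<lambda>x. indicator {0..s n} x) \<in> G" for n by (rule gen[OF s(1)])
      show "(\<lambda>x. indicator {0..s n} x) \<in> sq_int (Leb L)" for n using s(1) S(1) by (intro ind) auto
      show "(\<lambda>n. sq_norm (Leb L) (\<lambda>x. indicator {0..t} x - indicator {0..s n} x)) \<longlonglongrightarrow> 0"
      proof (rule sq_int_dominated_limit(3)[where w = "\<lambda>x. indicator ({0..K} \<inter> horizon L) x"])
        show "(\<lambda>x. indicator ({0..K} \<inter> horizon L) x) \<in> sq_int (Leb L)"
          by (rule sq_int_Leb_indicator[of _ _ 0 K]) (auto intro: borel_Int_horizon)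
        show "(\<lambda>x. indicator {0..s n} x) \<in> borel_measurable (Leb L)" for n
          by (rule borel_measurable_Leb) auto
        show "(\<lambda>x. indicator {0..t} x) \<in> borel_measurable (Leb L)"
          by (rule borel_measurable_Leb) auto
        show "AE x in Leb L. (\<lambda>n. indicator {0..s n} x :: complex) \<longlonglongrightarrow> indicator {0..t} x"
          using AE_Leb_singleton[where a = t and L = L]
        proof eventually_elim
          case (elim x)
          have "(\<lambda>n. indicator {0..} x * indicator {..s n} x :: complex) \<longlonglongrightarrow> indicator {0..} x * indicator {..t} x"
            by (intro tendsto_mult tendsto_const indicator_atMost_tendsto s(2) elim)
          moreover have "indicator {0..r} x = (indicator {0..} x * indicator {..r} x :: complex)" for r
            by (auto simp: indicator_def)
          ultimately show ?case by (simp only:)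
        qed
        show "AE x in Leb L. norm (indicator {0..s n} x :: complex) \<le> norm (indicator ({0..K} \<inter> horizon L) x :: complex)" for n
        proof (rule AE_I2)
          fix x assume "x \<in> space (Leb L)"
          then show "norm (indicator {0..s n} x :: complex) \<le> norm (indicator ({0..K} \<inter> horizon L) x :: complex)"
            using K[of n] by (auto simp: indicator_def)
        qed
      qed
    qed
  qed
  have gen0: "(\<lambda>x. indicator {0<..t} x) \<in> G" if t: "t \<in> horizon L" for t
  proof (rule closed_subspace_AE[OF G gen'[OF t] ind[OF t]])
    show "(\<lambda>x. indicator {0<..t} x) \<in> sq_int (Leb L)"
    proof (rule sq_int_Leb_indicator[of _ _ 0 t])
      have "0 \<in> horizon L" using L by (auto simp: horizon_def zero_ereal_def[symmetric])
      then show "{0<..t} \<in> sets (Leb L)" using t by (rule greaterThanAtMost_in_Leb)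
    qed auto
    show "AE x in Leb L. (indicator {0<..t} x :: complex) = indicator {0..t} x"
      using AE_Leb_singleton[where a = 0 and L = L] by eventually_elim (auto simp: indicator_def)
  qed
  have borel: "(\<lambda>x. indicator (A \<inter> {0<..t}) x) \<in> G" if t: "t \<in> horizon L" and A: "A \<in> sets borel" for A t
  proof -
    have sub: "{0<..t} \<subseteq> horizon L" using horizon_downward[OF t] by auto
    have sq: "(\<lambda>x. indicator (A \<inter> {0<..t}) x) \<in> sq_int (Leb L)" if "A \<in> sets borel" for A
      by (rule sq_int_Leb_indicator[of _ _ 0 t])
        (use borel_Int_horizon[of "A \<inter> {0<..t}" L] that sub in \<open>auto simp: Int_absorb2 subset_iff\<close>)
    have stable: "Int_stable (range (atMost :: real \<Rightarrow> real set))"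
      by (auto simp: Int_stable_def)
    have sub_Pow: "range (atMost :: real \<Rightarrow> real set) \<subseteq> Pow UNIV" by simp
    have "A \<in> sigma_sets UNIV (range atMost)"
      using A by (simp add: borel_eq_atMost)
    with stable sub_Pow show ?thesis
    proof (induction rule: sigma_sets_induct_disjoint)
      case (basic A)
      then obtain a where A: "A = {..a}" by auto
      show ?case
      proof (cases "a \<le> 0")
        case True
        then have "A \<inter> {0<..t} = {}" using A by auto
        then show ?thesis using closed_subspaceD(1)[OF G] by simp
      next
        case False
        then have "A \<inter> {0<..t} = {0<..min a t}" using A by auto
        moreover have "min a t \<in> horizon L" using False t by (intro horizon_downward[OF t]) (auto simp: horizon_def)
        ultimately show ?thesis using gen0 by simp
      qed
    next
      case empty
      then show ?case using closed_subspaceD(1)[OF G] by simp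
    next
      case (compl A)
      have "(\<lambda>x. indicator ((UNIV - A) \<inter> {0<..t}) x :: complex) = (\<lambda>x. indicator {0<..t} x - indicator (A \<inter> {0<..t}) x)"
        by (auto simp: indicator_def)
      then show ?case using closed_subspace_diff[OF G gen0[OF t] compl(2)] by simp
    next
      case (union A)
      have Ab: "A i \<in> sets borel" for i using union(2) by (auto simp: borel_eq_atMost)
      have part: "(\<lambda>x. \<Sum>i<n. indicator (A i \<inter> {0<..t}) x) \<in> G" for n
        by (intro closed_subspace_sum[OF G] union)
      have eq: "(\<Sum>i<n. indicator (A i \<inter> {0<..t}) x :: complex) = indicator ((\<Union>i<n. A i) \<inter> {0<..t}) x" for n x
      proof -
        have "(indicator (\<Union>i<n. A i \<inter> {0<..t}) x :: complex) = (\<Sum>i<n. indicator (A i \<inter> {0<..t}) x)"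
          by (rule indicator_UN_disjoint) (use union(1) in \<open>auto simp: disjoint_family_on_def\<close>)
        moreover have "(\<Union>i<n. A i \<inter> {0<..t}) = (\<Union>i<n. A i) \<inter> {0<..t}" by auto
        ultimately show ?thesis by simp
      qed
      have Ub: "(\<Union>i. A i) \<in> sets borel" "(\<Union>i<n. A i) \<in> sets borel" for n :: nat
        using Ab by auto
      show ?case
      proof (rule closed_subspaceD(4)[OF G sq])
        show "(\<Union>i. A i) \<in> sets borel" by (rule Ub)
        show "(\<lambda>x. indicator ((\<Union>i<n. A i) \<inter> {0<..t}) x) \<in> G" for n using part[of n] by (simp only: eq)
        show "(\<lambda>x. indicator ((\<Union>i<n. A i) \<inter> {0<..t}) x) \<in> sq_int (Leb L)" for n by (rule sq[OF Ub(2)])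
        show "(\<lambda>n. sq_norm (Leb L) (\<lambda>x. indicator ((\<Union>i. A i) \<inter> {0<..t}) x - indicator ((\<Union>i<n. A i) \<inter> {0<..t}) x)) \<longlonglongrightarrow> 0"
        proof (rule sq_int_dominated_limit(3)[OF sq[OF Ub(1)] sq_intD(1)[OF sq[OF Ub(2)]] sq_intD(1)[OF sq[OF Ub(1)]]])
          show "AE x in Leb L. (\<lambda>n. indicator ((\<Union>i<n. A i) \<inter> {0<..t}) x :: complex) \<longlonglongrightarrow> indicator ((\<Union>i. A i) \<inter> {0<..t}) x"
          proof (rule AE_I2)
            fix x
            show "(\<lambda>n. indicator ((\<Union>i<n. A i) \<inter> {0<..t}) x :: complex) \<longlonglongrightarrow> indicator ((\<Union>i. A i) \<inter> {0<..t}) x"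
            proof (cases "x \<in> (\<Union>i. A i)")
              case True
              then obtain j where "x \<in> A j" by auto
              then show ?thesis
                by (intro tendsto_eventually eventually_sequentiallyI[of "Suc j"]) (auto simp: indicator_def)
            next
              case False
              then show ?thesis by (auto simp: indicator_def)
            qed
          qed
        qed (auto simp: indicator_def)
      qed
    qed
  qed
  have leb: "(\<lambda>x. indicator (A \<inter> {0<..t}) x) \<in> G" if t: "t \<in> horizon L" and A: "A \<in> sets (Leb L)" for A t
  proof -
    from A have "A \<in> sets lebesgue" by (simp add: sets_Leb_iff)
    then obtain B N N' where B: "A = B \<union> N" "N \<subseteq> N'" "N' \<in> null_sets lborel" "B \<in> sets lborel"
      by (rule sets_completionE)
    have sub: "{0<..t} \<subseteq> horizon L" using horizon_downward[OF t] by auto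
    have N': "AE x in Leb L. x \<notin> N'"
    proof -
      have "AE x in lebesgue. x \<notin> N'" using AE_completion[OF AE_not_in[OF B(3)]] by simp
      then show ?thesis unfolding AE_Leb_iff by eventually_elim simp
    qed
    have s0: "{0<..t} \<in> sets (Leb L)" using borel_Int_horizon[of "{0<..t}" L] sub by (simp add: Int_absorb2)
    have "(\<lambda>x. indicator (B \<inter> {0<..t}) x) \<in> sq_int (Leb L)"
      by (rule sq_int_Leb_indicator[of _ _ 0 t])
        (use borel_Int_horizon[of "B \<inter> {0<..t}" L] B(4) sub in \<open>simp_all add: Int_absorb2 Int_assoc\<close>, auto)
    moreover have "(\<lambda>x. indicator (A \<inter> {0<..t}) x) \<in> sq_int (Leb L)"
      by (rule sq_int_Leb_indicator[of _ _ 0 t]) (use sets.Int[OF A s0] in auto)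
    moreover have "AE x in Leb L. (indicator (A \<inter> {0<..t}) x :: complex) = indicator (B \<inter> {0<..t}) x"
      using N'
    proof eventually_elim
      case (elim x)
      then have "x \<in> A \<longleftrightarrow> x \<in> B" using B(1,2) by blast
      then show ?case by (simp add: indicator_def)
    qed
    moreover have "(\<lambda>x. indicator (B \<inter> {0<..t}) x) \<in> G" using B(4) by (intro borel[OF t]) simp
    ultimately show ?thesis using closed_subspace_AE[OF G] by blast
  qed
  note [measurable] = sq_intD(1)[OF f]
  obtain F where F: "\<And>i. simple_function (Leb L) (F i)"
      "\<And>x. x \<in> space (Leb L) \<Longrightarrow> (\<lambda>i. F i x) \<longlonglongrightarrow> f x"
      "\<And>i x. x \<in> space (Leb L) \<Longrightarrow> dist (F i x) 0 \<le> 2 * dist (f x) 0"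
    using borel_measurable_implies_sequence_metric[OF sq_intD(1)[OF f], of 0] by metis
  \<comment> \<open>\<open>(0, T n]\<close> exhausts the time interval from within, whether \<open>L\<close> is finite or not.\<close>
  define T where "T n = (if ereal (real n) \<le> L then real n else real_of_ereal L)" for n
  have T: "T n \<in> horizon L" and Tn: "x \<in> horizon L \<Longrightarrow> x \<le> real n \<Longrightarrow> x \<le> T n" for n x
    using L by (cases L; auto simp: T_def horizon_def)+
  have T0: "{0<..T n} \<in> sets (Leb L)" for n
    using borel_Int_horizon[of "{0<..T n}" L] horizon_downward[OF T[of n]] by (simp add: Int_absorb2 subset_iff)
  have [measurable]: "F i \<in> borel_measurable (Leb L)" for i by (rule borel_measurable_simple_function[OF F(1)])
  show ?thesis
  proof (rule closed_subspaceD(4)[OF G f])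
    have dom: "AE x in Leb L. norm (F n x * indicator {0<..T n} x) \<le> norm (2 * f x)" for n
      using F(3)[of _ n] by (intro AE_I2) (auto simp: indicator_def norm_mult)
    have lim: "AE x in Leb L. (\<lambda>n. F n x * indicator {0<..T n} x) \<longlonglongrightarrow> f x"
      using AE_Leb_singleton[where a = 0 and L = L] AE_space
    proof eventually_elim
      case (elim x)
      have "\<forall>\<^sub>F n in sequentially. F n x = F n x * indicator {0<..T n} x"
        by (rule eventually_sequentiallyI[of "nat \<lceil>x\<rceil>"])
          (use elim Tn[of x] in \<open>auto simp: indicator_def horizon_def nat_ceiling_le_eq\<close>)
      from Lim_transform_eventually[OF F(2)[OF elim(2)] this] show ?case .
    qed
    have m: "(\<lambda>x. F n x * indicator {0<..T n} x) \<in> borel_measurable (Leb L)" for n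
      using T0[of n] by measurable
    show "(\<lambda>x. F n x * indicator {0<..T n} x) \<in> sq_int (Leb L)" for n
      by (rule sq_int_dominated_limit(2)[OF sq_int_scale[OF f, of 2] m sq_intD(1)[OF f] lim dom])
    show "(\<lambda>n. sq_norm (Leb L) (\<lambda>x. f x - F n x * indicator {0<..T n} x)) \<longlonglongrightarrow> 0"
      by (rule sq_int_dominated_limit(3)[OF sq_int_scale[OF f, of 2] m sq_intD(1)[OF f] lim dom])
    show "(\<lambda>x. F n x * indicator {0<..T n} x) \<in> G" for n
    proof -
      let ?A = "\<lambda>y. F n -` {y} \<inter> space (Leb L)"
      have fin: "finite (F n ` space (Leb L))" using F(1)[of n] by (simp add: simple_function_def)
      have eq: "F n x * indicator {0<..T n} x = (\<Sum>y\<in>F n ` space (Leb L). y * indicator (?A y \<inter> {0<..T n}) x)" for x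
      proof (cases "x \<in> {0<..T n}")
        case True
        then have x: "x \<in> space (Leb L)" using horizon_downward[OF T[of n]] by auto
        have "(\<Sum>y\<in>F n ` space (Leb L). y * indicator (?A y \<inter> {0<..T n}) x) = (\<Sum>y\<in>F n ` space (Leb L). if y = F n x then y else 0)"
          using x True by (intro sum.cong) (auto simp: indicator_def)
        also have "\<dots> = F n x" using fin x by simp
        finally show ?thesis using True by simp
      qed simp
      have "(\<lambda>x. \<Sum>y\<in>F n ` space (Leb L). y * indicator (?A y \<inter> {0<..T n}) x) \<in> G"
        by (intro closed_subspace_sum[OF G] closed_subspaceD(3)[OF G] leb[OF T]) measurable
      then show ?thesis by (simp only: eq)
    qed
  qed
qed

section \<open>Moments of elementary stochastic integrals\<close>

locale brownian = prob_space M for M :: "'w measure" +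
  fixes B :: "real \<Rightarrow> 'w \<Rightarrow> real" and L :: ereal
  assumes bm: "brownian_motion M B" and L_pos: "0 < L"
begin

lemma B_measurable: "0 \<le> t \<Longrightarrow> B t \<in> borel_measurable M"
  using bm by (auto simp: brownian_motion_def)

lemma B_indep: "0 \<le> t 0 \<Longrightarrow> mono t \<Longrightarrow>
    indep_vars (\<lambda>_. borel) (\<lambda>i w. B (t (Suc i)) w - B (t i) w) {..<n}" for t :: "nat \<Rightarrow> real"
  using bm by (auto simp: brownian_motion_def)

lemma B_normal: "0 \<le> s \<Longrightarrow> s < t \<Longrightarrow>
    distributed M lborel (\<lambda>w. B t w - B s w) (normal_density 0 (sqrt (t - s)))"
  using bm by (auto simp: brownian_motion_def)

text \<open>
  A linear combination of independent centred Gaussian variables is Gaussian, with fourth moment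
  \<open>3 \<sigma>\<^sup>4\<close>.  Vanishing coefficients are left out, because normal densities need a positive variance.
\<close>

lemma gaussian_fourth_moment:
  fixes t r :: "nat \<Rightarrow> real"
  assumes t: "0 \<le> t 0" "mono t" and strict: "\<forall>i<N. t i < t (Suc i)"
  shows "(\<integral>\<^sup>+w. ennreal ((\<Sum>i<N. r i * (B (t (Suc i)) w - B (t i) w)) ^ 4) \<partial>M)
     = ennreal (3 * (\<Sum>i<N. (r i)\<^sup>2 * (t (Suc i) - t i))\<^sup>2)"
proof -
  let ?D = "\<lambda>i w. B (t (Suc i)) w - B (t i) w"
  let ?I = "{i. i < N \<and> r i \<noteq> 0}"
  have I: "?I \<subseteq> {..<N}" by auto
  have s1: "(\<Sum>i<N. r i * ?D i w) = (\<Sum>i\<in>?I. r i * ?D i w)" for w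
    by (rule sum.mono_neutral_right) auto
  have s2: "(\<Sum>i<N. (r i)\<^sup>2 * (t (Suc i) - t i)) = (\<Sum>i\<in>?I. (\<bar>r i\<bar> * sqrt (t (Suc i) - t i))\<^sup>2)"
  proof -
    have "(\<Sum>i<N. (r i)\<^sup>2 * (t (Suc i) - t i)) = (\<Sum>i\<in>?I. (r i)\<^sup>2 * (t (Suc i) - t i))"
      by (rule sum.mono_neutral_right) auto
    also have "\<dots> = (\<Sum>i\<in>?I. (\<bar>r i\<bar> * sqrt (t (Suc i) - t i))\<^sup>2)"
      using strict by (intro sum.cong refl) (auto simp: power_mult_distrib less_imp_le)
    finally show ?thesis .
  qed
  show ?thesis
  proof (cases "?I = {}")
    case True
    then show ?thesis unfolding s1 s2 by simp
  next
    case False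
    define \<sigma> where "\<sigma> = sqrt (\<Sum>i\<in>?I. (\<bar>r i\<bar> * sqrt (t (Suc i) - t i))\<^sup>2)"
    have t0: "0 \<le> t i" for i using t monoD[OF t(2), of 0 i] by simp
    have ind: "indep_vars (\<lambda>i. borel) (\<lambda>i w. r i * ?D i w) ?I"
      by (rule indep_vars_compose2[OF indep_vars_subset[OF B_indep[OF t, of N] I]]) auto
    have d: "distributed M lborel (\<lambda>w. \<Sum>i\<in>?I. r i * ?D i w) (normal_density (\<Sum>i\<in>?I. 0) \<sigma>)"
      unfolding \<sigma>_def
    proof (rule sum_indep_normal[OF _ False ind])
      show "0 < \<bar>r i\<bar> * sqrt (t (Suc i) - t i)" if "i \<in> ?I" for i using strict that by auto
      show "distributed M lborel (\<lambda>w. r i * ?D i w) (normal_density 0 (\<bar>r i\<bar> * sqrt (t (Suc i) - t i)))" if "i \<in> ?I" for i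
        using normal_density_affine[OF B_normal[OF t0[of i], of "t (Suc i)"], where \<alpha> = "r i" and \<beta> = 0] strict that by auto
    qed auto
    have \<sigma>: "0 < \<sigma>" unfolding \<sigma>_def
      by (intro real_sqrt_gt_zero sum_pos) (use strict False in \<open>auto simp: power_mult_distrib less_imp_le\<close>)
    have "(\<integral>\<^sup>+w. ennreal ((\<Sum>i\<in>?I. r i * ?D i w) ^ 4) \<partial>M)
       = (\<integral>\<^sup>+x. ennreal (normal_density 0 \<sigma> x) * ennreal (x ^ 4) \<partial>lborel)"
      using distributed_nn_integral[OF d, of "\<lambda>x. ennreal (x ^ 4)"] by simp
    also have "\<dots> = (\<integral>\<^sup>+x. ennreal (normal_density 0 \<sigma> x * x ^ 4) \<partial>lborel)"
      by (intro nn_integral_cong) (simp add: ennreal_mult')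
    also have "\<dots> = ennreal (fact (2 * 2) / ((2 / \<sigma>\<^sup>2) ^ 2 * fact 2))"
    proof -
      have "has_bochner_integral lborel (\<lambda>x. normal_density 0 \<sigma> x * x ^ 4) (fact (2 * 2) / ((2 / \<sigma>\<^sup>2) ^ 2 * fact 2))"
        using normal_moment_even[OF \<sigma>, of 0 2] by simp
      then show ?thesis by (intro nn_integral_eq_integrable[THEN iffD2]) (auto simp: has_bochner_integral_iff zero_le_even_power)
    qed
    also have "fact (2 * 2) / ((2 / \<sigma>\<^sup>2) ^ 2 * fact 2) = 3 * (\<sigma>\<^sup>2)\<^sup>2"
      using \<sigma> by (simp add: fact_numeral field_simps)
    also have "\<sigma>\<^sup>2 = (\<Sum>i\<in>?I. (\<bar>r i\<bar> * sqrt (t (Suc i) - t i))\<^sup>2)"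
      unfolding \<sigma>_def by (intro real_sqrt_pow2 sum_nonneg) auto
    finally show ?thesis unfolding s1 s2 .
  qed
qed

end

text \<open>
  The endpoints of the intervals of a step function, listed in increasing order and continued constantly, so
  that independence of the increments along monotone sequences applies to them.
\<close>

lemma finite_set_grid:
  fixes T :: "real set"
  assumes "finite T" "T \<noteq> {}"
  shows "\<exists>t N. mono t \<and> (\<forall>i<N. t i < t (Suc i)) \<and> t ` {..N::nat} = T"
proof -
  define l where "l = sorted_list_of_set T"
  have l: "set l = T" "sorted_wrt (<) l" "l \<noteq> []"
    using assms by (auto simp: l_def)
  let ?t = "\<lambda>i. l ! min i (length l - 1)"
  have lt: "l ! i < l ! j" if "i < j" "j < length l" for i j
    using sorted_wrt_nth_less[OF l(2) that] .
  have len: "0 < length l" using l(3) by simp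
  have "mono ?t"
  proof (rule monoI)
    fix i j :: nat assume "i \<le> j"
    then have "min i (length l - 1) \<le> min j (length l - 1)" by auto
    moreover have "min j (length l - 1) < length l" using len by linarith
    ultimately show "?t i \<le> ?t j"
      using lt[of "min i (length l - 1)" "min j (length l - 1)"] by (metis order_le_less order_refl)
  qed
  moreover have "\<forall>i<length l - 1. ?t i < ?t (Suc i)" by (auto intro: lt)
  moreover have "?t ` {..length l - 1} = T"
  proof -
    have "?t ` {..length l - 1} = (!) l ` {..<length l}"
    proof (rule image_cong)
      show "{..length l - 1} = {..<length l}" using len by (cases "length l") auto
    qed auto
    also have "\<dots> = T" using l(1) by (auto simp: set_conv_nth)
    finally show ?thesis .
  qed
  ultimately show ?thesis by blast
qed

lemma strict_grid:
  fixes t :: "nat \<Rightarrow> real"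
  assumes "mono t" "\<forall>i<N. t i < t (Suc i)" "i \<le> N" "j \<le> N"
  shows "t i < t j \<longleftrightarrow> i < j" "t i \<le> t j \<longleftrightarrow> i \<le> j"
proof -
  have *: "t i < t j" if "i < j" "j \<le> N" for i j
  proof -
    have "t i < t (Suc i)" using assms(2) that by simp
    also have "\<dots> \<le> t j" using that by (intro monoD[OF assms(1)]) auto
    finally show ?thesis .
  qed
  show "t i < t j \<longleftrightarrow> i < j" using *[of i j] *[of j i] assms by (metis less_asym less_irrefl nat_neq_iff)
  show "t i \<le> t j \<longleftrightarrow> i \<le> j" using *[of i j] *[of j i] assms by (metis monoD not_le)
qed

text \<open>
  On a common grid for all endpoints, overlapping intervals are refined into disjoint ones: the coefficient of
  the increment over \<open>(t\<^sub>i, t\<^sub>i\<^sub>+\<^sub>1]\<close> is the value of the step function there.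
\<close>

lemma step_integral_grid:
  fixes t :: "nat \<Rightarrow> real"
  assumes t: "mono t" "\<forall>i<N. t i < t (Suc i)"
    and p: "\<forall>(c, s, u)\<in>set p. s \<in> t ` {..N} \<and> u \<in> t ` {..N} \<and> s \<le> u"
  shows "step_integral B p w = (\<Sum>i<N. step_fun p (t (Suc i)) * complex_of_real (B (t (Suc i)) w - B (t i) w))"
  using p
proof (induction p)
  case Nil
  then show ?case by (simp add: step_integral_def step_fun_def)
next
  case (Cons q p)
  obtain c s u where q: "q = (c, s, u)" by (cases q)
  from Cons.prems obtain a b where ab: "a \<le> N" "b \<le> N" "s = t a" "u = t b" "t a \<le> t b"
    by (auto simp: q)
  have iff: "indicator {s<..u} (t (Suc i)) = (of_bool (i \<in> {a..<b}) :: complex)" if "i < N" for i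
    using strict_grid[OF t, of a "Suc i"] strict_grid[OF t, of "Suc i" b] that ab
    by (auto simp: indicator_def)
  have "a \<le> b" using strict_grid(2)[OF t ab(1,2)] ab(5) by simp
  have "(\<Sum>i<N. c * indicator {s<..u} (t (Suc i)) * complex_of_real (B (t (Suc i)) w - B (t i) w))
     = (\<Sum>i<N. if i \<in> {a..<b} then c * complex_of_real (B (t (Suc i)) w - B (t i) w) else 0)"
    by (intro sum.cong refl) (auto simp: iff)
  also have "\<dots> = (\<Sum>i\<in>{a..<b}. c * complex_of_real (B (t (Suc i)) w - B (t i) w))"
    by (rule sum.mono_neutral_cong_right) (use ab in auto)
  also have "\<dots> = c * complex_of_real (\<Sum>i\<in>{a..<b}. B (t (Suc i)) w - B (t i) w)"
    by (simp add: sum_distrib_left)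
  also have "(\<Sum>i\<in>{a..<b}. B (t (Suc i)) w - B (t i) w) = B u w - B s w"
    using sum_Suc_diff'[OF \<open>a \<le> b\<close>, of "\<lambda>i. B (t i) w"] ab by simp
  finally have *: "c * complex_of_real (B u w - B s w)
     = (\<Sum>i<N. c * indicator {s<..u} (t (Suc i)) * complex_of_real (B (t (Suc i)) w - B (t i) w))" ..
  have "step_integral B (q # p) w = c * complex_of_real (B u w - B s w) + step_integral B p w"
    by (simp add: step_integral_def q)
  also have "step_integral B p w = (\<Sum>i<N. step_fun p (t (Suc i)) * complex_of_real (B (t (Suc i)) w - B (t i) w))"
    using Cons.prems by (intro Cons.IH) auto
  finally show ?case
    unfolding * by (simp add: step_fun_def q distrib_right flip: sum.distrib)
qed

lemma step_fun_append: "step_fun (p @ q) x = step_fun p x + step_fun q x"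
  by (simp add: step_fun_def)

lemma step_integral_append: "step_integral B (p @ q) w = step_integral B p w + step_integral B q w"
  by (simp add: step_integral_def)

definition step_scale :: "complex \<Rightarrow> step \<Rightarrow> step"
  where "step_scale a p = map (\<lambda>(c, s, u). (a * c, s, u)) p"

lemma step_fun_scale: "step_fun (step_scale a p) x = a * step_fun p x"
  by (induction p) (auto simp: step_fun_def step_scale_def algebra_simps)

lemma step_integral_scale: "step_integral B (step_scale a p) w = a * step_integral B p w"
  by (induction p) (auto simp: step_integral_def step_scale_def algebra_simps)

lemma step_in_append: "step_in L p \<Longrightarrow> step_in L q \<Longrightarrow> step_in L (p @ q)"
  by (auto simp: step_in_def)

lemma step_in_scale: "step_in L p \<Longrightarrow> step_in L (step_scale a p)"
  by (auto simp: step_in_def step_scale_def)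

lemma step_fun_sq_int: "step_in L p \<Longrightarrow> step_fun p \<in> sq_int (Leb L)"
proof (induction p)
  case Nil
  then show ?case by (simp add: step_fun_def[abs_def])
next
  case (Cons q p)
  obtain c s u where q: "q = (c, s, u)" by (cases q)
  have su: "s \<in> horizon L" "u \<in> horizon L" and p: "step_in L p" using Cons.prems by (auto simp: step_in_def q)
  have "(\<lambda>x. indicator {s<..u} x) \<in> sq_int (Leb L)"
    by (rule sq_int_Leb_indicator[of _ _ s u]) (use greaterThanAtMost_in_Leb[OF su] in auto)
  then have "(\<lambda>x. c * indicator {s<..u} x + step_fun p x) \<in> sq_int (Leb L)"
    by (intro sq_int_add sq_int_scale Cons.IH p)
  then show ?case by (simp add: step_fun_def[abs_def] q)
qed

context brownian
begin

lemma step_integral_measurable: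
  assumes "step_in L p" shows "step_integral B p \<in> borel_measurable M"
  using assms
proof (induction p)
  case Nil
  then show ?case by (simp add: step_integral_def[abs_def])
next
  case (Cons q p)
  obtain c s u where q: "q = (c, s, u)" by (cases q)
  have su: "s \<in> horizon L" "u \<in> horizon L" and p: "step_in L p" using Cons.prems by (auto simp: step_in_def q)
  then have [measurable]: "B s \<in> borel_measurable M" "B u \<in> borel_measurable M" "step_integral B p \<in> borel_measurable M"
    by (auto intro: B_measurable Cons.IH simp: horizon_def)
  have "(\<lambda>w. c * complex_of_real (B u w - B s w) + step_integral B p w) \<in> borel_measurable M"
    by measurable
  then show ?case by (simp add: step_integral_def[abs_def] q)
qed

text \<open>
  The Gaussian fourth moment for the real and the imaginary part of the coefficients, together with
  \<open>\<bar>z\<bar>\<^sup>4 \<le> 2 (Re z)\<^sup>4 + 2 (Im z)\<^sup>4\<close>.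
\<close>

lemma step_integral_fourth_moment:
  assumes p: "step_in L p"
  shows "(\<integral>\<^sup>+w. ennreal ((norm (step_integral B p w)) ^ 4) \<partial>M) \<le> ennreal (6 * (sq_norm (Leb L) (step_fun p))\<^sup>2)"
proof -
  let ?T = "insert 0 (fst ` snd ` set p \<union> snd ` snd ` set p)"
  have 0: "0 \<in> horizon L" using L_pos by (auto simp: horizon_def zero_ereal_def[symmetric])
  have sub: "?T \<subseteq> horizon L" using p 0 by (auto simp: step_in_def)
  obtain t and N :: nat where t: "mono t" "\<forall>i<N. t i < t (Suc i)" "t ` {..N} = ?T"
    using finite_set_grid[of ?T] by auto
  have T: "t i \<in> horizon L" if "i \<le> N" for i using t(3) sub that by blast
  have t0: "0 \<le> t 0" using T[of 0] by (simp add: horizon_def)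
  have pT: "\<forall>(c, s, u)\<in>set p. s \<in> t ` {..N} \<and> u \<in> t ` {..N} \<and> s \<le> u"
  proof clarify
    fix c s u assume m: "(c, s, u) \<in> set p"
    from imageI[OF imageI[OF m, of snd], of fst] imageI[OF imageI[OF m, of snd], of snd]
    show "s \<in> t ` {..N} \<and> u \<in> t ` {..N} \<and> s \<le> u"
      using p m unfolding t(3) by (auto simp: step_in_def)
  qed
  define d where "d i = step_fun p (t (Suc i))" for i
  define \<Delta> where "\<Delta> i = t (Suc i) - t i" for i
  have \<Delta>0: "0 \<le> \<Delta> i" for i unfolding \<Delta>_def using monoD[OF t(1), of i "Suc i"] by simp
  have energy: "(\<Sum>i<N. (norm (d i))\<^sup>2 * \<Delta> i) \<le> sq_norm (Leb L) (step_fun p)"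
  proof -
    have fin: "integrable (Leb L) (\<lambda>x. indicator {t i<..t (Suc i)} x :: real)"
       and me: "(LINT x|Leb L. indicator {t i<..t (Suc i)} x) = \<Delta> i" if "i < N" for i
    proof -
      have s: "{t i<..t (Suc i)} \<in> sets (Leb L)" using T[of i] T[of "Suc i"] that by (intro greaterThanAtMost_in_Leb) auto
      then have sub: "{t i<..t (Suc i)} \<subseteq> horizon L" by (simp add: sets_Leb_iff)
      have e: "emeasure (Leb L) {t i<..t (Suc i)} = ennreal (\<Delta> i)"
        using sub t(2) that by (subst emeasure_restrict_space) (auto simp: \<Delta>_def)
      show "integrable (Leb L) (\<lambda>x. indicator {t i<..t (Suc i)} x :: real)" using s e by simp
      show "(LINT x|Leb L. indicator {t i<..t (Suc i)} x) = \<Delta> i" using sub e \<Delta>0 by (simp add: measure_def Int_absorb2)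
    qed
    have "(\<Sum>i<N. (norm (d i))\<^sup>2 * \<Delta> i) = (\<Sum>i<N. LINT x|Leb L. (norm (d i))\<^sup>2 * indicator {t i<..t (Suc i)} x)"
      using me by (intro sum.cong) auto
    also have "\<dots> = (LINT x|Leb L. (\<Sum>i<N. (norm (d i))\<^sup>2 * indicator {t i<..t (Suc i)} x))"
      using fin by (subst Bochner_Integration.integral_sum) auto
    also have "\<dots> \<le> (LINT x|Leb L. (norm (step_fun p x))\<^sup>2)"
    proof (rule integral_mono)
      show "integrable (Leb L) (\<lambda>x. (\<Sum>i<N. (norm (d i))\<^sup>2 * indicator {t i<..t (Suc i)} x))"
        using fin by (intro Bochner_Integration.integrable_sum integrable_mult_right) auto
      show "integrable (Leb L) (\<lambda>x. (norm (step_fun p x))\<^sup>2)" by (rule sq_intD(2)[OF step_fun_sq_int[OF p]])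
      fix x
      show "(\<Sum>i<N. (norm (d i))\<^sup>2 * indicator {t i<..t (Suc i)} x) \<le> (norm (step_fun p x))\<^sup>2"
      proof (cases "\<exists>j<N. x \<in> {t j<..t (Suc j)}")
        case False
        then have "(\<Sum>i<N. (norm (d i))\<^sup>2 * indicator {t i<..t (Suc i)} x) = 0" by (intro sum.neutral) auto
        then show ?thesis by simp
      next
        case True
        then obtain j where j: "j < N" "t j < x" "x \<le> t (Suc j)" by auto
        have other: "x \<notin> {t i<..t (Suc i)}" if "i \<noteq> j" for i
        proof (cases "i < j")
          case True
          then have "t (Suc i) \<le> t j" by (intro monoD[OF t(1)]) auto
          then show ?thesis using j by auto
        next
          case False
          then have "t (Suc j) \<le> t i" using that by (intro monoD[OF t(1)]) auto
          then show ?thesis using j by auto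
        qed
        have "(\<Sum>i<N. (norm (d i))\<^sup>2 * indicator {t i<..t (Suc i)} x) = (\<Sum>i<N. if i = j then (norm (d i))\<^sup>2 else 0)"
          using other j by (intro sum.cong) (auto simp: indicator_def)
        also have "\<dots> = (norm (d j))\<^sup>2" using j by simp
        also have "d j = step_fun p x"
          unfolding d_def step_fun_def
        proof (intro arg_cong[where f = sum_list] map_cong refl, clarify)
          fix c s u assume "(c, s, u) \<in> set p"
          with pT obtain a b where ab: "a \<le> N" "b \<le> N" "s = t a" "u = t b" by blast
          have "t a < t (Suc j) \<longleftrightarrow> t a < x"
            using strict_grid[OF t(1,2), of a "Suc j"] strict_grid[OF t(1,2), of a j] j ab by auto
          moreover have "t (Suc j) \<le> t b \<longleftrightarrow> x \<le> t b"
            using strict_grid[OF t(1,2), of "Suc j" b] strict_grid[OF t(1,2), of j b] j ab by auto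
          ultimately show "c * indicator {s<..u} (t (Suc j)) = c * indicator {s<..u} x"
            using ab by (auto simp: indicator_def)
        qed
        finally show ?thesis by simp
      qed
    qed
    finally show ?thesis by (simp add: sq_norm_def)
  qed
  let ?X = "\<lambda>r w. \<Sum>i<N. r i * (B (t (Suc i)) w - B (t i) w)"
  have B_m: "B (t i) \<in> borel_measurable M" for i
    using t0 monoD[OF t(1), of 0 i] by (intro B_measurable) simp
  have [measurable]: "?X r \<in> borel_measurable M" for r
    using B_m by (intro borel_measurable_sum borel_measurable_times borel_measurable_diff) auto
  let ?a = "\<Sum>i<N. (Re (d i))\<^sup>2 * \<Delta> i" and ?b = "\<Sum>i<N. (Im (d i))\<^sup>2 * \<Delta> i"
  have ab0: "0 \<le> ?a" "0 \<le> ?b" by (auto intro!: sum_nonneg mult_nonneg_nonneg \<Delta>0)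
  have abs4: "(norm z) ^ 4 \<le> 2 * (Re z) ^ 4 + 2 * (Im z) ^ 4" for z :: complex
  proof -
    have "(norm z) ^ 4 = ((norm z)\<^sup>2)\<^sup>2" by (simp flip: power_mult)
    also have "\<dots> = ((Re z)\<^sup>2 + (Im z)\<^sup>2)\<^sup>2" by (simp add: cmod_power2)
    also have "\<dots> \<le> 2 * ((Re z)\<^sup>2)\<^sup>2 + 2 * ((Im z)\<^sup>2)\<^sup>2"
      using sum_squares_bound[of "(Re z)\<^sup>2" "(Im z)\<^sup>2"] by (simp add: power2_sum)
    finally show ?thesis by (simp flip: power_mult)
  qed
  have "(\<integral>\<^sup>+w. ennreal ((norm (step_integral B p w)) ^ 4) \<partial>M)
      \<le> (\<integral>\<^sup>+w. 2 * ennreal ((?X (\<lambda>i. Re (d i)) w) ^ 4) + 2 * ennreal ((?X (\<lambda>i. Im (d i)) w) ^ 4) \<partial>M)"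
  proof (rule nn_integral_mono)
    fix w
    have e: "step_integral B p w = (\<Sum>i<N. d i * complex_of_real (B (t (Suc i)) w - B (t i) w))"
      unfolding d_def by (rule step_integral_grid[OF t(1,2) pT])
    have "ennreal ((norm (step_integral B p w)) ^ 4) \<le> ennreal (2 * (?X (\<lambda>i. Re (d i)) w) ^ 4 + 2 * (?X (\<lambda>i. Im (d i)) w) ^ 4)"
      using abs4[of "step_integral B p w"] by (intro ennreal_leI) (simp add: e)
    also have "\<dots> = 2 * ennreal ((?X (\<lambda>i. Re (d i)) w) ^ 4) + 2 * ennreal ((?X (\<lambda>i. Im (d i)) w) ^ 4)"
      by (subst ennreal_plus) (auto simp: ennreal_mult' zero_le_even_power)
    finally show "ennreal ((norm (step_integral B p w)) ^ 4) \<le> \<dots>" .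
  qed
  also have "\<dots> = 2 * ennreal (3 * ?a\<^sup>2) + 2 * ennreal (3 * ?b\<^sup>2)"
    by (simp add: nn_integral_add nn_integral_cmult gaussian_fourth_moment[OF t0 t(1,2)] \<Delta>_def)
  also have "\<dots> = ennreal (6 * ?a\<^sup>2 + 6 * ?b\<^sup>2)"
    by (subst ennreal_plus) (auto simp: ennreal_mult' simp flip: ennreal_mult' mult.assoc ennreal_numeral)
  also have "\<dots> \<le> ennreal (6 * (?a + ?b)\<^sup>2)"
    using mult_nonneg_nonneg[OF ab0] by (intro ennreal_leI) (simp add: power2_sum)
  also have "?a + ?b = (\<Sum>i<N. (norm (d i))\<^sup>2 * \<Delta> i)"
    by (simp add: cmod_power2 algebra_simps sum.distrib)
  also have "ennreal (6 * (\<Sum>i<N. (norm (d i))\<^sup>2 * \<Delta> i)\<^sup>2) \<le> ennreal (6 * (sq_norm (Leb L) (step_fun p))\<^sup>2)"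
    using energy by (intro ennreal_leI mult_left_mono power_mono sum_nonneg mult_nonneg_nonneg \<Delta>0) auto
  finally show ?thesis .
qed

end

section \<open>Convergence in probability\<close>

context prob_space
begin

lemma in_prob_add:
  assumes X: "tendsto_in_prob M X Z" and X': "tendsto_in_prob M X' Z'"
    and [measurable]: "\<And>n. X n \<in> borel_measurable M" "\<And>n. X' n \<in> borel_measurable M"
      "Z \<in> borel_measurable M" "Z' \<in> borel_measurable M"
  shows "tendsto_in_prob M (\<lambda>n w. X n w + X' n w) (\<lambda>w. Z w + Z' w)"
  unfolding tendsto_in_prob_def
proof (intro allI impI)
  fix \<epsilon> :: real assume \<epsilon>: "0 < \<epsilon>"
  let ?a = "\<lambda>n. prob {w \<in> space M. norm (X n w - Z w) > \<epsilon> / 2}"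
  let ?b = "\<lambda>n. prob {w \<in> space M. norm (X' n w - Z' w) > \<epsilon> / 2}"
  have le: "prob {w \<in> space M. norm (X n w + X' n w - (Z w + Z' w)) > \<epsilon>} \<le> ?a n + ?b n" for n
  proof -
    have "prob {w \<in> space M. norm (X n w + X' n w - (Z w + Z' w)) > \<epsilon>}
       \<le> prob ({w \<in> space M. norm (X n w - Z w) > \<epsilon> / 2} \<union> {w \<in> space M. norm (X' n w - Z' w) > \<epsilon> / 2})"
    proof (rule finite_measure_mono)
      have "norm (X n w - Z w) > \<epsilon> / 2 \<or> norm (X' n w - Z' w) > \<epsilon> / 2" if "norm (X n w + X' n w - (Z w + Z' w)) > \<epsilon>" for w
        using norm_triangle_ineq[of "X n w - Z w" "X' n w - Z' w"] that by (simp add: algebra_simps) linarith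
      then show "{w \<in> space M. norm (X n w + X' n w - (Z w + Z' w)) > \<epsilon>} \<subseteq>
         {w \<in> space M. norm (X n w - Z w) > \<epsilon> / 2} \<union> {w \<in> space M. norm (X' n w - Z' w) > \<epsilon> / 2}" by auto
    qed measurable
    also have "\<dots> \<le> ?a n + ?b n" by (intro measure_Un_le) measurable
    finally show ?thesis .
  qed
  have "?a \<longlonglongrightarrow> 0" "?b \<longlonglongrightarrow> 0" using X X' half_gt_zero[OF \<epsilon>] unfolding tendsto_in_prob_def by blast+
  from tendsto_add[OF this] have "(\<lambda>n. ?a n + ?b n) \<longlonglongrightarrow> 0" by simp
  then show "(\<lambda>n. prob {w \<in> space M. norm (X n w + X' n w - (Z w + Z' w)) > \<epsilon>}) \<longlonglongrightarrow> 0"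
    using Lim_null_comparison[OF always_eventually, OF allI, of "\<lambda>n. prob {w \<in> space M. norm (X n w + X' n w - (Z w + Z' w)) > \<epsilon>}"
      "\<lambda>n. ?a n + ?b n"] le by simp
qed

lemma in_prob_scale:
  assumes X: "tendsto_in_prob M X Z"
  shows "tendsto_in_prob M (\<lambda>n w. c * X n w) (\<lambda>w. c * Z w)"
proof (cases "c = 0")
  case True
  then show ?thesis by (simp add: tendsto_in_prob_def not_less)
next
  case False
  have "norm (c * X n w - c * Z w) > \<epsilon> \<longleftrightarrow> norm (X n w - Z w) > \<epsilon> / norm c" for n w \<epsilon>
  proof -
    have "norm (c * X n w - c * Z w) = norm c * norm (X n w - Z w)"
      by (simp only: right_diff_distrib[symmetric] norm_mult)
    then show ?thesis using False by (simp add: pos_divide_less_eq mult.commute)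
  qed
  then show ?thesis using X False by (simp add: tendsto_in_prob_def)
qed

lemma in_prob_diff:
  assumes X: "tendsto_in_prob M X Z" and X': "tendsto_in_prob M X' Z'"
    and m: "\<And>n. X n \<in> borel_measurable M" "\<And>n. X' n \<in> borel_measurable M"
      "Z \<in> borel_measurable M" "Z' \<in> borel_measurable M"
  shows "tendsto_in_prob M (\<lambda>n w. X n w - X' n w) (\<lambda>w. Z w - Z' w)"
  using in_prob_add[OF X in_prob_scale[OF X', of "-1"] m(1) _ m(3)] m(2,4) by simp

lemma in_prob_unique:
  assumes X: "tendsto_in_prob M X Z" and X': "tendsto_in_prob M X Z'"
    and [measurable]: "\<And>n. X n \<in> borel_measurable M" "Z \<in> borel_measurable M" "Z' \<in> borel_measurable M"
  shows "AE w in M. Z w = Z' w"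
proof -
  have *: "tendsto_in_prob M (\<lambda>n w. X n w - X n w) (\<lambda>w. Z w - Z' w)"
    by (rule in_prob_diff[OF X X']) measurable
  have "prob {w \<in> space M. norm (Z w - Z' w) > \<epsilon>} = 0" if "\<epsilon> > 0" for \<epsilon>
    using * that by (auto simp: tendsto_in_prob_def norm_minus_commute LIMSEQ_const_iff)
  then have "AE w in M. \<not> norm (Z w - Z' w) > 1 / real (Suc k)" for k
    by (subst AE_iff_measurable[OF _ refl]) (auto simp: emeasure_eq_measure)
  then have "AE w in M. \<forall>k. \<not> norm (Z w - Z' w) > 1 / real (Suc k)" by (simp add: AE_all_countable)
  then show ?thesis
  proof eventually_elim
    case (elim w)
    show ?case
    proof (rule ccontr)
      assume "Z w \<noteq> Z' w"
      then have "0 < norm (Z w - Z' w)" by simp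
      from reals_Archimedean[OF this] elim show False by (auto simp: inverse_eq_divide)
    qed
  qed
qed

lemma in_prob_cong_AE:
  assumes X: "tendsto_in_prob M X Z" and eq: "\<And>n. AE w in M. X n w = X' n w" "AE w in M. Z w = Z' w"
    and [measurable]: "\<And>n. X n \<in> borel_measurable M" "\<And>n. X' n \<in> borel_measurable M" "Z \<in> borel_measurable M" "Z' \<in> borel_measurable M"
  shows "tendsto_in_prob M X' Z'"
proof -
  have "prob {w \<in> space M. norm (X n w - Z w) > \<epsilon>} = prob {w \<in> space M. norm (X' n w - Z' w) > \<epsilon>}" for n \<epsilon>
    by (rule finite_measure_eq_AE, use eq(1)[of n] eq(2) in eventually_elim) auto
  then show ?thesis using X by (simp add: tendsto_in_prob_def)
qed

lemma in_prob_of_AE: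
  assumes lim: "AE w in M. (\<lambda>n. X n w) \<longlonglongrightarrow> Z w"
    and [measurable]: "\<And>n. X n \<in> borel_measurable M" "Z \<in> borel_measurable M"
  shows "tendsto_in_prob M X Z"
  unfolding tendsto_in_prob_def
proof (intro allI impI)
  fix \<epsilon> :: real assume \<epsilon>: "0 < \<epsilon>"
  let ?A = "\<lambda>n. {w \<in> space M. norm (X n w - Z w) > \<epsilon>}"
  have "(\<lambda>n. LINT w|M. indicator (?A n) w) \<longlonglongrightarrow> (LINT w|M. 0 :: real)"
  proof (rule integral_dominated_convergence[where w = "\<lambda>_. 1"])
    show "AE w in M. (\<lambda>n. indicator (?A n) w :: real) \<longlonglongrightarrow> 0"
      using lim
    proof eventually_elim
      case (elim w)
      from tendstoD[OF elim \<epsilon>] have "\<forall>\<^sub>F n in sequentially. (indicator (?A n) w :: real) = 0"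
        by eventually_elim (auto simp: indicator_def dist_norm)
      then show ?case by (rule tendsto_eventually)
    qed
  qed (auto simp: indicator_def)
  then show "(\<lambda>n. prob (?A n)) \<longlonglongrightarrow> 0" by simp
qed

text \<open>
  The factor \<open>K\<close> may depend on \<open>w\<close> in a non-measurable way.  This is harmless along subsequences: if
  \<open>X\<close> did not converge, a subsequence would stay away from 0, but a further subsequence of \<open>Y\<close> with summable
  expectations tends to 0 almost surely, and then so does \<open>X\<close> along it.
\<close>

lemma in_prob_of_bound:
  assumes [measurable]: "\<And>n. X n \<in> borel_measurable M" "\<And>n. Y n \<in> borel_measurable M"
    and Y: "(\<lambda>n. \<integral>\<^sup>+w. Y n w \<partial>M) \<longlonglongrightarrow> 0"
    and bound: "AE w in M. \<exists>K::real. \<forall>n. ennreal (norm (X n w)) \<le> ennreal K * Y n w"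
  shows "tendsto_in_prob M X (\<lambda>_. 0)"
  unfolding tendsto_in_prob_def
proof (intro allI impI, rule ccontr)
  fix \<epsilon> :: real assume \<epsilon>: "0 < \<epsilon>"
  let ?a = "\<lambda>n. prob {w \<in> space M. norm (X n w - 0) > \<epsilon>}"
  assume "\<not> ?a \<longlonglongrightarrow> 0"
  then obtain \<delta> where \<delta>': "0 < \<delta>" "\<And>N. \<exists>n\<ge>N. \<not> dist (?a n) 0 < \<delta>"
    unfolding LIMSEQ_def by blast
  have \<delta>: "0 < \<delta>" "\<And>N. \<exists>n\<ge>N. \<delta> \<le> ?a n" using \<delta>' by (simp_all add: not_less)
  have "\<exists>n. \<delta> \<le> ?a n \<and> (\<integral>\<^sup>+w. Y n w \<partial>M) \<le> ennreal ((1/2) ^ j)" for j :: nat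
  proof -
    have "\<forall>\<^sub>F n in sequentially. (\<integral>\<^sup>+w. Y n w \<partial>M) < ennreal ((1/2) ^ j)"
      by (rule order_tendstoD(2)[OF Y]) simp
    then obtain N where "\<And>n. n \<ge> N \<Longrightarrow> (\<integral>\<^sup>+w. Y n w \<partial>M) < ennreal ((1/2) ^ j)"
      by (auto simp: eventually_sequentially)
    with \<delta>(2)[of N] show ?thesis by (meson less_imp_le)
  qed
  then obtain k where k: "\<And>j::nat. \<delta> \<le> ?a (k j)" "\<And>j. (\<integral>\<^sup>+w. Y (k j) w \<partial>M) \<le> ennreal ((1/2) ^ j)"
    by metis
  have "(\<integral>\<^sup>+w. (\<Sum>j. Y (k j) w) \<partial>M) = (\<Sum>j. \<integral>\<^sup>+w. Y (k j) w \<partial>M)"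
    by (rule nn_integral_suminf) measurable
  also have "\<dots> \<le> (\<Sum>j. ennreal ((1/2) ^ j))" by (intro suminf_le k) auto
  also have "\<dots> = ennreal (\<Sum>j. (1/2) ^ j)" by (rule suminf_ennreal2) (auto intro: summable_geometric)
  finally have "(\<integral>\<^sup>+w. (\<Sum>j. Y (k j) w) \<partial>M) \<noteq> \<infinity>" by (auto simp: top_unique)
  then have "AE w in M. (\<Sum>j. Y (k j) w) \<noteq> \<infinity>" by (intro nn_integral_noteq_infinite) measurable
  with bound have "AE w in M. (\<lambda>j. X (k j) w) \<longlonglongrightarrow> 0"
  proof eventually_elim
    case (elim w)
    then obtain K where K: "\<And>n. ennreal (norm (X n w)) \<le> ennreal K * Y n w" by auto
    have fin: "Y (k j) w \<noteq> \<infinity>" for j using ennreal_suminf_lessD[of "\<lambda>j. Y (k j) w" top j] elim(2) by (auto simp: less_top)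
    have e: "ennreal (enn2real (Y (k j) w)) = Y (k j) w" for j
      using fin[of j] by (simp add: less_top)
    have "summable (\<lambda>j. enn2real (Y (k j) w))"
      by (rule summable_suminf_not_top) (use elim(2) e in simp_all)
    then have "(\<lambda>j. \<bar>K\<bar> * enn2real (Y (k j) w)) \<longlonglongrightarrow> \<bar>K\<bar> * 0"
      by (intro tendsto_mult_left summable_LIMSEQ_zero)
    moreover have "norm (X (k j) w) \<le> \<bar>K\<bar> * enn2real (Y (k j) w)" for j
    proof -
      have "ennreal (norm (X (k j) w)) \<le> ennreal K * Y (k j) w" by (rule K)
      also have "\<dots> \<le> ennreal \<bar>K\<bar> * Y (k j) w" by (intro mult_right_mono ennreal_leI) auto
      finally have "ennreal (norm (X (k j) w)) \<le> ennreal \<bar>K\<bar> * ennreal (enn2real (Y (k j) w))"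
        by (simp only: e)
      then show ?thesis by (simp flip: ennreal_mult)
    qed
    ultimately show ?case
      using Lim_null_comparison[of "\<lambda>j. X (k j) w" "\<lambda>j. \<bar>K\<bar> * enn2real (Y (k j) w)" sequentially] by simp
  qed
  then have "tendsto_in_prob M (\<lambda>j. X (k j)) (\<lambda>_. 0)" by (rule in_prob_of_AE) measurable
  then have "(\<lambda>j. ?a (k j)) \<longlonglongrightarrow> 0" using \<epsilon> by (simp add: tendsto_in_prob_def)
  then have "\<delta> \<le> 0" by (rule LIMSEQ_le_const) (use k(1) in auto)
  with \<delta>(1) show False by linarith
qed

text \<open>
  The Cauchy condition is stated for pairs of index sequences, the form in which it is verified below.  By the
  Borel-Cantelli lemma, a subsequence converges almost surely.
\<close>

lemma in_prob_complete:
  assumes [measurable]: "\<And>n. X n \<in> borel_measurable M"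
    and cauchy: "\<And>m n :: nat \<Rightarrow> nat. (\<And>k. k \<le> m k) \<Longrightarrow> (\<And>k. k \<le> n k) \<Longrightarrow>
        tendsto_in_prob M (\<lambda>k w. X (m k) w - X (n k) w) (\<lambda>_. 0)"
  shows "\<exists>Z\<in>borel_measurable M. tendsto_in_prob M X Z"
proof -
  define q where "q j m n = prob {w \<in> space M. norm (X m w - X n w) > (1/2) ^ j}" for j m n :: nat
  have "\<exists>N. \<forall>m\<ge>N. \<forall>n\<ge>N. q j m n \<le> (1/2) ^ j" for j
  proof (rule ccontr)
    assume neg: "\<not> ?thesis"
    have "\<exists>m n. N \<le> m \<and> N \<le> n \<and> (1/2) ^ j < q j m n" for N
      using neg by (meson not_le)
    then obtain m n where mn: "\<And>N. N \<le> m N" "\<And>N. N \<le> n N" "\<And>N. (1/2) ^ j < q j (m N) (n N)"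
      by metis
    have "(\<lambda>N. q j (m N) (n N)) \<longlonglongrightarrow> 0"
      using cauchy[OF mn(1,2)] by (simp add: tendsto_in_prob_def q_def)
    then have "\<forall>\<^sub>F N in sequentially. q j (m N) (n N) < (1/2) ^ j"
      by (rule order_tendstoD(2)) simp
    then obtain N where "q j (m N) (n N) < (1/2) ^ j"
      by (auto simp: eventually_sequentially)
    with mn(3)[of N] show False by simp
  qed
  then obtain r where r: "\<And>j m n. m \<ge> r j \<Longrightarrow> n \<ge> r j \<Longrightarrow> q j m n \<le> (1/2) ^ j"
    by metis
  \<comment> \<open>The summand \<open>k\<close> makes \<open>R k \<ge> k\<close>, so that \<open>X k - X (R k)\<close> tends to 0 by the assumption.\<close>
  define R where "R k = k + (\<Sum>i\<le>k. r i)" for k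
  have Rr: "r k \<le> R k" for k unfolding R_def by (rule trans_le_add2, rule member_le_sum) auto
  have Rr': "r k \<le> R (Suc k)" for k using Rr[of k] by (simp add: R_def)
  have Rk: "k \<le> R k" for k by (simp add: R_def)
  let ?A = "\<lambda>j. {w \<in> space M. norm (X (R (Suc j)) w - X (R j) w) > (1/2) ^ j}"
  have "AE w in M. \<forall>\<^sub>F j in sequentially. w \<in> space M - ?A j"
  proof (rule borel_cantelli_AE1)
    show "summable (\<lambda>j. prob (?A j))"
      by (rule summable_comparison_test'[of "\<lambda>j. (1/2) ^ j"]) (auto intro: r[OF Rr' Rr, unfolded q_def] summable_geometric)
  qed (auto simp: emeasure_eq_measure)
  then have conv: "AE w in M. convergent (\<lambda>j. X (R j) w)"
  proof eventually_elim
    case (elim w)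
    have "summable (\<lambda>j. X (R (Suc j)) w - X (R j) w)"
    proof (rule summable_comparison_test_ev)
      show "\<forall>\<^sub>F j in sequentially. norm (X (R (Suc j)) w - X (R j) w) \<le> (1/2) ^ j"
        using elim by eventually_elim auto
    qed (auto intro: summable_geometric)
    then have "convergent (\<lambda>n. \<Sum>k<n. X (R (Suc k)) w - X (R k) w)" by (simp add: summable_iff_convergent)
    also have "(\<lambda>n. \<Sum>k<n. X (R (Suc k)) w - X (R k) w) = (\<lambda>n. X (R n) w - X (R 0) w)"
      using sum_lessThan_telescope[of "\<lambda>k. X (R k) w"] by auto
    finally show ?case by (simp add: convergent_diff_const_right_iff)
  qed
  define Z where "Z w = lim (\<lambda>k. X (R k) w)" for w
  have [measurable]: "Z \<in> borel_measurable M" unfolding Z_def by measurable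
  have "AE w in M. (\<lambda>k. X (R k) w) \<longlonglongrightarrow> Z w"
    using conv by eventually_elim (simp add: Z_def convergent_LIMSEQ_iff)
  then have "tendsto_in_prob M (\<lambda>k. X (R k)) Z" by (rule in_prob_of_AE) measurable
  from in_prob_add[OF cauchy[of "\<lambda>k. k" R, OF _ Rk] this] have "tendsto_in_prob M X Z"
    by simp
  then show ?thesis by (intro bexI[of _ Z]) auto
qed

end

section \<open>The Wiener integral\<close>

context brownian
begin

text \<open>
  The second moment is bounded through the fourth by the Cauchy-Schwarz inequality; with a constant
  3 in place of the 1 of Ito's isometry it still makes the elementary integral continuous.
\<close>

lemma step_integral_sq_int:
  assumes p: "step_in L p"
  shows "step_integral B p \<in> sq_int M" "sq_norm M (step_integral B p) \<le> 3 * sq_norm (Leb L) (step_fun p)"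
proof -
  note [measurable] = step_integral_measurable[OF p]
  let ?s = "\<integral>\<^sup>+w. ennreal ((norm (step_integral B p w))\<^sup>2) \<partial>M"
  have "?s\<^sup>2 = (\<integral>\<^sup>+w. ennreal ((norm (step_integral B p w))\<^sup>2) * 1 \<partial>M)\<^sup>2" by simp
  also have "\<dots> \<le> (\<integral>\<^sup>+w. (ennreal ((norm (step_integral B p w))\<^sup>2))\<^sup>2 \<partial>M) * (\<integral>\<^sup>+w. 1\<^sup>2 \<partial>M)"
    by (rule Cauchy_Schwarz_nn_integral) auto
  also have "\<dots> = (\<integral>\<^sup>+w. ennreal ((norm (step_integral B p w)) ^ 4) \<partial>M)"
    by (simp add: ennreal_power emeasure_space_1 flip: power_mult)
  also have "\<dots> \<le> ennreal (6 * (sq_norm (Leb L) (step_fun p))\<^sup>2)"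
    by (rule step_integral_fourth_moment[OF p])
  finally have b: "?s\<^sup>2 \<le> ennreal (6 * (sq_norm (Leb L) (step_fun p))\<^sup>2)" .
  then have "?s\<^sup>2 < \<infinity>" by (rule order.strict_trans1) simp
  then have "?s < \<infinity>" by (simp add: power_less_top_ennreal)
  then show sq: "step_integral B p \<in> sq_int M" by (intro sq_int_bounded) auto
  from b have "(sq_norm M (step_integral B p))\<^sup>2 \<le> 6 * (sq_norm (Leb L) (step_fun p))\<^sup>2"
    by (simp add: nn_integral_sq_norm[OF sq] ennreal_power)
  also have "\<dots> \<le> (3 * sq_norm (Leb L) (step_fun p))\<^sup>2" by (simp add: power_mult_distrib)
  finally show "sq_norm M (step_integral B p) \<le> 3 * sq_norm (Leb L) (step_fun p)"
    by (rule power2_le_imp_le) simp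
qed

text \<open>
  The functions that can be approximated by step functions form a closed subspace, which contains all
  \<open>1\<^bsub>[0,t]\<^esub>\<close>.
\<close>

lemma step_fun_dense:
  assumes g: "g \<in> sq_int (Leb L)" and \<epsilon>: "\<epsilon> > 0"
  shows "\<exists>p. step_in L p \<and> sq_norm (Leb L) (\<lambda>x. g x - step_fun p x) < \<epsilon>"
proof -
  let ?G = "{g \<in> sq_int (Leb L). \<forall>\<epsilon>>0. \<exists>p. step_in L p \<and> sq_norm (Leb L) (\<lambda>x. g x - step_fun p x) < \<epsilon>}"
  have zero: "0 \<in> horizon L" using L_pos by (auto simp: horizon_def zero_ereal_def[symmetric])
  have sub: "closed_subspace (Leb L) ?G"
    unfolding closed_subspace_def
  proof (intro conjI ballI allI impI)
    have "step_in L [] \<and> sq_norm (Leb L) (\<lambda>x. 0 - step_fun [] x) < \<epsilon>" if "\<epsilon> > 0" for \<epsilon>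
      using that by (simp add: step_in_def step_fun_def sq_norm_def)
    then show "(\<lambda>x. 0) \<in> ?G" by auto
  next
    fix f g assume f: "f \<in> ?G" and g: "g \<in> ?G"
    have "\<exists>p. step_in L p \<and> sq_norm (Leb L) (\<lambda>x. f x + g x - step_fun p x) < \<epsilon>" if "\<epsilon> > 0" for \<epsilon>
    proof -
      from f that obtain p where p: "step_in L p" "sq_norm (Leb L) (\<lambda>x. f x - step_fun p x) < \<epsilon> / 4"
        by (auto elim!: allE[of _ "\<epsilon> / 4"])
      from g that obtain q where q: "step_in L q" "sq_norm (Leb L) (\<lambda>x. g x - step_fun q x) < \<epsilon> / 4"
        by (auto elim!: allE[of _ "\<epsilon> / 4"])
      have "sq_norm (Leb L) (\<lambda>x. (f x - step_fun p x) + (g x - step_fun q x))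
         \<le> 2 * sq_norm (Leb L) (\<lambda>x. f x - step_fun p x) + 2 * sq_norm (Leb L) (\<lambda>x. g x - step_fun q x)"
        using f g by (intro sq_norm_add_le sq_int_diff step_fun_sq_int p q) auto
      also have "(\<lambda>x. (f x - step_fun p x) + (g x - step_fun q x)) = (\<lambda>x. f x + g x - step_fun (p @ q) x)"
        by (auto simp: step_fun_append)
      finally show ?thesis using p q by (intro exI[of _ "p @ q"]) (auto intro: step_in_append)
    qed
    then show "(\<lambda>x. f x + g x) \<in> ?G" using f g by (auto intro: sq_int_add)
  next
    fix f c assume f: "f \<in> ?G"
    have "\<exists>p. step_in L p \<and> sq_norm (Leb L) (\<lambda>x. c * f x - step_fun p x) < \<epsilon>" if "\<epsilon> > 0" for \<epsilon>
    proof -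
      have pos: "0 < \<epsilon> / ((norm c)\<^sup>2 + 1)" using that by (intro divide_pos_pos) (auto intro: add_nonneg_pos)
      with f obtain p where p: "step_in L p" "sq_norm (Leb L) (\<lambda>x. f x - step_fun p x) < \<epsilon> / ((norm c)\<^sup>2 + 1)" by auto
      have "sq_norm (Leb L) (\<lambda>x. c * f x - step_fun (step_scale c p) x) = (norm c)\<^sup>2 * sq_norm (Leb L) (\<lambda>x. f x - step_fun p x)"
        by (subst sq_norm_scale[symmetric]) (simp add: step_fun_scale right_diff_distrib)
      also have "\<dots> \<le> (norm c)\<^sup>2 * (\<epsilon> / ((norm c)\<^sup>2 + 1))" using p by (intro mult_left_mono) auto
      also have "\<dots> < \<epsilon>"
      proof -
        have "0 < (norm c)\<^sup>2 + 1" by (intro add_nonneg_pos) auto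
        then show ?thesis using that by (simp add: field_simps)
      qed
      finally show ?thesis using p by (intro exI[of _ "step_scale c p"]) (auto intro: step_in_scale)
    qed
    then show "(\<lambda>x. c * f x) \<in> ?G" using f by (auto intro: sq_int_scale)
  next
    fix f s assume f: "f \<in> sq_int (Leb L)" and s: "\<forall>n. s n \<in> ?G \<inter> sq_int (Leb L)"
      and lim: "(\<lambda>n. sq_norm (Leb L) (\<lambda>x. f x - s n x)) \<longlonglongrightarrow> 0"
    have "\<exists>p. step_in L p \<and> sq_norm (Leb L) (\<lambda>x. f x - step_fun p x) < \<epsilon>" if "\<epsilon> > 0" for \<epsilon>
    proof -
      from order_tendstoD(2)[OF lim, of "\<epsilon> / 4"] that obtain n where n: "sq_norm (Leb L) (\<lambda>x. f x - s n x) < \<epsilon> / 4"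
        by (auto simp: eventually_sequentially)
      have "0 < \<epsilon> / 4" using that by simp
      with s obtain p where p: "step_in L p" "sq_norm (Leb L) (\<lambda>x. s n x - step_fun p x) < \<epsilon> / 4" by blast
      have "sq_norm (Leb L) (\<lambda>x. (f x - s n x) + (s n x - step_fun p x))
         \<le> 2 * sq_norm (Leb L) (\<lambda>x. f x - s n x) + 2 * sq_norm (Leb L) (\<lambda>x. s n x - step_fun p x)"
        using f s by (intro sq_norm_add_le sq_int_diff step_fun_sq_int p) auto
      then show ?thesis using n p by (intro exI[of _ p]) auto
    qed
    then show "f \<in> ?G" using f by auto
  qed
  have "g \<in> ?G"
  proof (rule closed_subspace_intervals_dense[OF sub order_refl closure_subset _ L_pos g])
    fix t assume t: "t \<in> horizon L"
    have p: "step_in L [(1, 0, t)]" using zero t by (auto simp: step_in_def horizon_def)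
    have sq: "(\<lambda>x. indicator {0..t} x) \<in> sq_int (Leb L)"
      by (rule sq_int_Leb_indicator[OF atLeastAtMost_in_Leb[OF t]]) auto
    have "AE x in Leb L. indicator {0..t} x - step_fun [(1, 0, t)] x = 0"
      using AE_Leb_singleton[where a = 0 and L = L] by eventually_elim (auto simp: indicator_def step_fun_def)
    then have "sq_norm (Leb L) (\<lambda>x. indicator {0..t} x - step_fun [(1, 0, t)] x) = 0"
      by (subst sq_norm_zero_AE) (auto intro!: sq_int_diff step_fun_sq_int sq p)
    then show "(\<lambda>x. indicator {0..t} x) \<in> ?G" using p sq by force
  qed
  then show ?thesis using \<epsilon> by blast
qed

lemma has_wiener_integralI:
  assumes g: "g \<in> sq_int (Leb L)" and Z: "Z \<in> sq_int M" and p: "\<And>k. step_in L (p k)"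
    and lim: "(\<lambda>k. sq_norm (Leb L) (\<lambda>x. g x - step_fun (p k) x)) \<longlonglongrightarrow> 0"
    "(\<lambda>k. sq_norm M (\<lambda>w. Z w - step_integral B (p k) w)) \<longlonglongrightarrow> 0"
  shows "has_wiener_integral M B L g Z"
  unfolding has_wiener_integral_def
proof (intro conjI exI[of _ p] allI p)
  show "Z \<in> borel_measurable M" by (rule sq_intD[OF Z])
  show "(\<lambda>k. \<integral>\<^sup>+ t. ennreal ((norm (g t - step_fun (p k) t))\<^sup>2) \<partial>Leb L) \<longlonglongrightarrow> 0"
    using tendsto_ennrealI[OF lim(1)] by (simp add: nn_integral_sq_norm sq_int_diff g step_fun_sq_int p)
  show "(\<lambda>k. \<integral>\<^sup>+ w. ennreal ((norm (Z w - step_integral B (p k) w))\<^sup>2) \<partial>M) \<longlonglongrightarrow> 0"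
    using tendsto_ennrealI[OF lim(2)] by (simp add: nn_integral_sq_norm sq_int_diff Z step_integral_sq_int(1)[OF p])
qed

lemma wiener_integral_exists:
  assumes g: "g \<in> sq_int (Leb L)"
  shows "\<exists>Z. has_wiener_integral M B L g Z"
proof -
  have "\<forall>k::nat. \<exists>p. step_in L p \<and> sq_norm (Leb L) (\<lambda>x. g x - step_fun p x) < 1 / real (Suc k)"
    by (intro allI step_fun_dense[OF g]) simp
  then obtain p where p: "\<And>k. step_in L (p k)" "\<And>k::nat. sq_norm (Leb L) (\<lambda>x. g x - step_fun (p k) x) < 1 / real (Suc k)"
    by metis
  have lim: "(\<lambda>k. sq_norm (Leb L) (\<lambda>x. g x - step_fun (p k) x)) \<longlonglongrightarrow> 0"
    by (rule tendsto_sandwich[OF _ _ tendsto_const LIMSEQ_inverse_real_of_nat])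
      (use p(2) in \<open>auto intro!: always_eventually less_imp_le simp: inverse_eq_divide\<close>)
  have sf: "step_fun (p k) \<in> sq_int (Leb L)" for k by (rule step_fun_sq_int[OF p(1)])
  have "\<exists>Z\<in>sq_int M. (\<lambda>k. sq_norm M (\<lambda>w. Z w - step_integral B (p k) w)) \<longlonglongrightarrow> 0"
  proof (rule sq_int_complete)
    show "step_integral B (p n) \<in> sq_int M" for n by (rule step_integral_sq_int[OF p(1)])
    fix \<epsilon> :: real assume \<epsilon>: "\<epsilon> > 0"
    from order_tendstoD(2)[OF lim, of "\<epsilon> / 12"] \<epsilon> obtain N where
      N: "\<And>n. n \<ge> N \<Longrightarrow> sq_norm (Leb L) (\<lambda>x. g x - step_fun (p n) x) < \<epsilon> / 12" by (auto simp: eventually_sequentially)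
    have "sq_norm M (\<lambda>x. step_integral B (p m) x - step_integral B (p n) x) \<le> \<epsilon>" if "m \<ge> N" "n \<ge> N" for m n
    proof -
      let ?q = "p m @ step_scale (-1) (p n)"
      have "sq_norm M (\<lambda>x. step_integral B (p m) x - step_integral B (p n) x) = sq_norm M (step_integral B ?q)"
        by (intro arg_cong[where f = "sq_norm M"] ext) (simp add: step_integral_append step_integral_scale)
      also have "\<dots> \<le> 3 * sq_norm (Leb L) (step_fun ?q)"
        by (intro step_integral_sq_int step_in_append step_in_scale p)
      also have "step_fun ?q = (\<lambda>x. (g x - step_fun (p n) x) - (g x - step_fun (p m) x))"
        by (auto simp: step_fun_append step_fun_scale)
      also have "3 * sq_norm (Leb L) \<dots> \<le> 3 * (2 * sq_norm (Leb L) (\<lambda>x. g x - step_fun (p n) x) + 2 * sq_norm (Leb L) (\<lambda>x. g x - step_fun (p m) x))"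
        by (intro mult_left_mono sq_norm_diff_le sq_int_diff g sf) auto
      also have "\<dots> \<le> \<epsilon>" using N[OF that(1)] N[OF that(2)] by simp
      finally show ?thesis .
    qed
    then show "\<exists>n0. \<forall>m\<ge>n0. \<forall>n\<ge>n0. sq_norm M (\<lambda>x. step_integral B (p m) x - step_integral B (p n) x) \<le> \<epsilon>" by blast
  qed
  then obtain Z where Z: "Z \<in> sq_int M" "(\<lambda>k. sq_norm M (\<lambda>w. Z w - step_integral B (p k) w)) \<longlonglongrightarrow> 0" by blast
  show ?thesis by (rule exI, rule has_wiener_integralI[OF g Z(1) p(1) lim Z(2)])
qed

lemma wiener_integralI: "g \<in> sq_int (Leb L) \<Longrightarrow> has_wiener_integral M B L g (wiener_integral M B L g)"
  unfolding wiener_integral_def by (rule someI_ex[OF wiener_integral_exists])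

lemma has_wiener_integralD:
  assumes Z: "has_wiener_integral M B L g Z" and g: "g \<in> sq_int (Leb L)"
  obtains p where "Z \<in> sq_int M" "\<And>k. step_in L (p k)"
    "(\<lambda>k. sq_norm (Leb L) (\<lambda>x. g x - step_fun (p k) x)) \<longlonglongrightarrow> 0"
    "(\<lambda>k. sq_norm M (\<lambda>w. Z w - step_integral B (p k) w)) \<longlonglongrightarrow> 0"
proof -
  from Z obtain p where Zm: "Z \<in> borel_measurable M" and p: "\<And>k. step_in L (p k)"
    and l1: "(\<lambda>k. \<integral>\<^sup>+ t. ennreal ((norm (g t - step_fun (p k) t))\<^sup>2) \<partial>Leb L) \<longlonglongrightarrow> 0"
    and l2: "(\<lambda>k. \<integral>\<^sup>+ w. ennreal ((norm (Z w - step_integral B (p k) w))\<^sup>2) \<partial>M) \<longlonglongrightarrow> 0"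
    unfolding has_wiener_integral_def by blast
  note si = step_integral_sq_int(1)[OF p]
  from order_tendstoD(2)[OF l2, of 1] obtain k where
    "(\<integral>\<^sup>+ w. ennreal ((norm (Z w - step_integral B (p k) w))\<^sup>2) \<partial>M) < 1" by (auto simp: eventually_sequentially)
  then have "(\<lambda>w. Z w - step_integral B (p k) w) \<in> sq_int M"
    using Zm sq_intD(1)[OF si] by (intro sq_int_bounded) (auto elim: order.strict_trans)
  from sq_int_add[OF this si[of k]] have Zs: "Z \<in> sq_int M" by simp
  show ?thesis
  proof (rule that[OF Zs p])
    show "(\<lambda>k. sq_norm (Leb L) (\<lambda>x. g x - step_fun (p k) x)) \<longlonglongrightarrow> 0"
      using l1 by (simp add: nn_integral_sq_norm sq_int_diff g step_fun_sq_int p tendsto_ennreal_iff flip: ennreal_0)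
    show "(\<lambda>k. sq_norm M (\<lambda>w. Z w - step_integral B (p k) w)) \<longlonglongrightarrow> 0"
      using l2 by (simp add: nn_integral_sq_norm sq_int_diff Zs si tendsto_ennreal_iff flip: ennreal_0)
  qed
qed

lemma has_wiener_integral_add:
  assumes Z: "has_wiener_integral M B L g Z" and g: "g \<in> sq_int (Leb L)"
    and Z': "has_wiener_integral M B L g' Z'" and g': "g' \<in> sq_int (Leb L)"
  shows "has_wiener_integral M B L (\<lambda>x. g x + g' x) (\<lambda>w. Z w + Z' w)"
proof -
  obtain p where p: "Z \<in> sq_int M" "\<And>k. step_in L (p k)"
    "(\<lambda>k. sq_norm (Leb L) (\<lambda>x. g x - step_fun (p k) x)) \<longlonglongrightarrow> 0"
    "(\<lambda>k. sq_norm M (\<lambda>w. Z w - step_integral B (p k) w)) \<longlonglongrightarrow> 0" by (rule has_wiener_integralD[OF Z g]) auto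
  obtain q where q: "Z' \<in> sq_int M" "\<And>k. step_in L (q k)"
    "(\<lambda>k. sq_norm (Leb L) (\<lambda>x. g' x - step_fun (q k) x)) \<longlonglongrightarrow> 0"
    "(\<lambda>k. sq_norm M (\<lambda>w. Z' w - step_integral B (q k) w)) \<longlonglongrightarrow> 0" by (rule has_wiener_integralD[OF Z' g']) auto
  have limit: "(\<lambda>k. sq_norm N (\<lambda>x. f x + f' x - (s k x + s' k x))) \<longlonglongrightarrow> 0"
    if "f \<in> sq_int N" "f' \<in> sq_int N" "\<And>k. s k \<in> sq_int N" "\<And>k. s' k \<in> sq_int N"
      "(\<lambda>k. sq_norm N (\<lambda>x. f x - s k x)) \<longlonglongrightarrow> 0" "(\<lambda>k. sq_norm N (\<lambda>x. f' x - s' k x)) \<longlonglongrightarrow> 0"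
    for N :: "'z measure" and f f' s s'
  proof (rule tendsto_sandwich[OF _ _ tendsto_const])
    show "(\<lambda>k. 2 * sq_norm N (\<lambda>x. f x - s k x) + 2 * sq_norm N (\<lambda>x. f' x - s' k x)) \<longlonglongrightarrow> 0"
      using tendsto_add[OF tendsto_mult_left[OF that(5), of 2] tendsto_mult_left[OF that(6), of 2]] by simp
    have "sq_norm N (\<lambda>x. f x + f' x - (s k x + s' k x)) \<le> 2 * sq_norm N (\<lambda>x. f x - s k x) + 2 * sq_norm N (\<lambda>x. f' x - s' k x)" for k
      using sq_norm_add_le[OF sq_int_diff[OF that(1,3)] sq_int_diff[OF that(2,4)], of k k] by (simp add: algebra_simps)
    then show "\<forall>\<^sub>F k in sequentially. sq_norm N (\<lambda>x. f x + f' x - (s k x + s' k x)) \<le> 2 * sq_norm N (\<lambda>x. f x - s k x) + 2 * sq_norm N (\<lambda>x. f' x - s' k x)"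
      by simp
  qed simp
  show ?thesis
  proof (rule has_wiener_integralI[OF sq_int_add[OF g g'] sq_int_add[OF p(1) q(1)] step_in_append[OF p(2) q(2)]])
    show "(\<lambda>k. sq_norm (Leb L) (\<lambda>x. g x + g' x - step_fun (p k @ q k) x)) \<longlonglongrightarrow> 0"
      unfolding step_fun_append by (rule limit) (use g g' p q step_fun_sq_int in auto)
    show "(\<lambda>k. sq_norm M (\<lambda>w. Z w + Z' w - step_integral B (p k @ q k) w)) \<longlonglongrightarrow> 0"
      unfolding step_integral_append by (rule limit) (use p q step_integral_sq_int in auto)
  qed
qed

lemma has_wiener_integral_scale:
  assumes Z: "has_wiener_integral M B L g Z" and g: "g \<in> sq_int (Leb L)"
  shows "has_wiener_integral M B L (\<lambda>x. c * g x) (\<lambda>w. c * Z w)"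
proof -
  obtain p where p: "Z \<in> sq_int M" "\<And>k. step_in L (p k)"
    "(\<lambda>k. sq_norm (Leb L) (\<lambda>x. g x - step_fun (p k) x)) \<longlonglongrightarrow> 0"
    "(\<lambda>k. sq_norm M (\<lambda>w. Z w - step_integral B (p k) w)) \<longlonglongrightarrow> 0" by (rule has_wiener_integralD[OF Z g]) auto
  show ?thesis
  proof (rule has_wiener_integralI[OF sq_int_scale[OF g] sq_int_scale[OF p(1)] step_in_scale[OF p(2)]])
    show "(\<lambda>k. sq_norm (Leb L) (\<lambda>x. c * g x - step_fun (step_scale c (p k)) x)) \<longlonglongrightarrow> 0"
      using tendsto_mult_left[OF p(3), of "(norm c)\<^sup>2"]
      by (simp add: step_fun_scale sq_norm_scale flip: right_diff_distrib)
    show "(\<lambda>k. sq_norm M (\<lambda>w. c * Z w - step_integral B (step_scale c (p k)) w)) \<longlonglongrightarrow> 0"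
      using tendsto_mult_left[OF p(4), of "(norm c)\<^sup>2"]
      by (simp add: step_integral_scale sq_norm_scale flip: right_diff_distrib)
  qed
qed

lemma has_wiener_integral_sum:
  assumes "finite I" "\<And>i. i \<in> I \<Longrightarrow> has_wiener_integral M B L (g i) (Z i)" "\<And>i. i \<in> I \<Longrightarrow> g i \<in> sq_int (Leb L)"
  shows "has_wiener_integral M B L (\<lambda>x. \<Sum>i\<in>I. g i x) (\<lambda>w. \<Sum>i\<in>I. Z i w)"
  using assms
proof (induction I rule: finite_induct)
  case empty
  show ?case
    by (rule has_wiener_integralI[where p = "\<lambda>_. []"])
      (simp_all add: step_in_def step_fun_def step_integral_def sq_norm_def)
next
  case (insert i I)
  have "has_wiener_integral M B L (\<lambda>x. g i x + (\<Sum>i\<in>I. g i x)) (\<lambda>w. Z i w + (\<Sum>i\<in>I. Z i w))"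
    by (rule has_wiener_integral_add) (use insert in \<open>auto intro!: sq_int_sum\<close>)
  then show ?case using insert(1,2) by simp
qed

text \<open>
  The bound passes from step functions to the limit by Fatou's lemma along an almost surely convergent
  subsequence.  Chaining uses the law of Wiener integrals only through this estimate.
\<close>

lemma has_wiener_integral_fourth_moment:
  assumes Z: "has_wiener_integral M B L g Z" and g: "g \<in> sq_int (Leb L)"
  shows "(\<integral>\<^sup>+w. ennreal ((norm (Z w)) ^ 4) \<partial>M) \<le> ennreal (24 * (sq_norm (Leb L) g)\<^sup>2)"
proof -
  obtain p where p: "Z \<in> sq_int M" "\<And>k. step_in L (p k)"
    "(\<lambda>k. sq_norm (Leb L) (\<lambda>x. g x - step_fun (p k) x)) \<longlonglongrightarrow> 0"
    "(\<lambda>k. sq_norm M (\<lambda>w. Z w - step_integral B (p k) w)) \<longlonglongrightarrow> 0" by (rule has_wiener_integralD[OF Z g]) auto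
  note si = step_integral_sq_int(1)[OF p(2)] and sf = step_fun_sq_int[OF p(2)]
  note [measurable] = sq_intD(1)[OF p(1)] sq_intD(1)[OF si]
  obtain r :: "nat \<Rightarrow> nat" where r: "strict_mono r"
      and lim: "AE w in M. (\<lambda>k. (norm (Z w - step_integral B (p (r k)) w))\<^sup>2) \<longlonglongrightarrow> 0"
    using tendsto_L1_AE_subseq[of M "\<lambda>k w. (norm (Z w - step_integral B (p k) w))\<^sup>2"] p(4)
    by (auto simp: sq_norm_def intro: sq_intD(2)[OF sq_int_diff[OF p(1) si]])
  have "(\<integral>\<^sup>+w. ennreal ((norm (Z w)) ^ 4) \<partial>M) = (\<integral>\<^sup>+w. liminf (\<lambda>k. ennreal ((norm (step_integral B (p (r k)) w)) ^ 4)) \<partial>M)"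
  proof (rule nn_integral_cong_AE, use lim in eventually_elim)
    fix w assume "(\<lambda>k. (norm (Z w - step_integral B (p (r k)) w))\<^sup>2) \<longlonglongrightarrow> 0"
    then have "(\<lambda>k. sqrt ((norm (Z w - step_integral B (p (r k)) w))\<^sup>2)) \<longlonglongrightarrow> sqrt 0" by (rule tendsto_real_sqrt)
    then have "(\<lambda>k. Z w - step_integral B (p (r k)) w) \<longlonglongrightarrow> 0" by (subst tendsto_norm_zero_iff[symmetric]) simp
    from tendsto_diff[OF tendsto_const[of "Z w"] this] have "(\<lambda>k. step_integral B (p (r k)) w) \<longlonglongrightarrow> Z w" by simp
    then have "(\<lambda>k. ennreal ((norm (step_integral B (p (r k)) w)) ^ 4)) \<longlonglongrightarrow> ennreal ((norm (Z w)) ^ 4)"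
      by (intro tendsto_ennrealI tendsto_intros)
    then show "ennreal ((norm (Z w)) ^ 4) = liminf (\<lambda>k. ennreal ((norm (step_integral B (p (r k)) w)) ^ 4))"
      by (intro lim_imp_Liminf[symmetric]) auto
  qed
  also have "\<dots> \<le> liminf (\<lambda>k. \<integral>\<^sup>+w. ennreal ((norm (step_integral B (p (r k)) w)) ^ 4) \<partial>M)"
    by (rule nn_integral_liminf) measurable
  also have "\<dots> \<le> liminf (\<lambda>k. ennreal (6 * (2 * sq_norm (Leb L) g + 2 * sq_norm (Leb L) (\<lambda>x. g x - step_fun (p (r k)) x))\<^sup>2))"
  proof (intro Liminf_mono always_eventually allI order_trans[OF step_integral_fourth_moment[OF p(2)]] ennreal_leI mult_left_mono power_mono)
    fix k
    show "sq_norm (Leb L) (step_fun (p (r k))) \<le> 2 * sq_norm (Leb L) g + 2 * sq_norm (Leb L) (\<lambda>x. g x - step_fun (p (r k)) x)"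
      using sq_norm_le_two_diff[OF sf g, of "r k"] by simp
  qed auto
  also have "\<dots> = ennreal (6 * (2 * sq_norm (Leb L) g + 2 * 0)\<^sup>2)"
    using LIMSEQ_subseq_LIMSEQ[OF p(3) r]
    by (intro lim_imp_Liminf tendsto_ennrealI tendsto_intros) (auto simp: o_def)
  finally show ?thesis by (simp add: power_mult_distrib)
qed

end

section \<open>Integrals against functions of bounded variation\<close>

definition initial_segment :: "ereal \<Rightarrow> real set \<Rightarrow> bool"
  where "initial_segment L A \<longleftrightarrow> A \<subseteq> horizon L \<and> (\<forall>t\<in>A. \<forall>s\<in>horizon L. s \<le> t \<longrightarrow> s \<in> A)"

lemma initial_segment_sets: assumes "initial_segment L A" shows "A \<in> sets (Leb L)"
proof -
  have "is_interval A"
    unfolding is_interval_1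
  proof (intro ballI allI impI)
    fix a b x assume *: "a \<in> A" "b \<in> A" "a \<le> x \<and> x \<le> b"
    have sub: "A \<subseteq> horizon L" using assms by (simp add: initial_segment_def)
    then have b: "b \<in> horizon L" and "a \<in> horizon L" using * by blast+
    then have "0 \<le> x" using * by (simp add: horizon_def)
    then have "x \<in> horizon L" using * by (intro horizon_downward[OF b]) auto
    then show "x \<in> A" using assms * unfolding initial_segment_def by blast
  qed
  from real_interval_borel_measurable[OF this] have "A \<in> sets borel" .
  moreover have "A \<subseteq> horizon L" using assms by (simp add: initial_segment_def)
  ultimately show ?thesis using borel_Int_horizon[of A L] by (simp add: Int_absorb2)
qed

lemma initial_segment_chain: assumes "initial_segment L A" "initial_segment L A'" shows "A \<subseteq> A' \<or> A' \<subseteq> A"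
proof (rule ccontr)
  assume "\<not> ?thesis"
  then obtain a b where ab: "a \<in> A" "a \<notin> A'" "b \<in> A'" "b \<notin> A" by auto
  then have h: "a \<in> horizon L" "b \<in> horizon L" using assms by (auto simp: initial_segment_def)
  have "b \<in> A" if "b \<le> a" using assms(1) ab(1) h(2) that unfolding initial_segment_def by blast
  moreover have "a \<in> A'" if "a \<le> b" using assms(2) ab(3) h(1) that unfolding initial_segment_def by blast
  ultimately show False using ab by linarith
qed

lemma initial_segment_empty: "initial_segment L {}" and initial_segment_horizon: "initial_segment L (horizon L)"
  by (auto simp: initial_segment_def)

lemma floor_as_count:
  assumes "0 \<le> y" "y \<le> real N"
  shows "\<bar>y - (\<Sum>j\<in>{1..N}. of_bool (real j \<le> y))\<bar> \<le> 1"
proof -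
  have N: "nat \<lfloor>y\<rfloor> \<le> N" using assms by linarith
  have iff: "real j \<le> y \<longleftrightarrow> j \<le> nat \<lfloor>y\<rfloor>" for j
  proof
    assume "j \<le> nat \<lfloor>y\<rfloor>"
    then have "real j \<le> real (nat \<lfloor>y\<rfloor>)" by simp
    also have "\<dots> \<le> y" by (rule of_nat_floor[OF assms(1)])
    finally show "real j \<le> y" .
  qed (rule le_nat_floor)
  have "(\<Sum>j\<in>{1..N}. of_bool (real j \<le> y)) = (\<Sum>j\<in>{1..nat \<lfloor>y\<rfloor>}. 1 :: real)"
    by (rule sum.mono_neutral_cong_right) (use N in \<open>auto simp: iff\<close>)
  then have eq: "(\<Sum>j\<in>{1..N}. of_bool (real j \<le> y)) = real (nat \<lfloor>y\<rfloor>)" by simp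
  show ?thesis unfolding eq using assms(1) by linarith
qed

lemma integrable_times_bounded:
  fixes \<psi> :: "'a \<Rightarrow> complex" and m :: "'a \<Rightarrow> real"
  assumes \<psi>: "integrable N \<psi>" and m: "m \<in> borel_measurable N" "\<And>t. t \<in> space N \<Longrightarrow> \<bar>m t\<bar> \<le> R"
  shows "integrable N (\<lambda>t. \<psi> t * complex_of_real (m t))"
proof (rule Bochner_Integration.integrable_bound)
  show "integrable N (\<lambda>t. \<psi> t * complex_of_real R)" using \<psi> by simp
  show "(\<lambda>t. \<psi> t * complex_of_real (m t)) \<in> borel_measurable N"
    using borel_measurable_integrable[OF \<psi>] m(1) by measurable
  have "norm (\<psi> t * complex_of_real (m t)) \<le> norm (\<psi> t * complex_of_real R)" if "t \<in> space N" for t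
    using mult_left_mono[of "\<bar>m t\<bar>" "\<bar>R\<bar>" "norm (\<psi> t)"] m(2)[OF that] by (simp add: norm_mult)
  then show "AE t in N. norm (\<psi> t * complex_of_real (m t)) \<le> norm (\<psi> t * complex_of_real R)" by simp
qed

lemma integrable_times_indicator:
  fixes \<psi> :: "'a \<Rightarrow> complex"
  assumes "integrable N \<psi>" "A \<in> sets N" shows "integrable N (\<lambda>t. \<psi> t * indicator A t)"
proof (rule Bochner_Integration.integrable_bound[OF assms(1)])
  show "(\<lambda>t. \<psi> t * indicator A t) \<in> borel_measurable N"
    using borel_measurable_integrable[OF assms(1)] assms(2) by measurable
qed (auto simp: indicator_def)

text \<open>
  Up to an error of \<open>R / N\<close>, a monotone function \<open>m\<close> with values in \<open>[0, R]\<close> is \<open>R / N\<close> times the sum of the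
  indicators of the \<open>N\<close> sets \<open>{m \<ge> j R / N}\<close>, which are complements of initial segments.
\<close>

lemma integral_times_monotone_bound:
  fixes \<psi> :: "real \<Rightarrow> complex" and m :: "real \<Rightarrow> real"
  assumes m: "mono_on (horizon L) m" "\<And>t. t \<in> horizon L \<Longrightarrow> 0 \<le> m t" "\<And>t. t \<in> horizon L \<Longrightarrow> m t \<le> R" and R: "0 < R"
    and \<psi>: "integrable (Leb L) \<psi>"
    and D: "\<And>A. initial_segment L A \<Longrightarrow> norm (LINT t|Leb L. \<psi> t * indicator A t) \<le> D"
  shows "m \<in> borel_measurable (Leb L)" "norm (LINT t|Leb L. \<psi> t * complex_of_real (m t)) \<le> 2 * R * D"
proof -
  have ini: "initial_segment L {t \<in> horizon L. m t < y}" for y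
    using m(1) by (auto simp: initial_segment_def mono_on_def intro: le_less_trans)
  show mm [measurable]: "m \<in> borel_measurable (Leb L)"
    by (rule borel_measurableI_less) (use initial_segment_sets[OF ini] in simp)
  note [measurable] = borel_measurable_integrable[OF \<psi>]
  have \<psi>m: "integrable (Leb L) (\<lambda>t. \<psi> t * complex_of_real (m t))"
    by (rule integrable_times_bounded[OF \<psi> mm, of R]) (use m(2,3) in auto)
  define I where "I = (LINT t|Leb L. norm (\<psi> t))"
  have I: "0 \<le> I" by (simp add: I_def)
  have step: "norm (LINT t|Leb L. \<psi> t * complex_of_real (m t)) \<le> 2 * R * D + R * I / real (Suc n)" for n
  proof -
    let ?N = "Suc n"
    define \<delta> where "\<delta> = R / real ?N"
    have \<delta>: "0 < \<delta>" "real ?N * \<delta> = R" using R by (auto simp: \<delta>_def)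
    let ?U = "\<lambda>j. horizon L - {t \<in> horizon L. m t < real j * \<delta>}"
    have U: "?U j \<in> sets (Leb L)" for j using sets.compl_sets[OF initial_segment_sets[OF ini]] by simp
    let ?s = "\<lambda>t. \<Sum>j\<in>{1..?N}. \<delta> * indicator (?U j) t :: real"
    have approx: "\<bar>m t - ?s t\<bar> \<le> \<delta>" if t: "t \<in> horizon L" for t
    proof -
      have "indicator (?U j) t = (of_bool (real j \<le> m t / \<delta>) :: real)" for j
        using t \<delta>(1) by (auto simp: indicator_def not_less pos_le_divide_eq)
      then have "?s t = \<delta> * (\<Sum>j\<in>{1..?N}. of_bool (real j \<le> m t / \<delta>))"
        by (simp only: sum_distrib_left)
      then have "m t - ?s t = \<delta> * (m t / \<delta> - (\<Sum>j\<in>{1..?N}. of_bool (real j \<le> m t / \<delta>)))"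
        using \<delta>(1) by (simp only: right_diff_distrib) simp
      moreover have "\<bar>m t / \<delta> - (\<Sum>j\<in>{1..?N}. of_bool (real j \<le> m t / \<delta>))\<bar> \<le> 1"
        using m(2,3)[OF t] \<delta> by (intro floor_as_count) (auto simp: pos_divide_le_eq)
      ultimately show ?thesis using \<delta>(1) by (simp add: abs_mult mult_left_le)
    qed
    have iU: "integrable (Leb L) (\<lambda>t. \<psi> t * indicator (?U j) t)" for j
      by (rule integrable_times_indicator[OF \<psi> U])
    have nU: "norm (LINT t|Leb L. \<psi> t * indicator (?U j) t) \<le> 2 * D" for j
    proof -
      let ?A = "{t \<in> horizon L. m t < real j * \<delta>}"
      have iA: "integrable (Leb L) (\<lambda>t. \<psi> t * indicator A t)" if "initial_segment L A" for A
        by (rule integrable_times_indicator[OF \<psi> initial_segment_sets[OF that]])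
      have "(LINT t|Leb L. \<psi> t * indicator (?U j) t) = (LINT t|Leb L. \<psi> t * indicator (horizon L) t - \<psi> t * indicator ?A t)"
        by (intro Bochner_Integration.integral_cong) (auto simp: indicator_def)
      also have "\<dots> = (LINT t|Leb L. \<psi> t * indicator (horizon L) t) - (LINT t|Leb L. \<psi> t * indicator ?A t)"
        by (intro Bochner_Integration.integral_diff iA ini initial_segment_horizon)
      also have "norm \<dots> \<le> D + D"
        by (intro order_trans[OF norm_triangle_ineq4] add_mono D ini initial_segment_horizon)
      finally show ?thesis by simp
    qed
    have s_eq: "\<psi> t * complex_of_real (?s t) = (\<Sum>j\<in>{1..?N}. complex_of_real \<delta> * (\<psi> t * indicator (?U j) t))" for t
      unfolding of_real_sum of_real_mult sum_distrib_left
      by (intro sum.cong refl) (auto simp: indicator_def)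
    have int_s: "integrable (Leb L) (\<lambda>t. \<psi> t * complex_of_real (?s t))"
      unfolding s_eq by (intro Bochner_Integration.integrable_sum integrable_mult_right iU)
    have "norm (LINT t|Leb L. \<psi> t * complex_of_real (?s t)) = norm (\<Sum>j\<in>{1..?N}. complex_of_real \<delta> * (LINT t|Leb L. \<psi> t * indicator (?U j) t))"
      unfolding s_eq by (subst Bochner_Integration.integral_sum) (auto intro!: integrable_mult_right iU)
    also have "\<dots> \<le> (\<Sum>j\<in>{1..?N}. \<delta> * (2 * D))"
      by (rule sum_norm_le) (use nU \<delta>(1) in \<open>auto simp: norm_mult intro!: mult_left_mono\<close>)
    also have "\<dots> = real ?N * \<delta> * (2 * D)" by simp
    also have "\<dots> = 2 * R * D" by (simp only: \<delta>(2))
    finally have 1: "norm (LINT t|Leb L. \<psi> t * complex_of_real (?s t)) \<le> 2 * R * D" .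
    have "norm ((LINT t|Leb L. \<psi> t * complex_of_real (m t)) - (LINT t|Leb L. \<psi> t * complex_of_real (?s t)))
       = norm (LINT t|Leb L. \<psi> t * complex_of_real (m t) - \<psi> t * complex_of_real (?s t))"
      by (subst Bochner_Integration.integral_diff[OF \<psi>m int_s]) simp
    also have "\<dots> \<le> (LINT t|Leb L. \<delta> * norm (\<psi> t))"
    proof (rule Bochner_Integration.integral_norm_bound_integral)
      show "integrable (Leb L) (\<lambda>t. \<delta> * norm (\<psi> t))" using \<psi> by auto
      show "integrable (Leb L) (\<lambda>t. \<psi> t * complex_of_real (m t) - \<psi> t * complex_of_real (?s t))"
        using \<psi>m int_s by (rule Bochner_Integration.integrable_diff)
      fix t assume "t \<in> space (Leb L)"
      then have t: "t \<in> horizon L" by simp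
      have "norm (\<psi> t * complex_of_real (m t) - \<psi> t * complex_of_real (?s t)) = norm (\<psi> t) * \<bar>m t - ?s t\<bar>"
        by (simp only: right_diff_distrib[symmetric] of_real_diff[symmetric] norm_mult norm_of_real)
      also have "\<dots> \<le> norm (\<psi> t) * \<delta>" by (intro mult_left_mono approx t) auto
      finally show "norm (\<psi> t * complex_of_real (m t) - \<psi> t * complex_of_real (?s t)) \<le> \<delta> * norm (\<psi> t)"
        by (simp only: mult.commute)
    qed
    also have "\<dots> = R * I / real ?N" by (simp add: I_def \<delta>_def)
    finally have 2: "norm ((LINT t|Leb L. \<psi> t * complex_of_real (m t)) - (LINT t|Leb L. \<psi> t * complex_of_real (?s t))) \<le> R * I / real ?N" .
    show ?thesis
      using 1 2 norm_triangle_sub[of "LINT t|Leb L. \<psi> t * complex_of_real (m t)" "LINT t|Leb L. \<psi> t * complex_of_real (?s t)"]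
      by linarith
  qed
  have "(\<lambda>n. 2 * R * D + (R * I) * inverse (real (Suc n))) \<longlonglongrightarrow> 2 * R * D + (R * I) * 0"
    by (intro tendsto_intros LIMSEQ_inverse_real_of_nat)
  then show "norm (LINT t|Leb L. \<psi> t * complex_of_real (m t)) \<le> 2 * R * D"
    by (intro LIMSEQ_le_const[where X = "\<lambda>n. 2 * R * D + (R * I) * inverse (real (Suc n))"])
      (use step in \<open>auto simp: divide_inverse\<close>)
qed

text \<open>
  The function \<open>v\<close> is the variation of \<open>c\<close> up to a given time: appending the points \<open>s\<close> and \<open>t\<close> to a partition of
  the time up to \<open>s\<close> increases its sum by at least \<open>\<bar>c t - c s\<bar>\<close>.
\<close>

lemma bounded_variation_decomposition:
  assumes bv: "bounded_variation_on H c"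
  shows "\<exists>v C. 0 \<le> C \<and> (\<forall>t\<in>H. 0 \<le> v t \<and> v t \<le> C) \<and> (\<forall>s\<in>H. \<forall>t\<in>H. s \<le> t \<longrightarrow> \<bar>c t - c s\<bar> \<le> v t - v s)"
proof -
  from bv obtain C where C: "\<And>n (x :: nat \<Rightarrow> real). mono_on {..n} x \<Longrightarrow> x ` {..n} \<subseteq> H \<Longrightarrow>
       (\<Sum>i<n. \<bar>c (x (Suc i)) - c (x i)\<bar>) \<le> C"
    unfolding bounded_variation_on_def by blast
  define W where "W t = {\<Sum>i<n. \<bar>c (x (Suc i)) - c (x i)\<bar> | n (x :: nat \<Rightarrow> real). mono_on {..n} x \<and> x ` {..n} \<subseteq> H \<inter> {..t}}" for t
  have W0: "0 \<in> W t" if "t \<in> H" for t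
    unfolding W_def by (rule CollectI, intro exI[of _ 0] exI[of _ "\<lambda>_. t"]) (use that in \<open>auto simp: mono_on_def\<close>)
  have WC: "y \<le> C" if "y \<in> W t" for y t
    using that C unfolding W_def by auto
  have bdd: "bdd_above (W t)" for t by (rule bdd_aboveI) (rule WC)
  define v where "v t = Sup (W t)" for t
  have v0: "0 \<le> v t" if "t \<in> H" for t unfolding v_def by (rule cSup_upper[OF W0[OF that] bdd])
  have vC: "v t \<le> max C 0" if "t \<in> H" for t
    unfolding v_def by (rule cSup_least) (use W0[OF that] WC in \<open>auto intro: max.coboundedI1\<close>)
  have inc: "\<bar>c t - c s\<bar> \<le> v t - v s" if st: "s \<in> H" "t \<in> H" "s \<le> t" for s t
  proof -
    have "y \<le> v t - \<bar>c t - c s\<bar>" if y: "y \<in> W s" for y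
    proof -
      from y obtain n and x :: "nat \<Rightarrow> real" where x: "mono_on {..n} x" "x ` {..n} \<subseteq> H \<inter> {..s}"
        and y: "y = (\<Sum>i<n. \<bar>c (x (Suc i)) - c (x i)\<bar>)" unfolding W_def by auto
      define z where "z i = (if i \<le> n then x i else if i = Suc n then s else t)" for i
      have xs: "x i \<le> s" if "i \<le> n" for i using x(2) that by auto
      have mz: "mono_on {..Suc (Suc n)} z"
      proof (rule mono_onI)
        fix i j assume "i \<in> {..Suc (Suc n)}" "j \<in> {..Suc (Suc n)}" "i \<le> j"
        then show "z i \<le> z j"
          using mono_onD[OF x(1), of i j] xs[of i] st(3) unfolding z_def by auto
      qed
      have zt: "z ` {..Suc (Suc n)} \<subseteq> H \<inter> {..t}"
        using x(2) xs st unfolding z_def by (auto intro: order_trans)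
      have "(\<Sum>i<Suc (Suc n). \<bar>c (z (Suc i)) - c (z i)\<bar>) \<in> W t"
        unfolding W_def using mz zt by blast
      then have "(\<Sum>i<Suc (Suc n). \<bar>c (z (Suc i)) - c (z i)\<bar>) \<le> v t"
        unfolding v_def by (rule cSup_upper[OF _ bdd])
      moreover have "(\<Sum>i<Suc (Suc n). \<bar>c (z (Suc i)) - c (z i)\<bar>) = y + \<bar>c s - c (x n)\<bar> + \<bar>c t - c s\<bar>"
      proof -
        have "(\<Sum>i<n. \<bar>c (z (Suc i)) - c (z i)\<bar>) = y" unfolding y by (intro sum.cong) (auto simp: z_def)
        then show ?thesis by (simp add: z_def)
      qed
      ultimately show ?thesis by linarith
    qed
    then have "v s \<le> v t - \<bar>c t - c s\<bar>"
      unfolding v_def[of s] by (intro cSup_least) (use W0[OF st(1)] in auto)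
    then show ?thesis by simp
  qed
  show ?thesis by (intro exI[of _ v] exI[of _ "max C 0"]) (use v0 vC inc in auto)
qed

lemma bounded_variation_bounded:
  assumes "bounded_variation_on (horizon L) c" "0 < L"
  shows "\<exists>K. \<forall>t\<in>horizon L. \<bar>c t\<bar> \<le> K"
proof -
  obtain v C where v: "\<And>t. t \<in> horizon L \<Longrightarrow> 0 \<le> v t \<and> v t \<le> C"
    "\<And>s t. s \<in> horizon L \<Longrightarrow> t \<in> horizon L \<Longrightarrow> s \<le> t \<Longrightarrow> \<bar>c t - c s\<bar> \<le> v t - v s"
    using bounded_variation_decomposition[OF assms(1)] by blast
  have 0: "0 \<in> horizon L" using assms(2) by (auto simp: horizon_def zero_ereal_def[symmetric])
  have "\<bar>c t\<bar> \<le> C + \<bar>c 0\<bar>" if t: "t \<in> horizon L" for t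
  proof -
    have "0 \<le> t" using t by (simp add: horizon_def)
    then show ?thesis using v(2)[OF 0 t] v(1)[OF 0] v(1)[OF t] by linarith
  qed
  then show ?thesis by blast
qed

text \<open>
  A substitute for integration by parts.  Both \<open>v\<close> and \<open>v - c\<close> are bounded and monotone, where \<open>v\<close> is the
  variation of \<open>c\<close>, so the bound for monotone functions applies to each of them.
\<close>

lemma bounded_variation_integral_bound:
  assumes bv: "bounded_variation_on (horizon L) c" and L: "0 < L"
  shows "\<exists>K. \<forall>\<psi> D. integrable (Leb L) \<psi> \<longrightarrow>
     (\<forall>A. initial_segment L A \<longrightarrow> norm (LINT t|Leb L. \<psi> t * indicator A t) \<le> D) \<longrightarrow>
     norm (LINT t|Leb L. \<psi> t * complex_of_real (c t)) \<le> K * D"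
proof -
  obtain v C where v: "0 \<le> C" "\<And>t. t \<in> horizon L \<Longrightarrow> 0 \<le> v t \<and> v t \<le> C"
    "\<And>s t. s \<in> horizon L \<Longrightarrow> t \<in> horizon L \<Longrightarrow> s \<le> t \<Longrightarrow> \<bar>c t - c s\<bar> \<le> v t - v s"
    using bounded_variation_decomposition[OF bv] by blast
  have 0: "0 \<in> horizon L" using L by (auto simp: horizon_def zero_ereal_def[symmetric])
  have pos: "0 \<le> t" if "t \<in> horizon L" for t using that by (simp add: horizon_def)
  define R where "R = 2 * C + 1"
  have R: "0 < R" using v(1) by (simp add: R_def)
  \<comment> \<open>The shift by \<open>c 0\<close> makes this monotone function nonnegative.\<close>
  define u where "u t = v t - c t + c 0" for t
  have mv: "mono_on (horizon L) v"
  proof (rule mono_onI)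
    fix s t assume "s \<in> horizon L" "t \<in> horizon L" "s \<le> t"
    from v(3)[OF this] show "v s \<le> v t" by linarith
  qed
  have mu: "mono_on (horizon L) u"
  proof (rule mono_onI)
    fix s t assume "s \<in> horizon L" "t \<in> horizon L" "s \<le> t"
    from v(3)[OF this] show "u s \<le> u t" unfolding u_def by linarith
  qed
  have bv: "0 \<le> v t" "v t \<le> R" if "t \<in> horizon L" for t using v(1) v(2)[OF that] by (auto simp: R_def)
  have bu: "0 \<le> u t" "u t \<le> R" if "t \<in> horizon L" for t
    using v(1) v(2)[OF that] v(2)[OF 0] v(3)[OF 0 that pos[OF that]] unfolding u_def R_def by linarith+
  have "norm (LINT t|Leb L. \<psi> t * complex_of_real (c t)) \<le> (4 * R + \<bar>c 0\<bar>) * D"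
    if \<psi>: "integrable (Leb L) \<psi>"
    and D: "\<forall>A. initial_segment L A \<longrightarrow> norm (LINT t|Leb L. \<psi> t * indicator A t) \<le> D" for \<psi> D
  proof -
    note [measurable] = borel_measurable_integrable[OF \<psi>]
    have D': "\<And>A. initial_segment L A \<Longrightarrow> norm (LINT t|Leb L. \<psi> t * indicator A t) \<le> D" using D by blast
    note V = integral_times_monotone_bound[OF mv bv R \<psi> D'] and U = integral_times_monotone_bound[OF mu bu R \<psi> D']
    have int: "integrable (Leb L) (\<lambda>t. \<psi> t * complex_of_real (m t))"
      if [measurable]: "m \<in> borel_measurable (Leb L)" and m: "\<And>t. t \<in> horizon L \<Longrightarrow> 0 \<le> m t" "\<And>t. t \<in> horizon L \<Longrightarrow> m t \<le> R" for m
      by (rule integrable_times_bounded[OF \<psi> that(1), of R]) (use m in auto)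
    have iv: "integrable (Leb L) (\<lambda>t. \<psi> t * complex_of_real (v t))" by (rule int[OF V(1) bv])
    have iu: "integrable (Leb L) (\<lambda>t. \<psi> t * complex_of_real (u t))" by (rule int[OF U(1) bu])
    have i0: "integrable (Leb L) (\<lambda>t. \<psi> t * complex_of_real (c 0))" using \<psi> by simp
    have "(LINT t|Leb L. \<psi> t * complex_of_real (c t))
       = (LINT t|Leb L. (\<psi> t * complex_of_real (v t) - \<psi> t * complex_of_real (u t)) + \<psi> t * complex_of_real (c 0))"
      by (intro Bochner_Integration.integral_cong refl) (simp add: u_def algebra_simps)
    also have "\<dots> = (LINT t|Leb L. \<psi> t * complex_of_real (v t)) - (LINT t|Leb L. \<psi> t * complex_of_real (u t)) + (LINT t|Leb L. \<psi> t) * complex_of_real (c 0)"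
      using iv iu i0 by (simp add: Bochner_Integration.integral_add Bochner_Integration.integral_diff)
    also have "norm \<dots> \<le> 2 * R * D + 2 * R * D + D * \<bar>c 0\<bar>"
    proof (intro order_trans[OF norm_triangle_ineq] add_mono order_trans[OF norm_triangle_ineq4] V(2) U(2))
      have "(LINT t|Leb L. \<psi> t) = (LINT t|Leb L. \<psi> t * indicator (horizon L) t)"
        by (intro Bochner_Integration.integral_cong) auto
      then have "norm (LINT t|Leb L. \<psi> t) \<le> D" using D'[OF initial_segment_horizon] by simp
      then show "norm ((LINT t|Leb L. \<psi> t) * complex_of_real (c 0)) \<le> D * \<bar>c 0\<bar>"
        by (simp add: norm_mult mult_right_mono)
    qed
    finally show ?thesis by (simp add: algebra_simps)
  qed
  then show ?thesis by blast
qed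

lemma sq_norm_initial_diff:
  assumes f: "f \<in> sq_int (Leb L)" and A: "initial_segment L A" "initial_segment L A'"
  shows "sq_norm (Leb L) (\<lambda>t. f t * indicator A t - f t * indicator A' t)
     = \<bar>sq_norm (Leb L) (\<lambda>t. f t * indicator A t) - sq_norm (Leb L) (\<lambda>t. f t * indicator A' t)\<bar>"
proof -
  have *: "sq_norm (Leb L) (\<lambda>t. f t * indicator A' t - f t * indicator A t)
     = sq_norm (Leb L) (\<lambda>t. f t * indicator A' t) - sq_norm (Leb L) (\<lambda>t. f t * indicator A t)"
    if sub: "A \<subseteq> A'" and A: "initial_segment L A" "initial_segment L A'" for A A'
  proof -
    have i: "integrable (Leb L) (\<lambda>t. (norm (f t * indicator A t))\<^sup>2)" if "initial_segment L A" for A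
      by (rule sq_intD(2)[OF sq_int_indicator[OF f initial_segment_sets[OF that]]])
    show ?thesis
      unfolding sq_norm_def Bochner_Integration.integral_diff[OF i[OF A(2)] i[OF A(1)], symmetric]
      by (intro Bochner_Integration.integral_cong) (use sub in \<open>auto simp: indicator_def\<close>)
  qed
  from initial_segment_chain[OF A] show ?thesis
  proof
    assume "A \<subseteq> A'"
    from *[OF this A] show ?thesis
      using sq_norm_nonneg[of "Leb L" "\<lambda>t. f t * indicator A' t - f t * indicator A t"]
        sq_norm_commute[of "Leb L" "\<lambda>t. f t * indicator A t" "\<lambda>t. f t * indicator A' t"] by linarith
  next
    assume "A' \<subseteq> A"
    from *[OF this A(2,1)] show ?thesis
      using sq_norm_nonneg[of "Leb L" "\<lambda>t. f t * indicator A t - f t * indicator A' t"] by linarith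
  qed
qed

text \<open>
  The squared norm carried by \<open>(-\<infinity>, t]\<close> is a continuous function of \<open>t\<close> that rises from 0 to the squared norm
  of \<open>f\<close>; the full share \<open>u = 1\<close> need not be attained at a finite time and is carried by the whole interval.
\<close>

lemma quantile_exists:
  assumes f: "f \<in> sq_int (Leb L)" and u: "0 \<le> u" "u \<le> 1"
  shows "\<exists>A. initial_segment L A \<and> sq_norm (Leb L) (\<lambda>t. f t * indicator A t) = u * sq_norm (Leb L) f"
proof (cases "u = 1 \<or> u * sq_norm (Leb L) f = 0")
  case True
  then show ?thesis
  proof
    assume "u = 1"
    moreover have "sq_norm (Leb L) (\<lambda>t. f t * indicator (horizon L) t) = sq_norm (Leb L) f"
      unfolding sq_norm_def by (intro Bochner_Integration.integral_cong) auto
    ultimately show ?thesis using initial_segment_horizon[of L] by auto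
  next
    assume "u * sq_norm (Leb L) f = 0"
    then show ?thesis by (intro exI[of _ "{}"]) (auto simp: initial_segment_empty sq_norm_def)
  qed
next
  case False
  define F where "F t = (LINT x|Leb L. indicator {..t} x * (norm (f x))\<^sup>2)" for t
  note i = sq_intD(2)[OF f] and [measurable] = sq_intD(1)[OF f]
  have [measurable]: "(\<lambda>x. indicator {..t} x * (norm (f x))\<^sup>2) \<in> borel_measurable (Leb L)" for t
    by (intro borel_measurable_times borel_measurable_Leb[of "indicator {..t}"]) auto
  have F: "F t = sq_norm (Leb L) (\<lambda>x. f x * indicator (horizon L \<inter> {..t}) x)" for t
    unfolding F_def sq_norm_def by (intro Bochner_Integration.integral_cong) (auto simp: indicator_def)
  have top: "(\<lambda>n. F (real n)) \<longlonglongrightarrow> sq_norm (Leb L) f"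
    unfolding F_def sq_norm_def
  proof (rule integral_dominated_convergence[OF _ _ i])
    show "AE x in Leb L. (\<lambda>n. indicator {..real n} x * (norm (f x))\<^sup>2) \<longlonglongrightarrow> (norm (f x))\<^sup>2"
    proof (rule AE_I2)
      fix x
      show "(\<lambda>n. indicator {..real n} x * (norm (f x))\<^sup>2) \<longlonglongrightarrow> (norm (f x))\<^sup>2"
        by (rule tendsto_eventually, rule eventually_sequentiallyI[of "nat \<lceil>x\<rceil>"])
          (auto simp: indicator_def nat_ceiling_le_eq)
    qed
    show "AE x in Leb L. norm (indicator {..real n} x * (norm (f x))\<^sup>2) \<le> (norm (f x))\<^sup>2" for n
      by (intro AE_I2) (auto simp: indicator_def)
  qed auto
  have cont: "continuous_on UNIV F"
    unfolding continuous_on_sequentially o_def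
  proof safe
    fix s :: "nat \<Rightarrow> real" and t assume s: "s \<longlonglongrightarrow> t"
    show "(\<lambda>n. F (s n)) \<longlonglongrightarrow> F t"
      unfolding F_def
    proof (rule integral_dominated_convergence[OF _ _ i])
      show "AE x in Leb L. (\<lambda>n. indicator {..s n} x * (norm (f x))\<^sup>2) \<longlonglongrightarrow> indicator {..t} x * (norm (f x))\<^sup>2"
        using AE_Leb_singleton[where a = t and L = L]
      proof eventually_elim
        case (elim x)
        then show ?case by (intro tendsto_mult indicator_atMost_tendsto s tendsto_const)
      qed
      show "AE x in Leb L. norm (indicator {..s n} x * (norm (f x))\<^sup>2) \<le> (norm (f x))\<^sup>2" for n
        by (intro AE_I2) (auto simp: indicator_def)
    qed auto
  qed
  have "sq_norm (Leb L) f > 0" using False sq_norm_nonneg[of "Leb L" f] by (auto simp: less_le)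
  then have "u * sq_norm (Leb L) f < sq_norm (Leb L) f" using False u by simp
  from order_tendstoD(1)[OF top this] obtain n where n: "u * sq_norm (Leb L) f < F (real n)"
    by (auto simp: eventually_sequentially)
  have "F (- 1) = (LINT x|Leb L. 0)"
    unfolding F_def by (intro Bochner_Integration.integral_cong) (auto simp: indicator_def horizon_def)
  then have "F (- 1) \<le> u * sq_norm (Leb L) f" using u by simp
  then obtain t where "F t = u * sq_norm (Leb L) f"
    using IVT'[of F "- 1" "u * sq_norm (Leb L) f" "real n"] n continuous_on_subset[OF cont, of "{-1..real n}"] by auto
  moreover have "initial_segment L (horizon L \<inter> {..t})" by (auto simp: initial_segment_def)
  ultimately show ?thesis using F by auto
qed

text \<open>
  An initial segment that carries the share \<open>u\<close> of the squared norm of \<open>f\<close>.  Indexing by \<open>u\<close> instead of by time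
  turns the squared norm of an increment into a multiple of \<open>\<bar>u - v\<bar>\<close>, and the time interval, bounded or not,
  into \<open>[0, 1]\<close>.
\<close>

definition quantile_set :: "ereal \<Rightarrow> (real \<Rightarrow> complex) \<Rightarrow> real \<Rightarrow> real set"
  where "quantile_set L f u = (SOME A. initial_segment L A \<and> sq_norm (Leb L) (\<lambda>t. f t * indicator A t) = u * sq_norm (Leb L) f)"

lemma quantile_set:
  assumes "f \<in> sq_int (Leb L)" "u \<in> {0..1}"
  shows "initial_segment L (quantile_set L f u)" "sq_norm (Leb L) (\<lambda>t. f t * indicator (quantile_set L f u) t) = u * sq_norm (Leb L) f"
  using someI_ex[OF quantile_exists[OF assms(1), of u]] assms(2) unfolding quantile_set_def by auto

lemma quantile_set_increment:
  assumes "f \<in> sq_int (Leb L)" "u \<in> {0..1}" "v \<in> {0..1}"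
  shows "sq_norm (Leb L) (\<lambda>t. f t * indicator (quantile_set L f u) t - f t * indicator (quantile_set L f v) t) = \<bar>u - v\<bar> * sq_norm (Leb L) f"
  using sq_norm_initial_diff[OF assms(1) quantile_set(1)[OF assms(1,2)] quantile_set(1)[OF assms(1,3)]]
    abs_mult[of "u - v" "sq_norm (Leb L) f"] abs_of_nonneg[OF sq_norm_nonneg[of "Leb L" f]]
  by (simp only: quantile_set(2)[OF assms(1,2)] quantile_set(2)[OF assms(1,3)] left_diff_distrib)

text \<open>
  Two initial segments that carry the same share of \<open>f\<close> are nested, and \<open>f\<close> vanishes almost everywhere on their
  difference.
\<close>

lemma initial_segment_is_quantile_set:
  assumes f: "f \<in> sq_int (Leb L)" and A: "initial_segment L A"
  shows "\<exists>u\<in>{0..1}. \<forall>h\<in>sq_int (Leb L). inner_prod (Leb L) h (\<lambda>t. f t * indicator A t) = inner_prod (Leb L) h (\<lambda>t. f t * indicator (quantile_set L f u) t)"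
proof -
  let ?E = "sq_norm (Leb L) f" and ?e = "sq_norm (Leb L) (\<lambda>t. f t * indicator A t)"
  have e: "?e \<le> ?E" by (rule sq_norm_indicator_le[OF f initial_segment_sets[OF A]])
  define u where "u = ?e / ?E"
  have "?e = 0" if "?E = 0" using e that sq_norm_nonneg[of "Leb L" "\<lambda>t. f t * indicator A t"] by linarith
  then have u: "u \<in> {0..1}" "u * ?E = ?e"
    using e sq_norm_nonneg[of "Leb L" f] sq_norm_nonneg[of "Leb L" "\<lambda>t. f t * indicator A t"]
    unfolding u_def by (auto simp: divide_le_eq_1 less_le simp del: sq_norm_nonneg)
  have a: "(\<lambda>t. f t * indicator A t) \<in> sq_int (Leb L)" "(\<lambda>t. f t * indicator (quantile_set L f u) t) \<in> sq_int (Leb L)"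
    by (auto intro!: sq_int_indicator f initial_segment_sets A quantile_set u)
  have z: "sq_norm (Leb L) (\<lambda>t. f t * indicator A t - f t * indicator (quantile_set L f u) t) = 0"
    using sq_norm_initial_diff[OF f A quantile_set(1)[OF f u(1)]] quantile_set(2)[OF f u(1)] u(2) by simp
  show ?thesis
  proof (intro bexI[of _ u] ballI u(1))
    fix h assume h: "h \<in> sq_int (Leb L)"
    have "(norm (inner_prod (Leb L) h (\<lambda>t. f t * indicator A t - f t * indicator (quantile_set L f u) t)))\<^sup>2 \<le> 0"
      using inner_prod_CS[OF h sq_int_diff[OF a]] z by simp
    then show "inner_prod (Leb L) h (\<lambda>t. f t * indicator A t) = inner_prod (Leb L) h (\<lambda>t. f t * indicator (quantile_set L f u) t)"
      by (simp add: inner_prod_diff[OF h a])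
  qed
qed

lemma inner_prod_quantile_set_continuous:
  assumes f: "f \<in> sq_int (Leb L)" and h: "h \<in> sq_int (Leb L)"
  shows "continuous_on {0..1} (\<lambda>u. inner_prod (Leb L) h (\<lambda>t. f t * indicator (quantile_set L f u) t))"
  unfolding continuous_on_sequentially o_def
proof safe
  fix s :: "nat \<Rightarrow> real" and u assume su: "u \<in> {0..1}" "\<forall>n. s n \<in> {0..1}" and s: "s \<longlonglongrightarrow> u"
  have "(\<lambda>n. sq_norm (Leb L) (\<lambda>t. f t * indicator (quantile_set L f u) t - f t * indicator (quantile_set L f (s n)) t)) \<longlonglongrightarrow> \<bar>u - u\<bar> * sq_norm (Leb L) f"
    unfolding quantile_set_increment[OF f su(1) su(2)[rule_format]] by (intro tendsto_intros s)
  then show "(\<lambda>n. inner_prod (Leb L) h (\<lambda>t. f t * indicator (quantile_set L f (s n)) t)) \<longlonglongrightarrow> inner_prod (Leb L) h (\<lambda>t. f t * indicator (quantile_set L f u) t)"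
    using su by (intro inner_prod_tendsto h sq_int_indicator f initial_segment_sets quantile_set) auto
qed

section \<open>Chaining\<close>

lemma ennreal_tendsto_0I:
  fixes f :: "nat \<Rightarrow> ennreal"
  assumes "\<And>\<epsilon>::real. \<epsilon> > 0 \<Longrightarrow> \<forall>\<^sub>F n in sequentially. f n \<le> ennreal \<epsilon>"
  shows "f \<longlonglongrightarrow> 0"
proof (rule order_tendstoI)
  fix a :: ennreal assume "0 < a"
  then obtain \<epsilon> where \<epsilon>: "0 < \<epsilon>" "ennreal \<epsilon> < a"
    by (metis dense ennreal_cases ennreal_less_zero_iff less_top_ennreal order_less_trans)
  from assms[OF \<epsilon>(1)] show "\<forall>\<^sub>F n in sequentially. f n < a"
    by eventually_elim (use \<epsilon>(2) in auto)
qed auto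

text \<open>
  A dyadic point of level \<open>n + 1\<close> either has level \<open>n\<close> or is at distance \<open>2\<^sup>-\<^sup>n\<^sup>-\<^sup>1\<close> from its left neighbour,
  which has level \<open>n\<close>.  Iterating down to level \<open>K\<close> costs one increment per level.
\<close>

lemma dyadic_chain:
  fixes x :: "real \<Rightarrow> complex"
  assumes d: "\<And>l i. i < 2 ^ Suc l \<Longrightarrow> norm (x (real (Suc i) / 2 ^ Suc l) - x (real i / 2 ^ Suc l)) \<le> d l"
    and d0: "\<And>l. 0 \<le> d l"
    and j: "j \<le> 2 ^ (K + p)"
  shows "norm (x (real j / 2 ^ (K + p))) \<le> (\<Sum>i\<le>2 ^ K. norm (x (real i / 2 ^ K))) + (\<Sum>l<p. d (K + l))"
  using j
proof (induction p arbitrary: j)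
  case 0
  then have "norm (x (real j / 2 ^ K)) \<le> (\<Sum>i\<le>2 ^ K. norm (x (real i / 2 ^ K)))"
    by (intro member_le_sum[of j "{..2 ^ K}" "\<lambda>i. norm (x (real i / 2 ^ K))"]) auto
  then show ?case by simp
next
  case (Suc p)
  let ?S = "(\<Sum>i\<le>2 ^ K. norm (x (real i / 2 ^ K)))"
  define i where "i = j div 2"
  have half: "real (2 * i) / 2 ^ (K + Suc p) = real i / 2 ^ (K + p)" by simp
  have i: "i \<le> 2 ^ (K + p)" using Suc.prems by (simp add: i_def)
  show ?case
  proof (cases "even j")
    case True
    then have "j = 2 * i" by (simp add: i_def)
    then show ?thesis using Suc.IH[OF i] half d0[of "K + p"] by simp
  next
    case False
    then have j: "j = Suc (2 * i)" by (simp add: i_def)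
    have "2 * i < 2 ^ Suc (K + p)" using Suc.prems j by simp
    from d[OF this] have "norm (x (real j / 2 ^ (K + Suc p)) - x (real (2 * i) / 2 ^ (K + Suc p))) \<le> d (K + p)"
      by (simp only: j add_Suc_right)
    then have "norm (x (real j / 2 ^ (K + Suc p)) - x (real i / 2 ^ (K + p))) \<le> d (K + p)"
      by (simp only: half)
    then show ?thesis using Suc.IH[OF i] norm_triangle_sub[of "x (real j / 2 ^ (K + Suc p))" "x (real i / 2 ^ (K + p))"]
      by simp
  qed
qed

lemma le_plus_fourth_power:
  fixes x r :: real assumes "0 < r" "0 \<le> x" shows "x \<le> r + x ^ 4 / r ^ 3"
proof (cases "x \<le> r")
  case True
  have "0 \<le> x ^ 4 / r ^ 3" using assms by simp
  then show ?thesis using True by linarith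
next
  case False
  have "x * r ^ 3 \<le> x * x ^ 3" using False assms by (intro mult_left_mono power_mono) auto
  then have "x \<le> x ^ 4 / r ^ 3" using assms by (simp add: pos_le_divide_eq power4_eq_xxxx power3_eq_cube mult.assoc)
  then show ?thesis using assms by linarith
qed

context prob_space
begin

text \<open>
  The supremum of \<open>X\<^sub>k\<close> is bounded by the values at the finitely many dyadic points of level \<open>K\<close>, whose
  expectations tend to 0 with \<open>k\<close>, and the contributions of the finer levels, whose expectations are bounded
  by \<open>10 (1 + C) (9/10)\<^sup>K\<close> uniformly in \<open>k\<close>.
\<close>

lemma chaining_limit:
  fixes X :: "nat \<Rightarrow> real \<Rightarrow> 'a \<Rightarrow> complex"
  assumes [measurable]: "\<And>k u. u \<in> {0..1} \<Longrightarrow> X k u \<in> borel_measurable M"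
    and cont: "\<And>k w. w \<in> space M \<Longrightarrow> continuous_on {0..1} (\<lambda>u. X k u w)"
    and C: "0 \<le> C" "\<And>k u v. u \<in> {0..1} \<Longrightarrow> v \<in> {0..1} \<Longrightarrow>
        (\<integral>\<^sup>+w. ennreal ((norm (X k u w - X k v w)) ^ 4) \<partial>M) \<le> ennreal (C * (u - v)\<^sup>2)"
    and pt: "\<And>u. u \<in> {0..1} \<Longrightarrow> (\<lambda>k. \<integral>\<^sup>+w. ennreal (norm (X k u w)) \<partial>M) \<longlonglongrightarrow> 0"
  shows "\<exists>Y. (\<forall>k. Y k \<in> borel_measurable M) \<and>
     (\<forall>k. \<forall>w\<in>space M. \<forall>u\<in>{0..1}. ennreal (norm (X k u w)) \<le> Y k w) \<and>
     (\<lambda>k. \<integral>\<^sup>+w. Y k w \<partial>M) \<longlonglongrightarrow> 0"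
proof -
  define q where "q n j = real j / 2 ^ n" for n j :: nat
  have q: "q n j \<in> {0..1}" if "j \<le> 2 ^ n" for n j
  proof -
    have "real j \<le> 2 ^ n" using of_nat_mono[OF that, where ?'a = real] by simp
    then show ?thesis by (simp add: q_def)
  qed
  have qm [measurable]: "X k (q n j) \<in> borel_measurable M" if "j \<le> 2 ^ n" for k n j
    using q[OF that] by measurable
  define Y where "Y k w = (SUP n. SUP j\<in>{..2 ^ n}. ennreal (norm (X k (q n j) w)))" for k w
  have Ym: "Y k \<in> borel_measurable M" for k
  proof -
    have "(\<lambda>w. ennreal (norm (X k (q n j) w))) \<in> borel_measurable M" if "j \<in> {..2 ^ n}" for n j
      using that by (intro measurable_compose[OF _ measurable_ennreal] borel_measurable_norm qm) auto
    then show ?thesis unfolding Y_def by (intro borel_measurable_SUP) auto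
  qed
  have YX: "ennreal (norm (X k u w)) \<le> Y k w" if w: "w \<in> space M" and u: "u \<in> {0..1}" for k u w
  proof -
    \<comment> \<open>By continuity, it is enough to approximate \<open>u\<close> by dyadic points from below.\<close>
    define j where "j n = nat \<lfloor>u * 2 ^ n\<rfloor>" for n :: nat
    have j: "real (j n) \<le> u * 2 ^ n" "u * 2 ^ n < real (j n) + 1" for n
    proof -
      have "0 \<le> u * 2 ^ n" using u by simp
      then have "real (j n) = of_int \<lfloor>u * 2 ^ n\<rfloor>" by (simp add: j_def)
      then show "real (j n) \<le> u * 2 ^ n" "u * 2 ^ n < real (j n) + 1" by linarith+
    qed
    have jn: "j n \<le> 2 ^ n" for n
    proof -
      have "real (j n) \<le> 1 * 2 ^ n" using j(1)[of n] u by (intro order_trans[OF j(1)] mult_right_mono) auto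
      then have "real (j n) \<le> real (2 ^ n)" by simp
      then show ?thesis by (simp only: of_nat_le_iff)
    qed
    have lim: "(\<lambda>n. q n (j n)) \<longlonglongrightarrow> u"
    proof (rule tendsto_sandwich)
      show "\<forall>\<^sub>F n in sequentially. u - (1/2) ^ n \<le> q n (j n)"
      proof (intro always_eventually allI)
        fix n
        have "(u * 2 ^ n - 1) / 2 ^ n \<le> real (j n) / 2 ^ n"
          using j(2)[of n] by (intro divide_right_mono) auto
        then show "u - (1/2) ^ n \<le> q n (j n)" by (simp add: q_def diff_divide_distrib power_one_over)
      qed
      show "\<forall>\<^sub>F n in sequentially. q n (j n) \<le> u"
        using j(1) by (intro always_eventually allI) (simp add: q_def field_simps)
      have "(\<lambda>n. u - (1/2) ^ n) \<longlonglongrightarrow> u - 0" by (intro tendsto_diff tendsto_const LIMSEQ_power_zero) auto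
      then show "(\<lambda>n. u - (1/2) ^ n) \<longlonglongrightarrow> u" by simp
    qed auto
    have "(\<lambda>n. X k (q n (j n)) w) \<longlonglongrightarrow> X k u w"
      by (rule continuous_on_tendsto_compose[OF cont[OF w, of k] lim u]) (use q[OF jn] in simp)
    then have "(\<lambda>n. ennreal (norm (X k (q n (j n)) w))) \<longlonglongrightarrow> ennreal (norm (X k u w))"
      by (intro tendsto_ennrealI tendsto_norm)
    then show ?thesis
    proof (rule LIMSEQ_le_const2, intro exI[of _ 0] allI impI)
      fix n
      have "ennreal (norm (X k (q n (j n)) w)) \<le> (SUP j\<in>{..2 ^ n}. ennreal (norm (X k (q n j) w)))"
        using jn[of n] by (intro SUP_upper) auto
      also have "\<dots> \<le> Y k w" unfolding Y_def by (rule SUP_upper) auto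
      finally show "ennreal (norm (X k (q n (j n)) w)) \<le> Y k w" .
    qed
  qed
  \<comment> \<open>An increment \<open>x\<close> of level \<open>l\<close> is estimated by \<open>x \<le> r\<^sup>l + x\<^sup>4 / r\<^sup>3\<^sup>l\<close>.  The fourth moments of a level sum up to
    order \<open>2\<^sup>-\<^sup>l\<close>, so any \<open>r < 1\<close> with \<open>1 / (2 r\<^sup>3) \<le> r\<close> will do.\<close>
  define r :: real where "r = 9 / 10"
  have r: "0 < r" "r < 1" by (auto simp: r_def)
  define D where "D k l w = (\<Sum>i<2 ^ Suc l. (norm (X k (q (Suc l) (Suc i)) w - X k (q (Suc l) i) w)) ^ 4)" for k l w
  define d where "d k l w = r ^ l + D k l w / (r ^ l) ^ 3" for k l w
  have D0: "0 \<le> D k l w" for k l w by (auto simp: D_def intro!: sum_nonneg)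
  have Dm [measurable]: "D k l \<in> borel_measurable M" for k l
    unfolding D_def by (intro borel_measurable_sum borel_measurable_power borel_measurable_norm borel_measurable_diff qm) auto
  have dm [measurable]: "d k l \<in> borel_measurable M" for k l unfolding d_def by measurable
  have d0: "0 \<le> d k l w" for k l w using D0[of k l w] r by (simp add: d_def)
  have intd: "(\<integral>\<^sup>+w. ennreal (d k l w) \<partial>M) \<le> ennreal ((1 + C) * r ^ l)" for k l
  proof -
    have "(\<integral>\<^sup>+w. ennreal (D k l w) \<partial>M) = (\<Sum>i<2 ^ Suc l. \<integral>\<^sup>+w. ennreal ((norm (X k (q (Suc l) (Suc i)) w - X k (q (Suc l) i) w)) ^ 4) \<partial>M)"
      unfolding D_def by (subst sum_ennreal[symmetric], simp, rule nn_integral_sum)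
        (intro measurable_compose[OF _ measurable_ennreal] borel_measurable_power borel_measurable_norm borel_measurable_diff qm; auto)
    also have "\<dots> \<le> (\<Sum>i<(2::nat) ^ Suc l. ennreal (C * (1 / 2 ^ Suc l)\<^sup>2))"
    proof (rule sum_mono)
      fix i assume "i \<in> {..<(2::nat) ^ Suc l}"
      then have i: "i \<le> 2 ^ Suc l" "Suc i \<le> 2 ^ Suc l" by auto
      have "q (Suc l) (Suc i) - q (Suc l) i = 1 / 2 ^ Suc l" by (simp add: q_def field_simps)
      with C(2)[OF q[OF i(2)] q[OF i(1)], of k]
      show "(\<integral>\<^sup>+w. ennreal ((norm (X k (q (Suc l) (Suc i)) w - X k (q (Suc l) i) w)) ^ 4) \<partial>M) \<le> ennreal (C * (1 / 2 ^ Suc l)\<^sup>2)"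
        by (simp only:)
    qed
    also have "\<dots> = ennreal (2 ^ Suc l * (C * (1 / 2 ^ Suc l)\<^sup>2))"
      using C(1) by (subst sum_ennreal) auto
    also have "2 ^ Suc l * (C * (1 / 2 ^ Suc l)\<^sup>2) = C * (1 / 2 ^ Suc l)" by (simp add: power2_eq_square)
    finally have ID: "(\<integral>\<^sup>+w. ennreal (D k l w) \<partial>M) \<le> ennreal (C * (1 / 2 ^ Suc l))" .
    have "(\<integral>\<^sup>+w. ennreal (d k l w) \<partial>M) = (\<integral>\<^sup>+w. ennreal (r ^ l) + ennreal (1 / (r ^ l) ^ 3) * ennreal (D k l w) \<partial>M)"
      using D0 r by (intro nn_integral_cong) (simp add: d_def ennreal_plus flip: ennreal_mult)
    also have "\<dots> = ennreal (r ^ l) + ennreal (1 / (r ^ l) ^ 3) * (\<integral>\<^sup>+w. ennreal (D k l w) \<partial>M)"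
      by (simp add: nn_integral_add nn_integral_cmult emeasure_space_1)
    also have "\<dots> \<le> ennreal (r ^ l) + ennreal (1 / (r ^ l) ^ 3) * ennreal (C * (1 / 2 ^ Suc l))"
      by (intro add_left_mono mult_left_mono ID) auto
    also have "\<dots> = ennreal (r ^ l + 1 / (r ^ l) ^ 3 * (C * (1 / 2 ^ Suc l)))"
      using r C(1) by (simp add: ennreal_plus flip: ennreal_mult)
    also have "\<dots> \<le> ennreal ((1 + C) * r ^ l)"
    proof (rule ennreal_leI)
      have "1 / (r ^ l) ^ 3 * (1 / 2 ^ Suc l) \<le> 1 / (r ^ l) ^ 3 * (1 / 2 ^ l)"
        using r by (intro mult_left_mono) (auto simp: field_simps)
      also have "\<dots> = (500 / 729) ^ l"
      proof -
        have "1 / (r ^ l) ^ 3 * (1 / 2 ^ l) = (1 / (r ^ 3 * 2)) ^ l"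
          by (simp add: power_divide power_mult_distrib mult.commute flip: power_mult)
        then show ?thesis by (simp add: r_def power3_eq_cube)
      qed
      also have "\<dots> \<le> r ^ l" by (intro power_mono) (auto simp: r_def)
      finally have "C * (1 / (r ^ l) ^ 3 * (1 / 2 ^ Suc l)) \<le> C * r ^ l" by (rule mult_left_mono[OF _ C(1)])
      then show "r ^ l + 1 / (r ^ l) ^ 3 * (C * (1 / 2 ^ Suc l)) \<le> (1 + C) * r ^ l"
        by (simp add: algebra_simps)
    qed
    finally show ?thesis .
  qed
  have bound: "Y k w \<le> (\<Sum>i\<le>2 ^ K. ennreal (norm (X k (q K i) w))) + (\<Sum>l. ennreal (d k (K + l) w))" for k K w
  proof -
    have inc: "norm (X k (real (Suc i) / 2 ^ Suc l) w - X k (real i / 2 ^ Suc l) w) \<le> d k l w" if i: "i < 2 ^ Suc l" for l i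
    proof -
      let ?x = "norm (X k (q (Suc l) (Suc i)) w - X k (q (Suc l) i) w)"
      have "?x \<le> r ^ l + ?x ^ 4 / (r ^ l) ^ 3" by (rule le_plus_fourth_power) (use r in auto)
      also have "?x ^ 4 \<le> D k l w"
        unfolding D_def by (rule member_le_sum[where f = "\<lambda>i. norm (X k (q (Suc l) (Suc i)) w - X k (q (Suc l) i) w) ^ 4"]) (use i in auto)
      finally show ?thesis using r by (simp add: d_def q_def divide_right_mono)
    qed
    have dy: "ennreal (norm (X k (q (K + p) j) w)) \<le> (\<Sum>i\<le>2 ^ K. ennreal (norm (X k (q K i) w))) + (\<Sum>l. ennreal (d k (K + l) w))"
      if j: "j \<le> 2 ^ (K + p)" for p j
    proof -
      have "norm (X k (q (K + p) j) w) \<le> (\<Sum>i\<le>2 ^ K. norm (X k (q K i) w)) + (\<Sum>l<p. d k (K + l) w)"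
        using dyadic_chain[of "\<lambda>u. X k u w" "\<lambda>l. d k l w", OF inc d0 j] by (simp only: q_def)
      then have "ennreal (norm (X k (q (K + p) j) w)) \<le> (\<Sum>i\<le>2 ^ K. ennreal (norm (X k (q K i) w))) + (\<Sum>l<p. ennreal (d k (K + l) w))"
        using d0 by (simp add: sum_nonneg ennreal_leI flip: ennreal_plus)
      also have "\<dots> \<le> (\<Sum>i\<le>2 ^ K. ennreal (norm (X k (q K i) w))) + (\<Sum>l. ennreal (d k (K + l) w))"
        by (intro add_left_mono sum_le_suminf) auto
      finally show ?thesis .
    qed
    show ?thesis
      unfolding Y_def
    proof (intro SUP_least)
      fix n j assume "j \<in> {..(2::nat) ^ n}"
      then have j: "j \<le> 2 ^ n" by simp
      show "ennreal (norm (X k (q n j) w)) \<le> (\<Sum>i\<le>2 ^ K. ennreal (norm (X k (q K i) w))) + (\<Sum>l. ennreal (d k (K + l) w))"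
      proof (cases "K \<le> n")
        case True
        then show ?thesis using dy[of j "n - K"] j by simp
      next
        case False
        have "q n j = q (K + 0) (j * 2 ^ (K - n))"
        proof -
          have "(2::real) ^ K = 2 ^ n * 2 ^ (K - n)" using False by (simp flip: power_add)
          then show ?thesis by (simp add: q_def)
        qed
        moreover have "j * 2 ^ (K - n) \<le> 2 ^ (K + 0)"
        proof -
          have "j * 2 ^ (K - n) \<le> 2 ^ n * 2 ^ (K - n)" using j by (intro mult_right_mono) auto
          also have "\<dots> = 2 ^ K" using False by (simp flip: power_add)
          finally show ?thesis by simp
        qed
        ultimately show ?thesis using dy[of "j * 2 ^ (K - n)" 0] by simp
      qed
    qed
  qed
  have intY: "(\<integral>\<^sup>+w. Y k w \<partial>M) \<le> (\<Sum>i\<le>2 ^ K. \<integral>\<^sup>+w. ennreal (norm (X k (q K i) w)) \<partial>M) + ennreal (10 * (1 + C) * r ^ K)" for k K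
  proof -
    have qm': "(\<lambda>w. ennreal (norm (X k (q K i) w))) \<in> borel_measurable M" if "i \<in> {..2 ^ K}" for i
      by (intro measurable_compose[OF _ measurable_ennreal] borel_measurable_norm qm) (use that in auto)
    have "(\<integral>\<^sup>+w. Y k w \<partial>M) \<le> (\<integral>\<^sup>+w. (\<Sum>i\<le>2 ^ K. ennreal (norm (X k (q K i) w))) + (\<Sum>l. ennreal (d k (K + l) w)) \<partial>M)"
      by (intro nn_integral_mono bound)
    also have "\<dots> = (\<integral>\<^sup>+w. (\<Sum>i\<le>2 ^ K. ennreal (norm (X k (q K i) w))) \<partial>M) + (\<integral>\<^sup>+w. (\<Sum>l. ennreal (d k (K + l) w)) \<partial>M)"
      by (intro nn_integral_add borel_measurable_sum qm') measurable
    also have "(\<integral>\<^sup>+w. (\<Sum>i\<le>2 ^ K. ennreal (norm (X k (q K i) w))) \<partial>M) = (\<Sum>i\<le>2 ^ K. \<integral>\<^sup>+w. ennreal (norm (X k (q K i) w)) \<partial>M)"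
      by (intro nn_integral_sum qm')
    also have "(\<integral>\<^sup>+w. (\<Sum>l. ennreal (d k (K + l) w)) \<partial>M) = (\<Sum>l. \<integral>\<^sup>+w. ennreal (d k (K + l) w) \<partial>M)"
      by (rule nn_integral_suminf) measurable
    also have "\<dots> \<le> (\<Sum>l. ennreal ((1 + C) * r ^ K * r ^ l))"
      by (intro suminf_le order_trans[OF intd]) (auto simp: power_add mult.assoc)
    also have "\<dots> = ennreal ((1 + C) * r ^ K * (1 / (1 - r)))"
    proof (rule suminf_ennreal_eq)
      show "(\<lambda>l. (1 + C) * r ^ K * r ^ l) sums ((1 + C) * r ^ K * (1 / (1 - r)))"
        by (intro sums_mult geometric_sums) (use r in auto)
    qed (use r C(1) in auto)
    also have "(1 + C) * r ^ K * (1 / (1 - r)) = 10 * (1 + C) * r ^ K" by (simp add: r_def)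
    finally show ?thesis by (simp add: add_left_mono)
  qed
  have "(\<lambda>k. \<integral>\<^sup>+w. Y k w \<partial>M) \<longlonglongrightarrow> 0"
  proof (rule ennreal_tendsto_0I)
    fix \<epsilon> :: real assume \<epsilon>: "\<epsilon> > 0"
    have "(\<lambda>K. 10 * (1 + C) * r ^ K) \<longlonglongrightarrow> 10 * (1 + C) * 0"
      by (intro tendsto_mult_left LIMSEQ_power_zero) (use r in auto)
    then have "\<forall>\<^sub>F K in sequentially. 10 * (1 + C) * r ^ K < \<epsilon> / 2"
      using \<epsilon> by (intro order_tendstoD(2)) auto
    then obtain K where K: "10 * (1 + C) * r ^ K < \<epsilon> / 2" by (auto simp: eventually_sequentially)
    have "(\<lambda>k. \<Sum>i\<le>2 ^ K. \<integral>\<^sup>+w. ennreal (norm (X k (q K i) w)) \<partial>M) \<longlonglongrightarrow> (\<Sum>i\<le>(2::nat) ^ K. 0)"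
      by (intro tendsto_sum pt q) auto
    then have "\<forall>\<^sub>F k in sequentially. (\<Sum>i\<le>2 ^ K. \<integral>\<^sup>+w. ennreal (norm (X k (q K i) w)) \<partial>M) < ennreal (\<epsilon> / 2)"
      using \<epsilon> by (intro order_tendstoD(2)) auto
    then show "\<forall>\<^sub>F k in sequentially. (\<integral>\<^sup>+w. Y k w \<partial>M) \<le> ennreal \<epsilon>"
    proof eventually_elim
      case (elim k)
      have "(\<integral>\<^sup>+w. Y k w \<partial>M) \<le> ennreal (\<epsilon> / 2) + ennreal (\<epsilon> / 2)"
        using K elim by (intro order_trans[OF intY[of k K]] add_mono ennreal_leI less_imp_le) auto
      also have "\<dots> = ennreal \<epsilon>" using \<epsilon> by (simp flip: ennreal_plus)
      finally show ?case .
    qed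
  qed
  with Ym YX show ?thesis by blast
qed

end

section \<open>Integrands of finite variation\<close>

lemma sigma_finite_Leb: "sigma_finite_measure (Leb L)"
proof
  show "\<exists>A. countable A \<and> A \<subseteq> sets (Leb L) \<and> \<Union> A = space (Leb L) \<and> (\<forall>a\<in>A. emeasure (Leb L) a \<noteq> \<infinity>)"
  proof (intro exI[of _ "range (\<lambda>n::nat. {0..real n} \<inter> horizon L)"] conjI ballI)
    show "range (\<lambda>n::nat. {0..real n} \<inter> horizon L) \<subseteq> sets (Leb L)"
      using borel_Int_horizon by auto
    show "\<Union> (range (\<lambda>n::nat. {0..real n} \<inter> horizon L)) = space (Leb L)"
      using real_arch_simple by (auto simp: horizon_def)
    fix a assume "a \<in> range (\<lambda>n::nat. {0..real n} \<inter> horizon L)"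
    then show "emeasure (Leb L) a \<noteq> \<infinity>" using emeasure_Leb_interval by (auto simp: less_top)
  qed auto
qed

lemma measurable_Leb_integral:
  fixes g :: "real \<times> 'w \<Rightarrow> complex"
  assumes h: "h \<in> borel_measurable (Leb L)" and g: "g \<in> borel_measurable (Leb L \<Otimes>\<^sub>M M)"
  shows "(\<lambda>w. LINT t|Leb L. h t * g (t, w)) \<in> borel_measurable M"
proof (rule sigma_finite_measure.borel_measurable_lebesgue_integral[OF sigma_finite_Leb])
  note [measurable] = h measurable_compose[OF measurable_pair_swap' g]
  have "(\<lambda>x. h (snd x) * (case x of (w, t) \<Rightarrow> g (t, w))) \<in> borel_measurable (M \<Otimes>\<^sub>M Leb L)"
    using measurable_compose[OF measurable_pair_swap' g] by (intro borel_measurable_times measurable_compose[OF measurable_snd h]) (simp add: case_prod_unfold)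
  then show "(\<lambda>(w, t). h t * g (t, w)) \<in> borel_measurable (M \<Otimes>\<^sub>M Leb L)"
    by (simp add: case_prod_unfold)
qed

text \<open>
  The finite variation processes without their normalization outside \<open>[0, L] \<times> \<Omega>\<close>, so that differences of such
  processes are again of this kind.
\<close>

definition finite_var :: "'w measure \<Rightarrow> ereal \<Rightarrow> (real \<times> 'w \<Rightarrow> real) \<Rightarrow> bool"
  where "finite_var M L c \<longleftrightarrow> c \<in> borel_measurable (Leb L \<Otimes>\<^sub>M M) \<and>
    (AE w in M. bounded_variation_on (horizon L) (\<lambda>t. c (t, w)))"

lemma fv_processes_finite_var: "a \<in> fv_processes M L \<Longrightarrow> finite_var M L a"
  by (simp add: fv_processes_def finite_var_def)

lemma bounded_variation_diff:
  assumes "bounded_variation_on H c" "bounded_variation_on H c'"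
  shows "bounded_variation_on H (\<lambda>t. c t - c' t)"
proof -
  from assms obtain C C' where C: "\<And>n (x :: nat \<Rightarrow> real). mono_on {..n} x \<Longrightarrow> x ` {..n} \<subseteq> H \<Longrightarrow>
       (\<Sum>i<n. \<bar>c (x (Suc i)) - c (x i)\<bar>) \<le> C"
    and C': "\<And>n (x :: nat \<Rightarrow> real). mono_on {..n} x \<Longrightarrow> x ` {..n} \<subseteq> H \<Longrightarrow>
       (\<Sum>i<n. \<bar>c' (x (Suc i)) - c' (x i)\<bar>) \<le> C'"
    unfolding bounded_variation_on_def by blast
  have "(\<Sum>i<n. \<bar>c (x (Suc i)) - c' (x (Suc i)) - (c (x i) - c' (x i))\<bar>) \<le> C + C'"
    if x: "mono_on {..n} x" "x ` {..n} \<subseteq> H" for n and x :: "nat \<Rightarrow> real"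
  proof -
    have "(\<Sum>i<n. \<bar>c (x (Suc i)) - c' (x (Suc i)) - (c (x i) - c' (x i))\<bar>)
      \<le> (\<Sum>i<n. \<bar>c (x (Suc i)) - c (x i)\<bar> + \<bar>c' (x (Suc i)) - c' (x i)\<bar>)"
      by (intro sum_mono) linarith
    also have "\<dots> \<le> C + C'" unfolding sum.distrib by (intro add_mono C C' x)
    finally show ?thesis .
  qed
  then show ?thesis unfolding bounded_variation_on_def by blast
qed

lemma finite_var_diff:
  assumes "finite_var M L c" "finite_var M L c'" shows "finite_var M L (\<lambda>x. c x - c' x)"
proof -
  have "AE w in M. bounded_variation_on (horizon L) (\<lambda>t. c (t, w) - c' (t, w))"
    using assms unfolding finite_var_def by (auto elim: eventually_elim2 intro: bounded_variation_diff)
  then show ?thesis using assms unfolding finite_var_def by auto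
qed

definition integrand :: "(real \<Rightarrow> complex) \<Rightarrow> (real \<times> 'w \<Rightarrow> real) \<Rightarrow> real \<times> 'w \<Rightarrow> complex"
  where "integrand f c = (\<lambda>(t, w). f t * complex_of_real (c (t, w)))"

lemma integrand_measurable:
  assumes f: "f \<in> sq_int (Leb L)" and c: "c \<in> borel_measurable (Leb L \<Otimes>\<^sub>M M)"
  shows "integrand f c \<in> borel_measurable (Leb L \<Otimes>\<^sub>M M)"
proof -
  note [measurable] = sq_intD(1)[OF f] c
  show ?thesis unfolding integrand_def case_prod_unfold by measurable
qed

lemma bv_product_sq_int:
  assumes f: "f \<in> sq_int (Leb L)" and c: "finite_var M L c" and L: "0 < L"
  shows "AE w in M. (\<lambda>t. f t * complex_of_real (c (t, w))) \<in> sq_int (Leb L)"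
proof -
  have "AE w in M. bounded_variation_on (horizon L) (\<lambda>t. c (t, w))" using c by (simp add: finite_var_def)
  then show ?thesis using AE_space
  proof eventually_elim
    case (elim w)
    then obtain K where K: "\<forall>t\<in>horizon L. \<bar>c (t, w)\<bar> \<le> K"
      using bounded_variation_bounded[OF _ L] by blast
    have "(\<lambda>t. c (t, w)) \<in> borel_measurable (Leb L)"
      using c elim(2) by (auto simp: finite_var_def intro: measurable_compose[OF measurable_Pair2'])
    then show ?case by (intro sq_int_mult_bounded[OF f, of _ K]) (use K in auto)
  qed
qed

lemma integrand_L0_L2:
  assumes f: "f \<in> sq_int (Leb L)" and c: "finite_var M L c" and L: "0 < L"
  shows "integrand f c \<in> L0_L2 M L"
  using integrand_measurable[OF f, of c M] bv_product_sq_int[OF assms] c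
  by (simp add: L0_L2_def L2_eq finite_var_def integrand_def)

text \<open>
  For real \<open>\<phi>\<^sub>m\<close> the real and the imaginary part of \<open>\<langle>\<phi>\<^sub>m, f\<rangle>\<close> are the coefficients of the real and the imaginary
  part of \<open>f\<close>.  Hence a complete system of the real space is also complete in the complex space.
\<close>

lemma complete_ons_of_real:
  assumes \<phi>: "is_CONS L (L2_real L) \<phi>"
  shows "orthonormal (Leb L) \<phi>" "\<And>f. f \<in> sq_int (Leb L) \<Longrightarrow> (\<And>m. inner_prod (Leb L) (\<phi> m) f = 0) \<Longrightarrow> AE t in Leb L. f t = 0"
proof -
  show o: "orthonormal (Leb L) \<phi>"
    using \<phi> by (simp add: is_CONS_def orthonormal_def L2_real_def L2_eq L2_inner_eq)
  fix f assume f: "f \<in> sq_int (Leb L)" and z: "\<And>m. inner_prod (Leb L) (\<phi> m) f = 0"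
  note [measurable] = sq_intD(1)[OF f]
  let ?r = "\<lambda>t. complex_of_real (Re (f t))" and ?i = "\<lambda>t. complex_of_real (Im (f t))"
  have ri: "g \<in> L2_real L" if g: "g = ?r \<or> g = ?i" for g
  proof -
    have m: "g \<in> borel_measurable (Leb L)" using g by auto
    have "norm (g t) \<le> norm (f t)" for t using g abs_Re_le_cmod[of "f t"] abs_Im_le_cmod[of "f t"] by auto
    then have "integrable (Leb L) (\<lambda>t. (norm (g t))\<^sup>2)"
      by (intro Bochner_Integration.integrable_bound[OF sq_intD(2)[OF f]]) (use m in \<open>auto intro!: power_mono\<close>)
    then show ?thesis using m g by (auto simp: L2_real_def L2_def)
  qed
  then have s: "?r \<in> sq_int (Leb L)" "?i \<in> sq_int (Leb L)" by (simp_all add: L2_real_def L2_eq)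
  have real: "inner_prod (Leb L) (\<phi> m) (\<lambda>t. complex_of_real (g t)) \<in> \<real>" for m g
  proof -
    have "\<phi> m t \<in> \<real>" for t using \<phi> by (simp add: is_CONS_def L2_real_def)
    then have "cnj (\<phi> m t) * complex_of_real (g t) = complex_of_real (Re (\<phi> m t) * g t)" for t
      by (simp add: complex_eq_iff complex_is_Real_iff)
    then show ?thesis unfolding inner_prod_def by (simp only: integral_complex_of_real Reals_of_real)
  qed
  have both: "inner_prod (Leb L) (\<phi> m) ?r = 0 \<and> inner_prod (Leb L) (\<phi> m) ?i = 0" for m
  proof -
    have "0 = inner_prod (Leb L) (\<phi> m) (\<lambda>t. ?r t + \<i> * ?i t)" using z[of m] by (simp flip: complex_eq)
    also have "\<dots> = inner_prod (Leb L) (\<phi> m) ?r + \<i> * inner_prod (Leb L) (\<phi> m) ?i"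
      by (simp add: inner_prod_add inner_prod_scale orthonormal_sq_int[OF o] s sq_int_scale)
    finally show ?thesis using real[of m "\<lambda>t. Re (f t)"] real[of m "\<lambda>t. Im (f t)"]
      by (auto simp: complex_eq_iff complex_is_Real_iff)
  qed
  have "AE t in Leb L. g t = 0" if "g = ?r \<or> g = ?i" for g
    using \<phi> ri[OF that] both that unfolding is_CONS_def L2_inner_eq by blast
  then have "AE t in Leb L. ?r t = 0" "AE t in Leb L. ?i t = 0" by blast+
  then show "AE t in Leb L. f t = 0" by eventually_elim (simp add: complex_eq_iff)
qed

section \<open>Uniform convergence of the Ogawa sums\<close>

context brownian
begin

abbreviation W :: "(real \<Rightarrow> complex) \<Rightarrow> 'w \<Rightarrow> complex" where "W \<equiv> wiener_integral M B L"

text \<open>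
  A version of the Wiener integral of the projection of \<open>h\<close> to the span of the first \<open>n\<close> members of \<open>\<phi>\<close>.  In
  this form it is defined for every \<open>w\<close> and continuous in \<open>h\<close>, and \<open>h\<close> may itself depend on \<open>w\<close>; with
  \<open>h = f c(\<sqdot>, w)\<close> it becomes the partial sum of the Ogawa integral.
\<close>

definition wiener_proj :: "(nat \<Rightarrow> real \<Rightarrow> complex) \<Rightarrow> nat \<Rightarrow> (real \<Rightarrow> complex) \<Rightarrow> 'w \<Rightarrow> complex"
  where "wiener_proj \<phi> n h w = (\<Sum>m<n. inner_prod (Leb L) (\<phi> m) h * W (\<phi> m) w)"

definition ogawa_sum :: "(nat \<Rightarrow> real \<Rightarrow> complex) \<Rightarrow> nat \<Rightarrow> (real \<Rightarrow> complex) \<Rightarrow> (real \<times> 'w \<Rightarrow> real) \<Rightarrow> 'w \<Rightarrow> complex"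
  where "ogawa_sum \<phi> n f c w = wiener_proj \<phi> n (\<lambda>t. f t * complex_of_real (c (t, w))) w"

lemma W_measurable: "g \<in> sq_int (Leb L) \<Longrightarrow> W g \<in> borel_measurable M"
  using wiener_integralI[of g] by (simp add: has_wiener_integral_def)

lemma wiener_proj_measurable: "orthonormal (Leb L) \<phi> \<Longrightarrow> wiener_proj \<phi> n h \<in> borel_measurable M"
  unfolding wiener_proj_def[abs_def]
  by (intro borel_measurable_sum borel_measurable_times borel_measurable_const W_measurable orthonormal_sq_int)

lemma ogawa_sum_measurable:
  assumes o: "orthonormal (Leb L) \<phi>" and f: "f \<in> sq_int (Leb L)" and c: "finite_var M L c"
  shows "ogawa_sum \<phi> n f c \<in> borel_measurable M"
proof -
  have "(\<lambda>w. LINT t|Leb L. cnj (\<phi> m t) * integrand f c (t, w)) \<in> borel_measurable M" for m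
    by (rule measurable_Leb_integral)
      (use c in \<open>auto simp: finite_var_def intro: integrand_measurable[OF f] borel_measurable_cnj sq_intD(1)[OF orthonormal_sq_int[OF o]]\<close>)
  then have "(\<lambda>w. inner_prod (Leb L) (\<phi> m) (\<lambda>t. f t * complex_of_real (c (t, w)))) \<in> borel_measurable M" for m
    by (simp add: inner_prod_def integrand_def)
  then show ?thesis
    unfolding ogawa_sum_def[abs_def] wiener_proj_def
    by (intro borel_measurable_sum borel_measurable_times W_measurable orthonormal_sq_int[OF o])
qed

lemma wiener_proj_diff:
  assumes "orthonormal (Leb L) \<phi>" "g \<in> sq_int (Leb L)" "h \<in> sq_int (Leb L)"
  shows "wiener_proj \<phi> n (\<lambda>t. g t - h t) w = wiener_proj \<phi> n g w - wiener_proj \<phi> n h w"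
  unfolding wiener_proj_def using assms
  by (simp add: inner_prod_diff orthonormal_sq_int left_diff_distrib sum_subtractf)

lemma wiener_proj_add:
  assumes "orthonormal (Leb L) \<phi>" "g \<in> sq_int (Leb L)" "h \<in> sq_int (Leb L)"
  shows "wiener_proj \<phi> n (\<lambda>t. g t + h t) w = wiener_proj \<phi> n g w + wiener_proj \<phi> n h w"
  unfolding wiener_proj_def using assms
  by (simp add: inner_prod_add orthonormal_sq_int distrib_right sum.distrib)

lemma wiener_proj_scale: "wiener_proj \<phi> n (\<lambda>t. a * g t) w = a * wiener_proj \<phi> n g w"
  unfolding wiener_proj_def by (simp add: inner_prod_scale sum_distrib_left mult.assoc)

lemma wiener_proj_wiener:
  assumes o: "orthonormal (Leb L) \<phi>"
  shows "has_wiener_integral M B L (ons_proj (Leb L) \<phi> n h) (wiener_proj \<phi> n h)"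
  unfolding ons_proj_def[abs_def] wiener_proj_def[abs_def]
  by (intro has_wiener_integral_sum has_wiener_integral_scale wiener_integralI sq_int_scale orthonormal_sq_int[OF o] finite_lessThan)

lemma wiener_proj_diff_fourth_moment:
  assumes o: "orthonormal (Leb L) \<phi>" "orthonormal (Leb L) \<psi>"
  shows "(\<integral>\<^sup>+w. ennreal ((norm (wiener_proj \<phi> n h w - wiener_proj \<psi> m h w)) ^ 4) \<partial>M)
    \<le> ennreal (24 * (sq_norm (Leb L) (\<lambda>x. ons_proj (Leb L) \<phi> n h x - ons_proj (Leb L) \<psi> m h x))\<^sup>2)"
proof -
  have "has_wiener_integral M B L (\<lambda>x. ons_proj (Leb L) \<phi> n h x + (- 1) * ons_proj (Leb L) \<psi> m h x) (\<lambda>w. wiener_proj \<phi> n h w + (- 1) * wiener_proj \<psi> m h w)"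
    by (intro has_wiener_integral_add has_wiener_integral_scale wiener_proj_wiener ons_proj_sq_int sq_int_scale o)
  then have "has_wiener_integral M B L (\<lambda>x. ons_proj (Leb L) \<phi> n h x - ons_proj (Leb L) \<psi> m h x) (\<lambda>w. wiener_proj \<phi> n h w - wiener_proj \<psi> m h w)"
    by simp
  then show ?thesis by (rule has_wiener_integral_fourth_moment) (intro sq_int_diff ons_proj_sq_int o)
qed

lemma sq_norm_proj_diff_le:
  assumes o: "orthonormal (Leb L) \<phi>" "orthonormal (Leb L) \<psi>" and h: "h \<in> sq_int (Leb L)"
  shows "sq_norm (Leb L) (\<lambda>x. ons_proj (Leb L) \<phi> n h x - ons_proj (Leb L) \<psi> m h x) \<le> 4 * sq_norm (Leb L) h"
proof -
  have "sq_norm (Leb L) (\<lambda>x. ons_proj (Leb L) \<phi> n h x - ons_proj (Leb L) \<psi> m h x)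
     \<le> 2 * sq_norm (Leb L) (ons_proj (Leb L) \<phi> n h) + 2 * sq_norm (Leb L) (ons_proj (Leb L) \<psi> m h)"
    by (intro sq_norm_diff_le ons_proj_sq_int o)
  also have "\<dots> \<le> 2 * sq_norm (Leb L) h + 2 * sq_norm (Leb L) h"
    by (intro add_mono mult_left_mono) (auto simp: sq_norm_proj o bessel h)
  finally show ?thesis by simp
qed

lemma wiener_proj_quantile_set_continuous:
  assumes o: "orthonormal (Leb L) \<phi>" and f: "f \<in> sq_int (Leb L)"
  shows "continuous_on {0..1} (\<lambda>u. wiener_proj \<phi> n (\<lambda>t. f t * indicator (quantile_set L f u) t) w)"
  unfolding wiener_proj_def
  by (intro continuous_on_sum continuous_on_mult continuous_on_const inner_prod_quantile_set_continuous f orthonormal_sq_int[OF o])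

text \<open>
  The central estimate.  Let \<open>\<theta>\<close> be the random function \<open>\<Sum> cnj \<phi>\<^sub>i B\<^sub>L[\<phi>\<^sub>i] - \<Sum> cnj \<psi>\<^sub>i B\<^sub>L[\<psi>\<^sub>i]\<close>.  The difference
  of the sums is \<open>\<integral> \<theta> f\<^sub>k c d\<lambda>\<close>, and its bound in terms of the initial segments involves only the processes
  \<open>X\<^sub>k(u) = \<integral> \<theta> f\<^sub>k 1\<^sub>A d\<lambda>\<close>, where \<open>A\<close> is the quantile set for \<open>u\<close>.  They are Wiener integrals of differences
  of projections of \<open>f\<^sub>k 1\<^sub>A\<close>, and chaining applies to them.
\<close>

lemma ogawa_sum_diff_tendsto_0:
  assumes o: "orthonormal (Leb L) \<phi>" "orthonormal (Leb L) \<psi>"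
    and f: "\<And>k. f k \<in> sq_int (Leb L)" and E: "\<And>k. sq_norm (Leb L) (f k) \<le> E"
    and c: "finite_var M L c"
    and lim: "\<And>u. u \<in> {0..1} \<Longrightarrow> (\<lambda>k. sq_norm (Leb L) (\<lambda>x.
        ons_proj (Leb L) \<phi> (n k) (\<lambda>t. f k t * indicator (quantile_set L (f k) u) t) x -
        ons_proj (Leb L) \<psi> (m k) (\<lambda>t. f k t * indicator (quantile_set L (f k) u) t) x)) \<longlonglongrightarrow> 0"
  shows "tendsto_in_prob M (\<lambda>k w. ogawa_sum \<phi> (n k) (f k) c w - ogawa_sum \<psi> (m k) (f k) c w) (\<lambda>_. 0)"
proof -
  define g where "g k u t = f k t * indicator (quantile_set L (f k) u) t" for k u t
  have g: "g k u \<in> sq_int (Leb L)" if "u \<in> {0..1}" for k u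
    unfolding g_def by (intro sq_int_indicator f initial_segment_sets quantile_set that)
  define X where "X k u w = wiener_proj \<phi> (n k) (g k u) w - wiener_proj \<psi> (m k) (g k u) w" for k u w
  let ?Q = "\<lambda>k h x. ons_proj (Leb L) \<phi> (n k) h x - ons_proj (Leb L) \<psi> (m k) h x"
  have Xm [measurable]: "X k u \<in> borel_measurable M" for k u
    unfolding X_def by (intro borel_measurable_diff wiener_proj_measurable o)
  have "\<exists>Y. (\<forall>k. Y k \<in> borel_measurable M) \<and>
     (\<forall>k. \<forall>w\<in>space M. \<forall>u\<in>{0..1}. ennreal (norm (X k u w)) \<le> Y k w) \<and>
     (\<lambda>k. \<integral>\<^sup>+w. Y k w \<partial>M) \<longlonglongrightarrow> 0"
  proof (rule chaining_limit)
    show "X k u \<in> borel_measurable M" for k u by (rule Xm)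
    show "continuous_on {0..1} (\<lambda>u. X k u w)" for k w
      unfolding X_def g_def by (intro continuous_on_diff wiener_proj_quantile_set_continuous o f)
    show "0 \<le> 24 * (4 * E)\<^sup>2" by simp
  next
    fix k :: nat and u v :: real assume u: "u \<in> {0..1}" and v: "v \<in> {0..1}"
    let ?h = "\<lambda>t. g k u t - g k v t"
    have h: "?h \<in> sq_int (Leb L)" by (intro sq_int_diff g u v)
    have "X k u w - X k v w = wiener_proj \<phi> (n k) ?h w - wiener_proj \<psi> (m k) ?h w" for w
      unfolding X_def wiener_proj_diff[OF o(1) g[OF u] g[OF v]] wiener_proj_diff[OF o(2) g[OF u] g[OF v]] by simp
    then have "(\<integral>\<^sup>+w. ennreal ((norm (X k u w - X k v w)) ^ 4) \<partial>M) \<le> ennreal (24 * (sq_norm (Leb L) (?Q k ?h))\<^sup>2)"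
      using wiener_proj_diff_fourth_moment[OF o, of "n k" ?h "m k"] by simp
    also have "\<dots> \<le> ennreal (24 * (4 * E)\<^sup>2 * (u - v)\<^sup>2)"
    proof (rule ennreal_leI)
      have "sq_norm (Leb L) (?Q k ?h) \<le> 4 * sq_norm (Leb L) ?h" by (rule sq_norm_proj_diff_le[OF o h])
      also have "sq_norm (Leb L) ?h = \<bar>u - v\<bar> * sq_norm (Leb L) (f k)"
        unfolding g_def by (rule quantile_set_increment[OF f u v])
      also have "4 * (\<bar>u - v\<bar> * sq_norm (Leb L) (f k)) \<le> 4 * (\<bar>u - v\<bar> * E)"
        by (intro mult_left_mono E) auto
      finally have "(sq_norm (Leb L) (?Q k ?h))\<^sup>2 \<le> (4 * (\<bar>u - v\<bar> * E))\<^sup>2" by (intro power_mono) auto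
      then show "24 * (sq_norm (Leb L) (?Q k ?h))\<^sup>2 \<le> 24 * (4 * E)\<^sup>2 * (u - v)\<^sup>2"
        by (simp add: power_mult_distrib mult.commute[of "E\<^sup>2"])
    qed
    finally show "(\<integral>\<^sup>+w. ennreal ((norm (X k u w - X k v w)) ^ 4) \<partial>M) \<le> ennreal (24 * (4 * E)\<^sup>2 * (u - v)\<^sup>2)" .
  next
    fix u :: real assume u: "u \<in> {0..1}"
    show "(\<lambda>k. \<integral>\<^sup>+w. ennreal (norm (X k u w)) \<partial>M) \<longlonglongrightarrow> 0"
    proof (rule ennreal_tendsto_0I)
      fix \<epsilon> :: real assume \<epsilon>: "\<epsilon> > 0"
      let ?s = "\<lambda>k. sq_norm (Leb L) (?Q k (g k u))" and ?r = "\<epsilon> / 2"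
      have r: "0 < ?r" using \<epsilon> by simp
      have b: "(\<integral>\<^sup>+w. ennreal (norm (X k u w)) \<partial>M) \<le> ennreal (?r + 1 / ?r ^ 3 * (24 * (?s k)\<^sup>2))" for k
      proof -
        have "(\<integral>\<^sup>+w. ennreal (norm (X k u w)) \<partial>M) \<le> (\<integral>\<^sup>+w. ennreal ?r + ennreal (1 / ?r ^ 3) * ennreal ((norm (X k u w)) ^ 4) \<partial>M)"
        proof (rule nn_integral_mono)
          fix w
          have "norm (X k u w) \<le> ?r + (norm (X k u w)) ^ 4 / ?r ^ 3"
            by (rule le_plus_fourth_power[OF r norm_ge_zero])
          then have "ennreal (norm (X k u w)) \<le> ennreal (?r + 1 / ?r ^ 3 * (norm (X k u w)) ^ 4)"
            by (intro ennreal_leI) simp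
          also have "\<dots> = ennreal ?r + ennreal (1 / ?r ^ 3) * ennreal ((norm (X k u w)) ^ 4)"
            using r by (simp flip: ennreal_mult ennreal_plus)
          finally show "ennreal (norm (X k u w)) \<le> \<dots>" .
        qed
        also have "\<dots> = ennreal ?r + ennreal (1 / ?r ^ 3) * (\<integral>\<^sup>+w. ennreal ((norm (X k u w)) ^ 4) \<partial>M)"
          by (subst nn_integral_add, simp, simp, subst nn_integral_cmult) (auto simp: emeasure_space_1)
        also have "\<dots> \<le> ennreal ?r + ennreal (1 / ?r ^ 3) * ennreal (24 * (?s k)\<^sup>2)"
          unfolding X_def by (intro add_left_mono mult_left_mono wiener_proj_diff_fourth_moment o) auto
        also have "\<dots> = ennreal (?r + 1 / ?r ^ 3 * (24 * (?s k)\<^sup>2))"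
          using r by (simp flip: ennreal_mult ennreal_plus)
        finally show ?thesis .
      qed
      have "(\<lambda>k. ?r + 1 / ?r ^ 3 * (24 * (?s k)\<^sup>2)) \<longlonglongrightarrow> ?r + 1 / ?r ^ 3 * (24 * 0\<^sup>2)"
        using lim[OF u] unfolding g_def by (intro tendsto_add tendsto_mult tendsto_const tendsto_power)
      then have "\<forall>\<^sub>F k in sequentially. ?r + 1 / ?r ^ 3 * (24 * (?s k)\<^sup>2) < \<epsilon>"
        by (rule order_tendstoD(2)) (use \<epsilon> in simp)
      then show "\<forall>\<^sub>F k in sequentially. (\<integral>\<^sup>+w. ennreal (norm (X k u w)) \<partial>M) \<le> ennreal \<epsilon>"
      proof eventually_elim
        case (elim k)
        show ?case by (rule order_trans[OF b ennreal_leI]) (use elim in simp)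
      qed
    qed
  qed
  then obtain Y where Ym: "\<And>k. Y k \<in> borel_measurable M"
    and Y: "\<And>k w u. w \<in> space M \<Longrightarrow> u \<in> {0..1} \<Longrightarrow> ennreal (norm (X k u w)) \<le> Y k w"
    and Y0: "(\<lambda>k. \<integral>\<^sup>+w. Y k w \<partial>M) \<longlonglongrightarrow> 0" by blast
  show ?thesis
  proof (rule in_prob_of_bound[OF _ Ym Y0])
    show "(\<lambda>w. ogawa_sum \<phi> (n k) (f k) c w - ogawa_sum \<psi> (m k) (f k) c w) \<in> borel_measurable M" for k
      by (intro borel_measurable_diff ogawa_sum_measurable o f c)
    have "AE w in M. bounded_variation_on (horizon L) (\<lambda>t. c (t, w))" using c by (simp add: finite_var_def)
    moreover have "AE w in M. \<forall>k. (\<lambda>t. f k t * complex_of_real (c (t, w))) \<in> sq_int (Leb L)"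
      unfolding AE_all_countable using bv_product_sq_int[OF f c L_pos] by simp
    ultimately show "AE w in M. \<exists>K::real. \<forall>k. ennreal (norm (ogawa_sum \<phi> (n k) (f k) c w - ogawa_sum \<psi> (m k) (f k) c w)) \<le> ennreal K * Y k w"
      using AE_space
    proof eventually_elim
      case (elim w)
      from bounded_variation_integral_bound[OF elim(1) L_pos] obtain K where
        K: "\<And>\<psi> D. integrable (Leb L) \<psi> \<Longrightarrow> (\<And>A. initial_segment L A \<Longrightarrow> norm (LINT t|Leb L. \<psi> t * indicator A t) \<le> D) \<Longrightarrow>
           norm (LINT t|Leb L. \<psi> t * complex_of_real (c (t, w))) \<le> K * D" by blast
      have "ennreal (norm (ogawa_sum \<phi> (n k) (f k) c w - ogawa_sum \<psi> (m k) (f k) c w)) \<le> ennreal (max K 1) * Y k w" for k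
      proof (cases "Y k w")
        case (real D)
        \<comment> \<open>The coefficients are conjugated twice in order to write \<open>\<theta>\<close> as the conjugate of a function in \<open>L\<^sup>2\<close>, so that
          integration against \<open>\<theta>\<close> is an inner product.\<close>
        define \<theta> where "\<theta> t = cnj (\<Sum>i<n k. cnj (W (\<phi> i) w) * \<phi> i t) - cnj (\<Sum>i<m k. cnj (W (\<psi> i) w) * \<psi> i t)" for t
        let ?a = "\<lambda>t. \<Sum>i<n k. cnj (W (\<phi> i) w) * \<phi> i t" and ?b = "\<lambda>t. \<Sum>i<m k. cnj (W (\<psi> i) w) * \<psi> i t"
        have ab: "?a \<in> sq_int (Leb L)" "?b \<in> sq_int (Leb L)" by (intro sq_int_sum sq_int_scale orthonormal_sq_int o)+
        have \<theta>h: "(LINT t|Leb L. \<theta> t * h t) = wiener_proj \<phi> (n k) h w - wiener_proj \<psi> (m k) h w"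
          and \<theta>i: "integrable (Leb L) (\<lambda>t. \<theta> t * h t)" if h: "h \<in> sq_int (Leb L)" for h
        proof -
          have *: "inner_prod (Leb L) (\<lambda>t. \<Sum>i<N. cnj (W (\<eta> i) w) * \<eta> i t) h = wiener_proj \<eta> N h w" if "orthonormal (Leb L) \<eta>" for \<eta> N
          proof -
            have "inner_prod (Leb L) (\<lambda>t. \<Sum>i<N. cnj (W (\<eta> i) w) * \<eta> i t) h = cnj (inner_prod (Leb L) h (\<lambda>t. \<Sum>i<N. cnj (W (\<eta> i) w) * \<eta> i t))"
              by (simp only: inner_prod_commute)
            also have "\<dots> = cnj (\<Sum>i<N. cnj (W (\<eta> i) w) * inner_prod (Leb L) h (\<eta> i))"
              using that h by (subst inner_prod_sum) (auto intro: sq_int_scale orthonormal_sq_int simp: inner_prod_scale)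
            also have "\<dots> = wiener_proj \<eta> N h w"
              unfolding wiener_proj_def by (simp add: inner_prod_commute mult.commute)
            finally show ?thesis .
          qed
          have e: "\<theta> t * h t = cnj (?a t) * h t - cnj (?b t) * h t" for t
            by (simp add: \<theta>_def left_diff_distrib)
          show "integrable (Leb L) (\<lambda>t. \<theta> t * h t)"
            unfolding e by (intro Bochner_Integration.integrable_diff inner_prod_integrable ab h)
          have "(LINT t|Leb L. \<theta> t * h t) = inner_prod (Leb L) ?a h - inner_prod (Leb L) ?b h"
            unfolding e inner_prod_def by (intro Bochner_Integration.integral_diff inner_prod_integrable ab h)
          then show "(LINT t|Leb L. \<theta> t * h t) = wiener_proj \<phi> (n k) h w - wiener_proj \<psi> (m k) h w"
            by (simp only: * o)
        qed
        have "norm (LINT t|Leb L. (\<theta> t * f k t) * complex_of_real (c (t, w))) \<le> K * D"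
        proof (rule K)
          show "integrable (Leb L) (\<lambda>t. \<theta> t * f k t)" by (rule \<theta>i[OF f])
          fix A assume A: "initial_segment L A"
          have fA: "(\<lambda>t. f k t * indicator A t) \<in> sq_int (Leb L)" by (intro sq_int_indicator f initial_segment_sets A)
          from initial_segment_is_quantile_set[OF f A, of k] obtain u where u: "u \<in> {0..1}"
            and eq: "\<And>h. h \<in> sq_int (Leb L) \<Longrightarrow> inner_prod (Leb L) h (\<lambda>t. f k t * indicator A t) = inner_prod (Leb L) h (g k u)"
            unfolding g_def by blast
          have "(LINT t|Leb L. \<theta> t * f k t * indicator A t) = X k u w"
            unfolding X_def mult.assoc \<theta>h[OF fA] wiener_proj_def by (simp add: eq orthonormal_sq_int[OF o(1)] orthonormal_sq_int[OF o(2)])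
          moreover have "ennreal (norm (X k u w)) \<le> ennreal D" using Y[OF elim(3) u, of k] real by simp
          ultimately show "norm (LINT t|Leb L. \<theta> t * f k t * indicator A t) \<le> D" using real by simp
        qed
        also have "(LINT t|Leb L. (\<theta> t * f k t) * complex_of_real (c (t, w))) = ogawa_sum \<phi> (n k) (f k) c w - ogawa_sum \<psi> (m k) (f k) c w"
          unfolding ogawa_sum_def mult.assoc by (rule \<theta>h) (use elim(2) in auto)
        also have "K * D \<le> max K 1 * D" using real by (intro mult_right_mono) auto
        finally show ?thesis using real by (simp add: ennreal_leI flip: ennreal_mult)
      next
        case top
        then show ?thesis by (simp add: ennreal_mult_top)
      qed
      then show ?case by blast
    qed
  qed
qed

end

section \<open>Functions with vanishing u-integral\<close>

definition complete_ons :: "'a measure \<Rightarrow> (nat \<Rightarrow> 'a \<Rightarrow> complex) \<Rightarrow> bool"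
  where "complete_ons N \<phi> \<longleftrightarrow> orthonormal N \<phi> \<and> (\<forall>f\<in>sq_int N. (\<forall>m. inner_prod N (\<phi> m) f = 0) \<longrightarrow> (AE x in N. f x = 0))"

lemma complete_onsD: "complete_ons N \<phi> \<Longrightarrow> orthonormal N \<phi>"
  by (simp add: complete_ons_def)

lemma complete_ons_proj_tendsto:
  "complete_ons N \<phi> \<Longrightarrow> g \<in> sq_int N \<Longrightarrow> (\<lambda>n. sq_norm N (\<lambda>x. g x - ons_proj N \<phi> n g x)) \<longlonglongrightarrow> 0"
  by (rule complete_ons_expansion) (auto simp: complete_ons_def)

lemma is_CONS_complex: "is_CONS L (L2 L) \<phi> \<longleftrightarrow> complete_ons (Leb L) \<phi>"
  by (auto simp: is_CONS_def complete_ons_def orthonormal_def L2_eq L2_inner_eq)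

lemma is_CONS_real: "is_CONS L (L2_real L) \<phi> \<Longrightarrow> complete_ons (Leb L) \<phi>"
  using complete_ons_of_real unfolding complete_ons_def by blast

lemma complete_ons_cnj:
  assumes "complete_ons N \<phi>" shows "complete_ons N (\<lambda>m x. cnj (\<phi> m x))"
proof -
  have inner_prod: "inner_prod N (\<lambda>x. cnj (f x)) (\<lambda>x. cnj (g x)) = cnj (inner_prod N f g)" for f g
  proof -
    have "(LINT x|N. cnj (cnj (f x) * g x)) = cnj (LINT x|N. cnj (f x) * g x)"
      by (rule Bochner_Integration.integral_cnj)
    then show ?thesis by (simp add: inner_prod_def)
  qed
  have "AE x in N. f x = 0" if f: "f \<in> sq_int N" and z: "\<forall>m. inner_prod N (\<lambda>x. cnj (\<phi> m x)) f = 0" for f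
  proof -
    have "inner_prod N (\<phi> m) (\<lambda>x. cnj (f x)) = 0" for m
      using z inner_prod[of "\<phi> m" "\<lambda>x. cnj (f x)"] by simp
    with assms sq_int_cnj[OF f] have "AE x in N. cnj (f x) = 0" unfolding complete_ons_def by blast
    then show ?thesis by simp
  qed
  then show ?thesis using assms by (auto simp: complete_ons_def orthonormal_def inner_prod sq_int_cnj)
qed

lemma tendsto_compose_ge:
  fixes a :: "nat \<Rightarrow> real"
  assumes "a \<longlonglongrightarrow> l" "\<And>k. k \<le> n k" shows "(\<lambda>k. a (n k)) \<longlonglongrightarrow> l"
proof (rule filterlim_compose[OF assms(1)])
  show "filterlim n sequentially sequentially"
    by (rule filterlim_at_top_mono[OF filterlim_ident]) (use assms(2) in simp)
qed

lemma in_prob_compose_ge: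
  assumes "tendsto_in_prob M X Z" "\<And>k. k \<le> n k" shows "tendsto_in_prob M (\<lambda>k. X (n k)) Z"
  unfolding tendsto_in_prob_def
proof (intro allI impI)
  fix \<epsilon> :: real assume "\<epsilon> > 0"
  with assms(1) have "(\<lambda>k. measure M {w \<in> space M. norm (X k w - Z w) > \<epsilon>}) \<longlonglongrightarrow> 0"
    by (simp add: tendsto_in_prob_def)
  from tendsto_compose_ge[OF this, of n] assms(2)
  show "(\<lambda>k. measure M {w \<in> space M. norm (X (n k) w - Z w) > \<epsilon>}) \<longlonglongrightarrow> 0" by simp
qed

context brownian
begin

lemma ogawa_sum_zero [simp]: "ogawa_sum \<psi> 0 f c w = 0"
  by (simp add: ogawa_sum_def wiener_proj_def)

text \<open>
  With \<open>f\<close> fixed, both projections of \<open>f 1\<^sub>A\<close> converge to \<open>f 1\<^sub>A\<close>.  Equal systems give the Cauchy property of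
  the Ogawa sums, different ones the independence of their limit of the system.
\<close>

lemma ogawa_sum_cons_diff_tendsto_0:
  assumes \<phi>: "complete_ons (Leb L) \<phi>" and \<psi>: "complete_ons (Leb L) \<psi>" and f: "f \<in> sq_int (Leb L)" and c: "finite_var M L c"
    and n: "\<And>k. k \<le> n k" and m: "\<And>k. k \<le> m k"
  shows "tendsto_in_prob M (\<lambda>k w. ogawa_sum \<phi> (n k) f c w - ogawa_sum \<psi> (m k) f c w) (\<lambda>_. 0)"
proof (rule ogawa_sum_diff_tendsto_0[where f = "\<lambda>_. f", OF complete_onsD[OF \<phi>] complete_onsD[OF \<psi>] f order_refl c])
  fix u :: real assume "u \<in> {0..1}"
  define g where "g = (\<lambda>t. f t * indicator (quantile_set L f u) t)"
  have g: "g \<in> sq_int (Leb L)"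
    unfolding g_def by (intro sq_int_indicator f initial_segment_sets quantile_set \<open>u \<in> {0..1}\<close>)
  let ?p = "\<lambda>k. sq_norm (Leb L) (\<lambda>x. g x - ons_proj (Leb L) \<phi> (n k) g x)"
  let ?q = "\<lambda>k. sq_norm (Leb L) (\<lambda>x. g x - ons_proj (Leb L) \<psi> (m k) g x)"
  have le: "sq_norm (Leb L) (\<lambda>x. ons_proj (Leb L) \<phi> (n k) g x - ons_proj (Leb L) \<psi> (m k) g x) \<le> 2 * ?q k + 2 * ?p k" for k
  proof -
    have "sq_norm (Leb L) (\<lambda>x. (g x - ons_proj (Leb L) \<psi> (m k) g x) - (g x - ons_proj (Leb L) \<phi> (n k) g x)) \<le> 2 * ?q k + 2 * ?p k"
      by (intro sq_norm_diff_le sq_int_diff g ons_proj_sq_int complete_onsD \<phi> \<psi>)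
    then show ?thesis by simp
  qed
  have "?p \<longlonglongrightarrow> 0" "?q \<longlonglongrightarrow> 0"
    using tendsto_compose_ge[OF complete_ons_proj_tendsto[OF \<phi> g] n] tendsto_compose_ge[OF complete_ons_proj_tendsto[OF \<psi> g] m] by simp_all
  then have "(\<lambda>k. 2 * ?q k + 2 * ?p k) \<longlonglongrightarrow> 2 * 0 + 2 * 0" by (intro tendsto_intros)
  then have lim: "(\<lambda>k. 2 * ?q k + 2 * ?p k) \<longlonglongrightarrow> 0" by simp
  show "(\<lambda>k. sq_norm (Leb L) (\<lambda>x. ons_proj (Leb L) \<phi> (n k) (\<lambda>t. f t * indicator (quantile_set L f u) t) x -
        ons_proj (Leb L) \<psi> (m k) (\<lambda>t. f t * indicator (quantile_set L f u) t) x)) \<longlonglongrightarrow> 0"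
    unfolding g_def[symmetric]
    by (rule tendsto_sandwich[OF _ _ tendsto_const lim]) (use le in simp_all)
qed

lemma ogawa_sum_converges:
  assumes \<psi>: "complete_ons (Leb L) \<psi>" and f: "f \<in> sq_int (Leb L)" and c: "finite_var M L c"
  shows "\<exists>Z\<in>borel_measurable M. tendsto_in_prob M (\<lambda>n. ogawa_sum \<psi> n f c) Z"
  by (rule in_prob_complete) (auto intro: ogawa_sum_measurable complete_onsD \<psi> f c ogawa_sum_cons_diff_tendsto_0)

lemma has_u_integral_iff:
  assumes \<psi>: "is_CONS L (L2_real L) \<psi>" and f: "f \<in> sq_int (Leb L)" and c: "finite_var M L c"
  shows "has_u_integral M B L (integrand f c) Z \<longleftrightarrow>
    Z \<in> borel_measurable M \<and> tendsto_in_prob M (\<lambda>n. ogawa_sum \<psi> n f c) Z"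
proof -
  have og: "has_ogawa_integral M B L \<phi> (integrand f c) Z \<longleftrightarrow> Z \<in> borel_measurable M \<and> tendsto_in_prob M (\<lambda>n. ogawa_sum \<phi> n f c) Z" for \<phi>
    unfolding has_ogawa_integral_def ogawa_sum_def[abs_def] wiener_proj_def L2_inner_eq
    using integrand_L0_L2[OF f c L_pos] by (simp add: integrand_def)
  have "tendsto_in_prob M (\<lambda>n. ogawa_sum \<phi> n f c) Z"
    if Z: "Z \<in> borel_measurable M" "tendsto_in_prob M (\<lambda>n. ogawa_sum \<psi> n f c) Z" and \<phi>: "is_CONS L (L2_real L) \<phi>" for \<phi>
  proof -
    note \<phi>' = is_CONS_real[OF \<phi>] and \<psi>' = is_CONS_real[OF \<psi>]
    have m: "ogawa_sum \<phi> n f c \<in> borel_measurable M" "ogawa_sum \<psi> n f c \<in> borel_measurable M" for n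
      by (intro ogawa_sum_measurable complete_onsD \<phi>' \<psi>' f c)+
    have "tendsto_in_prob M (\<lambda>n w. (ogawa_sum \<phi> n f c w - ogawa_sum \<psi> n f c w) + ogawa_sum \<psi> n f c w) (\<lambda>w. 0 + Z w)"
      by (rule in_prob_add[OF ogawa_sum_cons_diff_tendsto_0[OF \<phi>' \<psi>' f c] Z(2)]) (use m Z(1) in auto)
    then show ?thesis by simp
  qed
  then show ?thesis using \<psi> unfolding has_u_integral_def og by blast
qed

lemma u_integral_limit:
  assumes \<psi>: "is_CONS L (L2_real L) \<psi>" and f: "f \<in> sq_int (Leb L)" and c: "finite_var M L c"
  shows "u_integral M B L (integrand f c) \<in> borel_measurable M"
    "tendsto_in_prob M (\<lambda>n. ogawa_sum \<psi> n f c) (u_integral M B L (integrand f c))"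
proof -
  have "\<exists>Z. has_u_integral M B L (integrand f c) Z"
    using ogawa_sum_converges[OF is_CONS_real[OF \<psi>] f c] has_u_integral_iff[OF assms] by blast
  then have "has_u_integral M B L (integrand f c) (u_integral M B L (integrand f c))"
    unfolding u_integral_def by (rule someI_ex)
  then show "u_integral M B L (integrand f c) \<in> borel_measurable M"
    "tendsto_in_prob M (\<lambda>n. ogawa_sum \<psi> n f c) (u_integral M B L (integrand f c))"
    using has_u_integral_iff[OF assms] by blast+
qed

text \<open>
  The functions \<open>f\<close> for which the u-integral of \<open>f c\<close> vanishes almost surely; by \<open>has_u_integral_iff\<close> it is
  enough to consider one complete system \<open>\<psi>\<close>.
\<close>

definition null_integrands :: "(nat \<Rightarrow> real \<Rightarrow> complex) \<Rightarrow> (real \<times> 'w \<Rightarrow> real) \<Rightarrow> (real \<Rightarrow> complex) set"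
  where "null_integrands \<psi> c = {f \<in> sq_int (Leb L). tendsto_in_prob M (\<lambda>n. ogawa_sum \<psi> n f c) (\<lambda>_. 0)}"

lemma u_integral_eq_iff:
  assumes \<psi>: "is_CONS L (L2_real L) \<psi>" and f: "f \<in> sq_int (Leb L)" and a: "finite_var M L a" "finite_var M L a'"
  shows "(AE w in M. u_integral M B L (integrand f a) w = u_integral M B L (integrand f a') w) \<longleftrightarrow>
     f \<in> null_integrands \<psi> (\<lambda>x. a x - a' x)"
proof -
  note o = complete_onsD[OF is_CONS_real[OF \<psi>]]
  let ?c = "\<lambda>x. a x - a' x" and ?Z = "u_integral M B L (integrand f a)" and ?Z' = "u_integral M B L (integrand f a')"
  note U = u_integral_limit[OF \<psi> f a(1)] and U' = u_integral_limit[OF \<psi> f a(2)]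
  have m: "ogawa_sum \<psi> n f c \<in> borel_measurable M" if "finite_var M L c" for n c by (rule ogawa_sum_measurable[OF o f that])
  have eq: "AE w in M. ogawa_sum \<psi> n f a w - ogawa_sum \<psi> n f a' w = ogawa_sum \<psi> n f ?c w" for n
    using bv_product_sq_int[OF f a(1) L_pos] bv_product_sq_int[OF f a(2) L_pos]
  proof eventually_elim
    case (elim w)
    show ?case unfolding ogawa_sum_def using wiener_proj_diff[OF o elim, of n w]
      by (simp add: right_diff_distrib)
  qed
  have lim: "tendsto_in_prob M (\<lambda>n. ogawa_sum \<psi> n f ?c) (\<lambda>w. ?Z w - ?Z' w)"
    by (rule in_prob_cong_AE[OF in_prob_diff[OF U(2) U'(2)] eq])
      (auto intro!: m finite_var_diff a borel_measurable_diff U(1) U'(1))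
  show ?thesis
  proof
    assume "AE w in M. ?Z w = ?Z' w"
    then have "AE w in M. ?Z w - ?Z' w = 0" by eventually_elim simp
    then have "tendsto_in_prob M (\<lambda>n. ogawa_sum \<psi> n f ?c) (\<lambda>_. 0)"
      by (intro in_prob_cong_AE[OF lim]) (auto intro!: m finite_var_diff a borel_measurable_diff U(1) U'(1))
    then show "f \<in> null_integrands \<psi> ?c" using f by (simp add: null_integrands_def)
  next
    assume "f \<in> null_integrands \<psi> ?c"
    then have "tendsto_in_prob M (\<lambda>n. ogawa_sum \<psi> n f ?c) (\<lambda>_. 0)" by (simp add: null_integrands_def)
    from in_prob_unique[OF lim this] have "AE w in M. ?Z w - ?Z' w = 0"
      by (auto intro!: m finite_var_diff a borel_measurable_diff U(1) U'(1))
    then show "AE w in M. ?Z w = ?Z' w" by eventually_elim simp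
  qed
qed

text \<open>
  For closedness let \<open>s\<^sub>k \<rightarrow> f\<close> with \<open>s\<^sub>k\<close> in the set.  The Ogawa sums of \<open>(f - s\<^sub>k) c\<close> are small uniformly in
  their length \<open>n\<close>, so if \<open>n\<^sub>k\<close> is taken so large that the sum of length \<open>n\<^sub>k\<close> for \<open>s\<^sub>k c\<close> is small as well, then
  the sums for \<open>f c\<close> tend to 0 along \<open>n\<^sub>k\<close>, and their limit is 0.
\<close>

lemma closed_subspace_null_integrands:
  assumes \<psi>: "complete_ons (Leb L) \<psi>" and c: "finite_var M L c"
  shows "closed_subspace (Leb L) (null_integrands \<psi> c)"
  unfolding closed_subspace_def
proof (intro conjI ballI allI impI)
  note o = complete_onsD[OF \<psi>]
  have m: "ogawa_sum \<psi> n f c \<in> borel_measurable M" if "f \<in> sq_int (Leb L)" for n f by (rule ogawa_sum_measurable[OF o that c])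
  have add: "AE w in M. ogawa_sum \<psi> n f c w + ogawa_sum \<psi> n g c w = ogawa_sum \<psi> n (\<lambda>x. f x + g x) c w"
    if "f \<in> sq_int (Leb L)" "g \<in> sq_int (Leb L)" for n f g
    using bv_product_sq_int[OF that(1) c L_pos] bv_product_sq_int[OF that(2) c L_pos]
  proof eventually_elim
    case (elim w)
    show ?case unfolding ogawa_sum_def using wiener_proj_add[OF o elim, of n w] by (simp add: distrib_right)
  qed
  have scale: "ogawa_sum \<psi> n (\<lambda>x. a * f x) c = (\<lambda>w. a * ogawa_sum \<psi> n f c w)" for a f n
    unfolding ogawa_sum_def by (simp add: mult.assoc wiener_proj_scale)
  show "(\<lambda>x. 0) \<in> null_integrands \<psi> c"
    using scale[of _ 0 "\<lambda>_. 0"] by (simp add: null_integrands_def tendsto_in_prob_def not_less)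
  fix f assume f: "f \<in> null_integrands \<psi> c"
  show "(\<lambda>x. a * f x) \<in> null_integrands \<psi> c" for a
    using f in_prob_scale[of "\<lambda>n. ogawa_sum \<psi> n f c" "\<lambda>_. 0" a]
    by (simp add: null_integrands_def scale sq_int_scale)
  fix g assume g: "g \<in> null_integrands \<psi> c"
  have s: "f \<in> sq_int (Leb L)" "g \<in> sq_int (Leb L)" using f g by (auto simp: null_integrands_def)
  have "tendsto_in_prob M (\<lambda>n w. ogawa_sum \<psi> n f c w + ogawa_sum \<psi> n g c w) (\<lambda>w. 0 + 0)"
    by (rule in_prob_add) (use f g m s in \<open>auto simp: null_integrands_def\<close>)
  then have "tendsto_in_prob M (\<lambda>n. ogawa_sum \<psi> n (\<lambda>x. f x + g x) c) (\<lambda>_. 0)"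
    by (rule in_prob_cong_AE[OF _ add[OF s]]) (auto intro!: m s sq_int_add borel_measurable_add)
  then show "(\<lambda>x. f x + g x) \<in> null_integrands \<psi> c" using s by (simp add: null_integrands_def sq_int_add)
next
  fix f s assume f: "f \<in> sq_int (Leb L)" and s: "\<forall>n. s n \<in> null_integrands \<psi> c \<inter> sq_int (Leb L)"
    and lim: "(\<lambda>n. sq_norm (Leb L) (\<lambda>x. f x - s n x)) \<longlonglongrightarrow> 0"
  note o = complete_onsD[OF \<psi>]
  have m: "ogawa_sum \<psi> n f c \<in> borel_measurable M" if "f \<in> sq_int (Leb L)" for n f by (rule ogawa_sum_measurable[OF o that c])
  have s': "s k \<in> sq_int (Leb L)" "tendsto_in_prob M (\<lambda>n. ogawa_sum \<psi> n (s k) c) (\<lambda>_. 0)" for k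
    using s by (auto simp: null_integrands_def)
  have d: "(\<lambda>x. f x - s k x) \<in> sq_int (Leb L)" for k by (rule sq_int_diff[OF f s'(1)])
  define q where "q k n = prob {w \<in> space M. norm (ogawa_sum \<psi> n (s k) c w - 0) > 1 / real (Suc k)}" for k n
  have "\<exists>n\<ge>k. q k n < 1 / real (Suc k)" for k
  proof -
    have "q k \<longlonglongrightarrow> 0" using s'(2)[of k] by (simp add: tendsto_in_prob_def q_def[abs_def])
    then have "\<forall>\<^sub>F n in sequentially. q k n < 1 / real (Suc k)" by (rule order_tendstoD(2)) simp
    then have "\<forall>\<^sub>F n in sequentially. k \<le> n \<and> q k n < 1 / real (Suc k)"
      by (intro eventually_conj eventually_ge_at_top)
    then show ?thesis by (auto dest!: eventually_happens)
  qed
  then obtain n where n: "\<And>k. k \<le> n k" "\<And>k. q k (n k) < 1 / real (Suc k)" by metis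
  have small: "tendsto_in_prob M (\<lambda>k. ogawa_sum \<psi> (n k) (s k) c) (\<lambda>_. 0)"
    unfolding tendsto_in_prob_def
  proof (intro allI impI)
    fix \<epsilon> :: real assume \<epsilon>: "0 < \<epsilon>"
    have "\<forall>\<^sub>F k in sequentially. 1 / real (Suc k) < \<epsilon>"
      using order_tendstoD(2)[OF LIMSEQ_inverse_real_of_nat \<epsilon>] by (simp add: inverse_eq_divide)
    then have le: "\<forall>\<^sub>F k in sequentially. prob {w \<in> space M. norm (ogawa_sum \<psi> (n k) (s k) c w - 0) > \<epsilon>} \<le> inverse (real (Suc k))"
    proof eventually_elim
      case (elim k)
      have [measurable]: "ogawa_sum \<psi> (n k) (s k) c \<in> borel_measurable M" by (rule m[OF s'(1)])
      have "prob {w \<in> space M. norm (ogawa_sum \<psi> (n k) (s k) c w - 0) > \<epsilon>} \<le> q k (n k)"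
        unfolding q_def using elim by (intro finite_measure_mono) auto
      then show ?case using n(2)[of k] by (simp add: inverse_eq_divide)
    qed
    show "(\<lambda>k. prob {w \<in> space M. norm (ogawa_sum \<psi> (n k) (s k) c w - 0) > \<epsilon>}) \<longlonglongrightarrow> 0"
      by (rule tendsto_sandwich[OF _ le tendsto_const LIMSEQ_inverse_real_of_nat]) simp
  qed
  have "Bseq (\<lambda>k. sq_norm (Leb L) (\<lambda>x. f x - s k x))" using lim by (intro convergent_imp_Bseq) (auto simp: convergent_def)
  then obtain E where "\<And>k. norm (sq_norm (Leb L) (\<lambda>x. f x - s k x)) \<le> E" unfolding Bseq_def by blast
  then have E: "sq_norm (Leb L) (\<lambda>x. f x - s k x) \<le> E" for k by (metis abs_le_D1 real_norm_def)
  \<comment> \<open>Here the second sum of the central estimate is empty.\<close>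
  have "tendsto_in_prob M (\<lambda>k w. ogawa_sum \<psi> (n k) (\<lambda>x. f x - s k x) c w - ogawa_sum \<psi> 0 (\<lambda>x. f x - s k x) c w) (\<lambda>_. 0)"
  proof (rule ogawa_sum_diff_tendsto_0[where m = "\<lambda>_. 0", OF o o d E c])
    fix u :: real assume u: "u \<in> {0..1}"
    let ?g = "\<lambda>k t. (f t - s k t) * indicator (quantile_set L (\<lambda>x. f x - s k x) u) t"
    have le: "sq_norm (Leb L) (\<lambda>x. ons_proj (Leb L) \<psi> (n k) (?g k) x - ons_proj (Leb L) \<psi> 0 (?g k) x) \<le> 4 * sq_norm (Leb L) (\<lambda>x. f x - s k x)" for k
    proof -
      have A: "quantile_set L (\<lambda>x. f x - s k x) u \<in> sets (Leb L)" by (intro initial_segment_sets quantile_set d u)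
      show ?thesis
        using sq_norm_proj_diff_le[OF o o sq_int_indicator[OF d[of k] A], where n = "n k" and m = 0] sq_norm_indicator_le[OF d[of k] A] by linarith
    qed
    have "(\<lambda>k. 4 * sq_norm (Leb L) (\<lambda>x. f x - s k x)) \<longlonglongrightarrow> 4 * 0" by (intro tendsto_mult_left lim)
    then have l: "(\<lambda>k. 4 * sq_norm (Leb L) (\<lambda>x. f x - s k x)) \<longlonglongrightarrow> 0" by simp
    show "(\<lambda>k. sq_norm (Leb L) (\<lambda>x. ons_proj (Leb L) \<psi> (n k) (?g k) x - ons_proj (Leb L) \<psi> 0 (?g k) x)) \<longlonglongrightarrow> 0"
      by (rule tendsto_sandwich[OF _ _ tendsto_const l]) (use le in simp_all)
  qed
  then have "tendsto_in_prob M (\<lambda>k w. ogawa_sum \<psi> (n k) (\<lambda>x. f x - s k x) c w) (\<lambda>_. 0)" by simp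
  from in_prob_add[OF this small] have sum: "tendsto_in_prob M (\<lambda>k w. ogawa_sum \<psi> (n k) (\<lambda>x. f x - s k x) c w + ogawa_sum \<psi> (n k) (s k) c w) (\<lambda>_. 0)"
    by (simp add: m d s')
  have "AE w in M. ogawa_sum \<psi> (n k) (\<lambda>x. f x - s k x) c w + ogawa_sum \<psi> (n k) (s k) c w = ogawa_sum \<psi> (n k) f c w" for k
    using bv_product_sq_int[OF f c L_pos] bv_product_sq_int[OF s'(1)[of k] c L_pos]
  proof eventually_elim
    case (elim w)
    show ?case unfolding ogawa_sum_def using wiener_proj_diff[OF o elim, of "n k" w] by (simp add: left_diff_distrib)
  qed
  then have sub: "tendsto_in_prob M (\<lambda>k. ogawa_sum \<psi> (n k) f c) (\<lambda>_. 0)"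
    by (rule in_prob_cong_AE[OF sum]) (auto intro!: borel_measurable_add m d s' f)
  obtain Z where Z: "Z \<in> borel_measurable M" "tendsto_in_prob M (\<lambda>n. ogawa_sum \<psi> n f c) Z"
    using ogawa_sum_converges[OF \<psi> f c] by blast
  have "AE w in M. Z w = 0"
    by (rule in_prob_unique[OF in_prob_compose_ge[OF Z(2) n(1)] sub]) (auto intro: m f Z)
  then have "tendsto_in_prob M (\<lambda>n. ogawa_sum \<psi> n f c) (\<lambda>_. 0)"
    by (intro in_prob_cong_AE[OF Z(2)]) (auto intro: m f Z)
  then show "f \<in> null_integrands \<psi> c" using f by (simp add: null_integrands_def)
qed

text \<open>
  Either condition forces the closed subspace to be all of \<open>L\<^sup>2\<close>.
\<close>

lemma null_integrands_determined:
  assumes \<psi>: "complete_ons (Leb L) \<psi>" and c: "finite_var M L c" and e: "complete_ons (Leb L) e"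
    and S: "S \<subseteq> horizon L" "horizon L \<subseteq> closure S"
  shows "(\<forall>n. (\<lambda>x. cnj (e n x)) \<in> null_integrands \<psi> c) \<longleftrightarrow> (\<forall>t\<in>S. (\<lambda>x. indicator {0..t} x) \<in> null_integrands \<psi> c)"
proof -
  note G = closed_subspace_null_integrands[OF \<psi> c]
  have e': "complete_ons (Leb L) (\<lambda>n x. cnj (e n x))" by (rule complete_ons_cnj[OF e])
  show ?thesis
  proof
    assume *: "\<forall>n. (\<lambda>x. cnj (e n x)) \<in> null_integrands \<psi> c"
    show "\<forall>t\<in>S. (\<lambda>x. indicator {0..t} x) \<in> null_integrands \<psi> c"
    proof
      fix t assume "t \<in> S"
      then have "(\<lambda>x. indicator {0..t} x) \<in> sq_int (Leb L)"
        using S(1) by (intro sq_int_Leb_indicator[OF atLeastAtMost_in_Leb]) auto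
      then show "(\<lambda>x. indicator {0..t} x) \<in> null_integrands \<psi> c"
        using e' by (intro closed_subspace_cons[OF G complete_onsD[OF e'] *[rule_format]]) (simp_all add: complete_ons_def)
    qed
  next
    assume "\<forall>t\<in>S. (\<lambda>x. indicator {0..t} x) \<in> null_integrands \<psi> c"
    then show "\<forall>n. (\<lambda>x. cnj (e n x)) \<in> null_integrands \<psi> c"
      by (intro allI closed_subspace_intervals_dense[OF G S _ L_pos orthonormal_sq_int[OF complete_onsD[OF e']]]) blast
  qed
qed

end

section \<open>Identification\<close>

lemma L0_class_eq_iff:
  assumes "Z \<in> borel_measurable M" "Z' \<in> borel_measurable M"
  shows "L0_class M Z = L0_class M Z' \<longleftrightarrow> (AE w in M. Z w = Z' w)"
proof
  assume "L0_class M Z = L0_class M Z'"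
  moreover have "Z \<in> L0_class M Z" using assms by (simp add: L0_class_def)
  ultimately have "Z \<in> L0_class M Z'" by simp
  then show "AE w in M. Z w = Z' w" by (simp add: L0_class_def)
next
  assume eq: "AE w in M. Z w = Z' w"
  have "(AE w in M. X w = Z w) \<longleftrightarrow> (AE w in M. X w = Z' w)" for X
  proof
    show "AE w in M. X w = Z' w" if "AE w in M. X w = Z w" using that eq by eventually_elim simp
    show "AE w in M. X w = Z w" if "AE w in M. X w = Z' w" using that eq by eventually_elim simp
  qed
  then show "L0_class M Z = L0_class M Z'" by (simp add: L0_class_def)
qed

lemma identified_iff: "identified A X h \<longleftrightarrow> (\<forall>a\<in>A. \<forall>a'\<in>A. X a = X a' \<longrightarrow> h a = h a')"
proof
  assume "identified A X h"
  then show "\<forall>a\<in>A. \<forall>a'\<in>A. X a = X a' \<longrightarrow> h a = h a'" unfolding identified_def by metis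
next
  assume *: "\<forall>a\<in>A. \<forall>a'\<in>A. X a = X a' \<longrightarrow> h a = h a'"
  have "h (SOME a'. a' \<in> A \<and> X a' = X a) = h a" if "a \<in> A" for a
    using someI_ex[of "\<lambda>a'. a' \<in> A \<and> X a' = X a"] * that by blast
  then show "identified A X h"
    unfolding identified_def by (intro exI[of _ "\<lambda>x. h (SOME a'. a' \<in> A \<and> X a' = x)"]) auto
qed

context brownian
begin

lemma SFC_eq_iff:
  assumes \<psi>: "is_CONS L (L2_real L) \<psi>" and a: "finite_var M L a" "finite_var M L a'"
    and b: "b \<in> L0_L2 M L" and e: "e \<in> sq_int (Leb L)"
  shows "SFC M B L b a e = SFC M B L b a' e \<longleftrightarrow> (\<lambda>x. cnj (e x)) \<in> null_integrands \<psi> (\<lambda>x. a x - a' x)"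
proof -
  let ?f = "\<lambda>x. cnj (e x)"
  note f = sq_int_cnj[OF e]
  have form: "(\<lambda>(s, w). cnj (e s) * complex_of_real (a (s, w))) = integrand ?f a" for a by (simp add: integrand_def)
  have [measurable]: "(\<lambda>w. LINT s|Leb L. cnj (e s) * b (s, w)) \<in> borel_measurable M"
    by (rule measurable_Leb_integral[OF sq_intD(1)[OF f]]) (use b in \<open>simp add: L0_L2_def\<close>)
  note [measurable] = u_integral_limit(1)[OF \<psi> f a(1)] u_integral_limit(1)[OF \<psi> f a(2)]
  show ?thesis
    unfolding SFC_def form u_integral_eq_iff[OF \<psi> f a, symmetric]
    by (subst L0_class_eq_iff) auto
qed

lemma Y_process_eq_iff:
  assumes \<psi>: "is_CONS L (L2_real L) \<psi>" and a: "finite_var M L a" "finite_var M L a'"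
    and b: "b \<in> L0_L2 M L" and t: "t \<in> horizon L"
  shows "Y_process M B L b a t = Y_process M B L b a' t \<longleftrightarrow> (\<lambda>x. indicator {0..t} x) \<in> null_integrands \<psi> (\<lambda>x. a x - a' x)"
proof -
  let ?f = "\<lambda>x. indicator {0..t} x"
  have f: "?f \<in> sq_int (Leb L)" by (rule sq_int_Leb_indicator[OF atLeastAtMost_in_Leb[OF t]]) auto
  have form: "(\<lambda>(s, w). complex_of_real (a (s, w)) * indicator {0..t} s) = integrand ?f a" for a
    by (simp add: integrand_def mult.commute)
  have "(LINT s:{0..t}|lebesgue. b (s, w)) = (LINT s|Leb L. indicator {0..t} s * b (s, w))" for w
  proof -
    have "(LINT s|Leb L. indicator {0..t} s * b (s, w)) = (LINT s|lebesgue. indicator (horizon L) s *\<^sub>R (indicator {0..t} s * b (s, w)))"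
      by (rule integral_restrict_space) auto
    also have "\<dots> = (LINT s:{0..t}|lebesgue. b (s, w))"
      unfolding set_lebesgue_integral_def
      by (intro Bochner_Integration.integral_cong refl) (use horizon_downward[OF t] in \<open>auto simp: indicator_def\<close>)
    finally show ?thesis ..
  qed
  moreover have "(\<lambda>w. LINT s|Leb L. indicator {0..t} s * b (s, w)) \<in> borel_measurable M"
    by (rule measurable_Leb_integral[OF sq_intD(1)[OF f]]) (use b in \<open>simp add: L0_L2_def\<close>)
  ultimately have [measurable]: "(\<lambda>w. LINT s:{0..t}|lebesgue. b (s, w)) \<in> borel_measurable M" by simp
  note [measurable] = u_integral_limit(1)[OF \<psi> f a(1)] u_integral_limit(1)[OF \<psi> f a(2)]
  show ?thesis
    unfolding Y_process_def form u_integral_eq_iff[OF \<psi> f a, symmetric]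
    by (subst L0_class_eq_iff) auto
qed

end

theorem corollary6p1:
  fixes M :: "'w measure"
    and B :: "real \<Rightarrow> 'w \<Rightarrow> real"
    and L :: ereal
    and e :: "nat \<Rightarrow> real \<Rightarrow> complex"
    and b :: "real \<times> 'w \<Rightarrow> complex"
    and \<S> :: "(real \<times> 'w \<Rightarrow> real) set"
    and S :: "real set"
    and h :: "(real \<times> 'w \<Rightarrow> real) \<Rightarrow> 'c"
  assumes "prob_space M"
    and "brownian_motion M B"
    and "0 < L"
    and "is_CONS L (L2 L) e"
    and "b \<in> L0_L2 M L"
    and "\<And>n. compactly_supported L (e n)"
    and "\<S> \<subseteq> fv_processes M L"
    and "S \<subseteq> horizon L" and "horizon L \<subseteq> closure S"
  shows "identified \<S> (\<lambda>a n. SFC M B L b a (e n)) h \<longleftrightarrow>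
         identified \<S> (\<lambda>a. \<lambda>t\<in>S. Y_process M B L b a t) h"
proof -
  interpret prob_space M by fact
  interpret brownian M B L by unfold_locales (fact assms)+
  have e: "complete_ons (Leb L) e" using assms(4) by (simp add: is_CONS_complex)
  have "(\<lambda>n. SFC M B L b a (e n)) = (\<lambda>n. SFC M B L b a' (e n)) \<longleftrightarrow>
      (\<lambda>t\<in>S. Y_process M B L b a t) = (\<lambda>t\<in>S. Y_process M B L b a' t)"
    if a: "a \<in> \<S>" "a' \<in> \<S>" for a a'
  proof (cases "\<exists>\<psi>. is_CONS L (L2_real L) \<psi>")
    case False
    \<comment> \<open>If there were no complete system of the real space, every random variable would be a u-integral of every
      integrand, and neither side would depend on the process.  This disposes of that case without the
      construction of a system.\<close>
    then have "u_integral M B L f = (SOME Z. True)" for f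
      by (simp add: u_integral_def has_u_integral_def)
    then show ?thesis by (simp only: SFC_def Y_process_def) simp
  next
    case True
    then obtain \<psi> where \<psi>: "is_CONS L (L2_real L) \<psi>" ..
    have finite_var: "finite_var M L a" "finite_var M L a'" using a assms(7) by (auto intro: fv_processes_finite_var)
    let ?G = "null_integrands \<psi> (\<lambda>x. a x - a' x)"
    have "(\<lambda>n. SFC M B L b a (e n)) = (\<lambda>n. SFC M B L b a' (e n)) \<longleftrightarrow> (\<forall>n. (\<lambda>x. cnj (e n x)) \<in> ?G)"
      by (simp add: fun_eq_iff SFC_eq_iff[OF \<psi> finite_var assms(5) orthonormal_sq_int[OF complete_onsD[OF e]]])
    also have "\<dots> \<longleftrightarrow> (\<forall>t\<in>S. (\<lambda>x. indicator {0..t} x) \<in> ?G)"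
      by (rule null_integrands_determined[OF is_CONS_real[OF \<psi>] finite_var_diff[OF finite_var] e assms(8,9)])
    also have "\<dots> \<longleftrightarrow> (\<forall>t\<in>S. Y_process M B L b a t = Y_process M B L b a' t)"
      using assms(8) by (intro ball_cong refl Y_process_eq_iff[OF \<psi> finite_var assms(5), symmetric]) auto
    also have "\<dots> \<longleftrightarrow> (\<lambda>t\<in>S. Y_process M B L b a t) = (\<lambda>t\<in>S. Y_process M B L b a' t)"
      unfolding restrict_def by metis
    finally show ?thesis .
  qed
  then show ?thesis unfolding identified_iff by (intro ball_cong refl) simp
qed

end
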